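(* Let $k \ge 3$ be fixed. For all sufficiently large $n$ with $n \equiv 1 \pmod{2k}$ there is a regular $n$-vertex tournament $T$ such that $\nu_k(T)=\nu^*_k(T)=\frac{n(n-1)}{2k}$ and $\tau_k(T) = \frac{n^2}{4}-o(n^2)$ (where $o(n^2)/n^2\to 0$ as $n\to\infty$).
   Context: A tournament is an orientation of a complete graph; it is regular if all vertices have the same out-degree. $\overrightarrow{C_k}$ is the directed cycle on $k$ vertices. For a directed graph $D$ (unweighted, i.e. all arc weights 1): $\nu_k(D)$ is the maximum number of pairwise arc-disjoint copies of $\overrightarrow{C_k}$ in $D$; $\tau_k(D)$ is the minimum number of arcs whose removal leaves no copy of $\overrightarrow{C_k}$; a fractional $\overrightarrow{C_k}$-packing is a function $m$ from the set of copies of $\overrightarrow{C_k}$ in $D$ to $[0,\infty)$ such that for every arc $e$ the sum of $m(X)$ over copies $X$ containing $e$ is at most $1$, and $\nu_k^*(D)$ is the maximum of $\sum_X m(X)$ over fractional packings. *)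

theory Defs
  imports
    "Graph_Theory.Pair_Digraph"
    "Graph_Theory.Digraph_Component"
    "Graph_Theory.Digraph_Isomorphism"
    "HOL-Library.Landau_Symbols"
    "HOL-Number_Theory.Cong"
begin

locale tournament = pair_digraph G for G :: "'a pair_pre_digraph" +
  assumes exactly_one_arc:
    "\<lbrakk>u \<in> pverts G; v \<in> pverts G; u \<noteq> v\<rbrakk> \<Longrightarrow> ((u, v) \<in> parcs G) \<noteq> ((v, u) \<in> parcs G)"

definition regular_tournament :: "'a pair_pre_digraph \<Rightarrow> bool" where
  "regular_tournament T \<longleftrightarrow>
     tournament T \<and> (\<exists>d. \<forall>v \<in> pverts T. out_degree (with_proj T) v = d)"

definition directed_cycle :: "nat \<Rightarrow> nat pair_pre_digraph" where
  "directed_cycle k = \<lparr>pverts = {..<k}, parcs = (\<lambda>i. (i, Suc i mod k)) ` {..<k}\<rparr>"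

text \<open>Copies are subgraphs, not labelled embeddings: rotations of a cycle count once.\<close>

definition cycle_copies :: "nat \<Rightarrow> 'a pair_pre_digraph \<Rightarrow> 'a pair_pre_digraph set" where
  "cycle_copies k D =
     {X. subgraph (with_proj X) (with_proj D) \<and>
         digraph_iso (with_proj (directed_cycle k)) (with_proj X)}"

definition arc_disjoint :: "'a pair_pre_digraph \<Rightarrow> 'a pair_pre_digraph \<Rightarrow> bool" where
  "arc_disjoint X Y \<longleftrightarrow> parcs X \<inter> parcs Y = {}"

definition nu :: "nat \<Rightarrow> 'a pair_pre_digraph \<Rightarrow> nat" where
  "nu k D = Max {card P | P. P \<subseteq> cycle_copies k D \<and> pairwise arc_disjoint P}"

definition tau :: "nat \<Rightarrow> 'a pair_pre_digraph \<Rightarrow> nat" where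
  "tau k D =
     Min {card F | F. F \<subseteq> parcs D \<and> cycle_copies k (D\<lparr>parcs := parcs D - F\<rparr>) = {}}"

definition fractional_packing ::
    "nat \<Rightarrow> 'a pair_pre_digraph \<Rightarrow> ('a pair_pre_digraph \<Rightarrow> real) \<Rightarrow> bool" where
  "fractional_packing k D m \<longleftrightarrow>
     (\<forall>X \<in> cycle_copies k D. 0 \<le> m X) \<and>
     (\<forall>e \<in> parcs D. (\<Sum>X \<in> {X \<in> cycle_copies k D. e \<in> parcs X}. m X) \<le> 1)"

text \<open>The set of values is infinite, so \<^const>\<open>Max\<close> does not apply;
  \<^const>\<open>Greatest\<close> denotes its maximum.\<close>

definition nu_frac :: "nat \<Rightarrow> 'a pair_pre_digraph \<Rightarrow> real" where
  "nu_frac k D =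
     (GREATEST s. \<exists>m. fractional_packing k D m \<and> s = (\<Sum>X \<in> cycle_copies k D. m X))"

end

theory Submission
  imports Defs "HOL-Probability.Hoeffding"
begin

text \<open>
  Decompose \<open>K\<^sub>n\<close> into \<open>k\<close>-cycles and orient each cycle at random in one of its two directions. Every
  such orientation is a regular tournament whose arcs are partitioned into copies of the directed
  cycle, which settles the packing numbers. With positive probability the arcs from \<open>A\<close> to \<open>B\<close>
  number at most \<open>|A||B|/2 + o(n\<^sup>2)\<close> for all vertex sets \<open>A, B\<close>.

  Let \<open>H\<close> be a subgraph of such a tournament with at least \<open>(1/4 + \<epsilon>) n\<^sup>2\<close> arcs. By weak regularity
  \<open>H\<close> is close in cut norm to a block kernel \<open>W\<close>, whose values are essentially at most \<open>1/2\<close>; hence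
  more than half of all ordered pairs have non-negligible weight in \<open>W\<close>. A digraph with more
  than \<open>n\<^sup>2/2\<close> arcs has two-way arcs, even inside a subset of large minimum degree where each
  two-way arc lies on many directed triangles, and therefore a positive proportion of all
  \<open>k\<close>-tuples are closed walks. The cut norm transfers this to \<open>H\<close>, so \<open>H\<close> contains a \<open>k\<close>-cycle:
  a set of arcs meeting all \<open>k\<close>-cycles has at least \<open>n\<^sup>2/4 - o(n\<^sup>2)\<close> elements.

  For \<open>n = 2kp + 1\<close> the vertices of \<open>K\<^sub>n\<close> are one special point and \<open>p\<close> groups of \<open>2k\<close> points. Each
  group and the special point carry a cyclic decomposition of \<open>K\<^bsub>2k+1\<^esub>\<close>. The edges between the groups
  are covered by zigzags between two groups if \<open>k\<close> is even; if \<open>k\<close> is odd, a zigzag needs a vertex on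
  a third level to close up, and the levels are combined by a commutative quasigroup with holes of
  size two.
\<close>

section \<open>Cycles as lists of vertices\<close>

definition cycles_on :: "'a set \<Rightarrow> nat \<Rightarrow> 'a list set" where
  "cycles_on V k = {ws. length ws = k \<and> distinct ws \<and> set ws \<subseteq> V}"

definition cycle_arcs :: "'a list \<Rightarrow> 'a rel" where
  "cycle_arcs ws = set (zip ws (rotate1 ws))"

definition cycle_edges :: "'a list \<Rightarrow> 'a rel" where
  "cycle_edges ws = cycle_arcs ws \<union> (cycle_arcs ws)\<inverse>"

lemma finite_cycles_on: "finite V \<Longrightarrow> finite (cycles_on V k)"
  by (rule finite_subset[OF _ finite_lists_length_eq[of V k]]) (auto simp: cycles_on_def)

lemma cycles_on_mono: "V \<subseteq> W \<Longrightarrow> cycles_on V k \<subseteq> cycles_on W k"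
  by (auto simp: cycles_on_def)

lemma map_in_cycles_on:
  "ws \<in> cycles_on V k \<Longrightarrow> inj_on f V \<Longrightarrow> f ` V \<subseteq> W \<Longrightarrow> map f ws \<in> cycles_on W k"
  by (auto simp: cycles_on_def distinct_map intro: inj_on_subset)

lemma cycle_arcs_conv_nth:
  "cycle_arcs ws = (\<lambda>j. (ws ! j, ws ! (Suc j mod length ws))) ` {..<length ws}"
  by (auto simp: cycle_arcs_def set_zip nth_rotate1 image_iff)

lemma successively_closed_walk_iff:
  "successively P (x # ws @ [x]) \<longleftrightarrow> (\<forall>(u, v)\<in>cycle_arcs (x # ws). P u v)"
proof -
  have "successively P (x # ws @ [y]) \<longleftrightarrow> (\<forall>(u, v)\<in>set (zip (x # ws) (ws @ [y])). P u v)" for y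
    by (induction ws arbitrary: x) auto
  then show ?thesis by (simp add: cycle_arcs_def)
qed

lemma finite_cycle_arcs [simp]: "finite (cycle_arcs ws)"
  by (simp add: cycle_arcs_def)

lemma cycle_arcs_subset: "cycle_arcs ws \<subseteq> set ws \<times> set ws"
  by (auto simp: cycle_arcs_def dest: set_zip_leftD set_zip_rightD)

lemma card_cycle_arcs: "distinct ws \<Longrightarrow> card (cycle_arcs ws) = length ws"
  by (simp add: cycle_arcs_def distinct_zipI1 distinct_card)

lemma cycle_arcs_map: "cycle_arcs (map f ws) = map_prod f f ` cycle_arcs ws"
  by (simp add: cycle_arcs_def rotate1_map zip_map_map map_prod_def)

lemma cycle_arcs_rev: "cycle_arcs (rev ws) = (cycle_arcs ws)\<inverse>"
proof -
  have sub: "cycle_arcs (rev ws) \<subseteq> (cycle_arcs ws)\<inverse>" for ws :: "'a list"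
  proof
    let ?k = "length ws"
    fix e assume "e \<in> cycle_arcs (rev ws)"
    then obtain j where j: "j < ?k" and e: "e = (rev ws ! j, rev ws ! (Suc j mod ?k))"
      by (auto simp: cycle_arcs_conv_nth)
    define i where "i = ?k - 1 - Suc j mod ?k"
    have "Suc j mod ?k < ?k" using j by (intro mod_less_divisor) auto
    then have i: "rev ws ! (Suc j mod ?k) = ws ! i" "i < ?k" using j by (auto simp: i_def rev_nth)
    have "Suc i mod ?k = ?k - 1 - j" using j by (cases "Suc j = ?k") (auto simp: i_def mod_Suc)
    then have "rev ws ! j = ws ! (Suc i mod ?k)" using j by (simp add: rev_nth)
    then show "e \<in> (cycle_arcs ws)\<inverse>" using e i by (auto simp: cycle_arcs_conv_nth)
  qed
  show ?thesis using sub[of ws] sub[of "rev ws"] by auto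
qed

lemma card_cycle_arcs_Image:
  assumes "distinct ws"
  shows "card (cycle_arcs ws `` {v}) = of_bool (v \<in> set ws)"
proof (cases "v \<in> set ws")
  case True
  then obtain i where i: "i < length ws" "v = ws ! i" by (auto simp: in_set_conv_nth)
  have "cycle_arcs ws `` {v} = {ws ! (Suc i mod length ws)}"
    using i assms by (auto simp: cycle_arcs_conv_nth Image_iff nth_eq_iff_index_eq)
  then show ?thesis using True by simp
next
  case False
  then have "cycle_arcs ws `` {v} = {}" using cycle_arcs_subset[of ws] by auto
  then show ?thesis using False by simp
qed

lemma cycle_arcs_disjoint_converse:
  assumes "distinct ws" "3 \<le> length ws"
  shows "cycle_arcs ws \<inter> (cycle_arcs ws)\<inverse> = {}"
proof (rule equals0I)
  let ?k = "length ws"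
  fix e assume "e \<in> cycle_arcs ws \<inter> (cycle_arcs ws)\<inverse>"
  then obtain i j where ij: "i < ?k" "j < ?k"
    and eq: "ws ! i = ws ! (Suc j mod ?k)" "ws ! j = ws ! (Suc i mod ?k)"
    by (auto simp: cycle_arcs_conv_nth)
  have "Suc i mod ?k < ?k" "Suc j mod ?k < ?k" using ij by (auto intro!: mod_less_divisor)
  then have "i = Suc j mod ?k" "j = Suc i mod ?k"
    using ij eq assms(1) by (simp_all add: nth_eq_iff_index_eq)
  then have "Suc (Suc i) mod ?k = i mod ?k" using ij(1) by (metis mod_Suc_eq mod_less)
  then have "?k dvd 2" by (simp add: mod_eq_dvd_iff_nat)
  then show False using assms(2) by (auto dest: dvd_imp_le)
qed

lemma cycle_arcs_irrefl: "distinct ws \<Longrightarrow> 3 \<le> length ws \<Longrightarrow> (v, v) \<notin> cycle_arcs ws"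
  using cycle_arcs_disjoint_converse[of ws] by blast

lemma finite_cycle_edges [simp]: "finite (cycle_edges ws)"
  by (simp add: cycle_edges_def)

lemma cycle_edges_sym: "(u, v) \<in> cycle_edges ws \<Longrightarrow> (v, u) \<in> cycle_edges ws"
  by (auto simp: cycle_edges_def)

lemma cycle_edges_rev: "cycle_edges (rev ws) = cycle_edges ws"
  by (auto simp: cycle_edges_def cycle_arcs_rev)

lemma cycle_edges_map: "cycle_edges (map f ws) = map_prod f f ` cycle_edges ws"
  by (auto simp: cycle_edges_def cycle_arcs_map)

lemma cycle_edges_subset: "cycle_edges ws \<subseteq> set ws \<times> set ws"
  using cycle_arcs_subset by (auto simp: cycle_edges_def)

lemma card_cycle_edges:
  "distinct ws \<Longrightarrow> 3 \<le> length ws \<Longrightarrow> card (cycle_edges ws) = 2 * length ws"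
  by (simp add: cycle_edges_def card_Un_disjoint cycle_arcs_disjoint_converse card_cycle_arcs)

lemma cycle_edges_irrefl: "distinct ws \<Longrightarrow> 3 \<le> length ws \<Longrightarrow> (v, v) \<notin> cycle_edges ws"
  using cycle_arcs_irrefl[of ws v] by (auto simp: cycle_edges_def)

section \<open>Weak regularity\<close>

definition block :: "'a set \<Rightarrow> ('a \<Rightarrow> nat) \<Rightarrow> 'a \<Rightarrow> 'a set" where
  "block V \<phi> x = {x' \<in> V. \<phi> x = \<phi> x'}"

definition block_avg :: "'a set \<Rightarrow> ('a \<Rightarrow> nat) \<Rightarrow> ('a \<Rightarrow> real) \<Rightarrow> 'a \<Rightarrow> real" where
  "block_avg V \<phi> f x = (\<Sum>x'\<in>block V \<phi> x. f x') / card (block V \<phi> x)"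

definition block_avg2 :: "'a set \<Rightarrow> ('a \<Rightarrow> nat) \<Rightarrow> ('a \<Rightarrow> 'a \<Rightarrow> real) \<Rightarrow> 'a \<Rightarrow> 'a \<Rightarrow> real" where
  "block_avg2 V \<phi> h x y = block_avg V \<phi> (\<lambda>x'. block_avg V \<phi> (h x') y) x"

definition unit_kernel :: "'a set \<Rightarrow> ('a \<Rightarrow> 'a \<Rightarrow> real) \<Rightarrow> bool" where
  "unit_kernel V h \<longleftrightarrow> (\<forall>x\<in>V. \<forall>y\<in>V. 0 \<le> h x y \<and> h x y \<le> 1)"

definition cut_close :: "'a set \<Rightarrow> real \<Rightarrow> ('a \<Rightarrow> 'a \<Rightarrow> real) \<Rightarrow> ('a \<Rightarrow> 'a \<Rightarrow> real) \<Rightarrow> bool" where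
  "cut_close V \<eta> g h \<longleftrightarrow> (\<forall>A\<subseteq>V. \<forall>B\<subseteq>V. \<bar>\<Sum>x\<in>A. \<Sum>y\<in>B. g x y - h x y\<bar> \<le> \<eta> * (real (card V))\<^sup>2)"

lemma block_subset: "block V \<phi> x \<subseteq> V"
  by (auto simp: block_def)

lemma finite_block [simp]: "finite V \<Longrightarrow> finite (block V \<phi> x)"
  by (simp add: block_def)

lemma block_avg_nonneg:
  assumes "\<And>x. x \<in> V \<Longrightarrow> 0 \<le> f x"
  shows "0 \<le> block_avg V \<phi> f x"
  unfolding block_avg_def using assms block_subset[of V \<phi> x]
  by (intro divide_nonneg_nonneg sum_nonneg) auto

lemma block_avg_le:
  assumes "\<And>x. x \<in> V \<Longrightarrow> f x \<le> c" "0 \<le> c"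
  shows "block_avg V \<phi> f x \<le> c"
proof -
  have "(\<Sum>x'\<in>block V \<phi> x. f x') \<le> card (block V \<phi> x) * c"
    using assms(1) block_subset[of V \<phi> x] by (intro sum_bounded_above) auto
  then show ?thesis
    using \<open>0 \<le> c\<close> by (cases "card (block V \<phi> x) = 0")
      (simp_all add: block_avg_def divide_le_eq mult.commute del: card_eq_0_iff)
qed

lemma sum_block_avg:
  assumes fin: "finite V" and g: "\<And>x x'. x \<in> V \<Longrightarrow> x' \<in> V \<Longrightarrow> \<phi> x = \<phi> x' \<Longrightarrow> g x = g x'"
  shows "(\<Sum>x\<in>V. block_avg V \<phi> f x * g x) = (\<Sum>x\<in>V. f x * g x)"
proof -
  let ?c = "\<lambda>x. real (card (block V \<phi> x))"
  have "(\<Sum>x\<in>V. block_avg V \<phi> f x * g x) = (\<Sum>x\<in>V. \<Sum>x'\<in>block V \<phi> x. f x' * g x / ?c x)"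
    by (simp add: block_avg_def sum_distrib_right sum_divide_distrib)
  also have "\<dots> = (\<Sum>x'\<in>V. \<Sum>x | x \<in> V \<and> \<phi> x = \<phi> x'. f x' * g x / ?c x)"
    unfolding block_def by (rule sum.swap_restrict[OF fin fin])
  also have "\<dots> = (\<Sum>x'\<in>V. \<Sum>x\<in>block V \<phi> x'. f x' * g x' / ?c x')"
  proof (intro sum.cong refl)
    show "{x \<in> V. \<phi> x = \<phi> y} = block V \<phi> y" for y by (auto simp: block_def)
    fix y x assume "y \<in> V" "x \<in> block V \<phi> y"
    then have "g x = g y" "block V \<phi> x = block V \<phi> y" using g[of x y] by (auto simp: block_def)
    then show "f y * g x / ?c x = f y * g y / ?c y" by simp
  qed
  also have "\<dots> = (\<Sum>x'\<in>V. f x' * g x')"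
  proof (rule sum.cong[OF refl])
    fix y assume "y \<in> V"
    then have "0 < card (block V \<phi> y)" using fin by (auto simp: card_gt_0_iff block_def)
    then show "(\<Sum>x\<in>block V \<phi> y. f y * g y / ?c y) = f y * g y" by simp
  qed
  finally show ?thesis .
qed

lemma sum_block_avg2:
  assumes fin: "finite V"
    and g: "\<And>x x' y y'. x \<in> V \<Longrightarrow> x' \<in> V \<Longrightarrow> y \<in> V \<Longrightarrow> y' \<in> V \<Longrightarrow> \<phi> x = \<phi> x' \<Longrightarrow> \<phi> y = \<phi> y'
      \<Longrightarrow> g x y = g x' y'"
  shows "(\<Sum>x\<in>V. \<Sum>y\<in>V. block_avg2 V \<phi> h x y * g x y) = (\<Sum>x\<in>V. \<Sum>y\<in>V. h x y * g x y)"
proof -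
  have "(\<Sum>x\<in>V. \<Sum>y\<in>V. block_avg2 V \<phi> h x y * g x y)
      = (\<Sum>y\<in>V. \<Sum>x\<in>V. block_avg V \<phi> (\<lambda>x'. block_avg V \<phi> (h x') y) x * g x y)"
    unfolding block_avg2_def by (rule sum.swap)
  also have "\<dots> = (\<Sum>y\<in>V. \<Sum>x\<in>V. block_avg V \<phi> (h x) y * g x y)"
    by (rule sum.cong[OF refl], rule sum_block_avg[OF fin]) (auto intro: g)
  also have "\<dots> = (\<Sum>x\<in>V. \<Sum>y\<in>V. block_avg V \<phi> (h x) y * g x y)"
    by (rule sum.swap)
  also have "\<dots> = (\<Sum>x\<in>V. \<Sum>y\<in>V. h x y * g x y)"
    by (rule sum.cong[OF refl], rule sum_block_avg[OF fin]) (auto intro: g)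
  finally show ?thesis .
qed

lemma block_avg2_cong:
  "\<phi> x = \<phi> x' \<Longrightarrow> \<phi> y = \<phi> y' \<Longrightarrow> block_avg2 V \<phi> h x y = block_avg2 V \<phi> h x' y'"
  by (simp add: block_avg2_def block_avg_def block_def)

lemma block_avg2_eq:
  "block_avg2 V \<phi> h x y = (\<Sum>x'\<in>block V \<phi> x. \<Sum>y'\<in>block V \<phi> y. h x' y')
     / (real (card (block V \<phi> x)) * real (card (block V \<phi> y)))"
  by (simp add: block_avg2_def block_avg_def mult.commute flip: sum_divide_distrib)

lemma unit_kernel_block_avg2:
  assumes "unit_kernel V h"
  shows "unit_kernel V (block_avg2 V \<phi> h)"
  unfolding unit_kernel_def block_avg2_def using assms[unfolded unit_kernel_def]
  by (auto intro!: block_avg_nonneg block_avg_le)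

lemma sum_block_avg2_refinement:
  assumes fin: "finite V" and ref: "\<And>x y. x \<in> V \<Longrightarrow> y \<in> V \<Longrightarrow> \<psi> x = \<psi> y \<Longrightarrow> \<phi> x = \<phi> y"
  shows "(\<Sum>x\<in>V. \<Sum>y\<in>V. (block_avg2 V \<psi> h x y - block_avg2 V \<phi> h x y)\<^sup>2)
    = (\<Sum>x\<in>V. \<Sum>y\<in>V. (block_avg2 V \<psi> h x y)\<^sup>2) - (\<Sum>x\<in>V. \<Sum>y\<in>V. (block_avg2 V \<phi> h x y)\<^sup>2)"
proof -
  let ?S = "\<lambda>f. \<Sum>x\<in>V. \<Sum>y\<in>V. f x y :: real"
  let ?P = "block_avg2 V \<psi> h" and ?W = "block_avg2 V \<phi> h"
  have "?S (\<lambda>x y. ?P x y * ?W x y) = ?S (\<lambda>x y. h x y * ?W x y)"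
    by (intro sum_block_avg2[OF fin] block_avg2_cong) (auto intro: ref)
  also have "\<dots> = ?S (\<lambda>x y. ?W x y * ?W x y)"
    by (rule sum_block_avg2[OF fin, symmetric]) (rule block_avg2_cong)
  finally have "?S (\<lambda>x y. ?P x y * ?W x y) = ?S (\<lambda>x y. (?W x y)\<^sup>2)" by (simp add: power2_eq_square)
  moreover have "?S (\<lambda>x y. (?P x y - ?W x y)\<^sup>2)
      = ?S (\<lambda>x y. (?P x y)\<^sup>2) - 2 * ?S (\<lambda>x y. ?P x y * ?W x y) + ?S (\<lambda>x y. (?W x y)\<^sup>2)"
    by (simp add: power2_diff sum.distrib sum_subtractf sum_distrib_left mult.assoc)
  ultimately show ?thesis by simp
qed

lemma double_sum_Cauchy_Schwarz:
  fixes f g :: "'a \<Rightarrow> 'b \<Rightarrow> real"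
  shows "(\<Sum>x\<in>A. \<Sum>y\<in>B. f x y * g x y)\<^sup>2
    \<le> (\<Sum>x\<in>A. \<Sum>y\<in>B. (f x y)\<^sup>2) * (\<Sum>x\<in>A. \<Sum>y\<in>B. (g x y)\<^sup>2)"
  using Cauchy_Schwarz_ineq_sum[of "\<lambda>p. f (fst p) (snd p)" "\<lambda>p. g (fst p) (snd p)" "A \<times> B"]
  by (simp add: sum.cartesian_product split_def)

lemma double_sum_restrict:
  fixes f :: "'a \<Rightarrow> 'a \<Rightarrow> real"
  assumes "finite V" "A \<subseteq> V" "B \<subseteq> V"
  shows "(\<Sum>x\<in>V. \<Sum>y\<in>V. f x y * (of_bool (x \<in> A) * of_bool (y \<in> B))) = (\<Sum>x\<in>A. \<Sum>y\<in>B. f x y)"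
proof -
  have "(\<Sum>x\<in>V. \<Sum>y\<in>V. f x y * (of_bool (x \<in> A) * of_bool (y \<in> B)))
      = (\<Sum>x\<in>V. if x \<in> A then \<Sum>y\<in>V. if y \<in> B then f x y else 0 else 0)"
    by (intro sum.cong refl) (auto intro!: sum.cong)
  then show ?thesis
    using assms by (simp add: sum.If_cases Int_absorb1)
qed

lemma square_cut_sum_le:
  fixes f :: "'a \<Rightarrow> 'a \<Rightarrow> real"
  assumes "finite V" "A \<subseteq> V" "B \<subseteq> V"
  shows "(\<Sum>x\<in>A. \<Sum>y\<in>B. f x y)\<^sup>2 \<le> (\<Sum>x\<in>V. \<Sum>y\<in>V. (f x y)\<^sup>2) * (real (card V))\<^sup>2"
proof -
  let ?g = "\<lambda>x y. of_bool (x \<in> A) * of_bool (y \<in> B) :: real"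
  have "(\<Sum>x\<in>A. \<Sum>y\<in>B. f x y)\<^sup>2 \<le> (\<Sum>x\<in>V. \<Sum>y\<in>V. (f x y)\<^sup>2) * (\<Sum>x\<in>V. \<Sum>y\<in>V. (?g x y)\<^sup>2)"
    unfolding double_sum_restrict[OF assms, symmetric] by (rule double_sum_Cauchy_Schwarz)
  also have "(\<Sum>x\<in>V. \<Sum>y\<in>V. (?g x y)\<^sup>2) \<le> (\<Sum>x\<in>V. \<Sum>y\<in>V. 1)" by (intro sum_mono) auto
  finally show ?thesis by (simp add: power2_eq_square mult_left_mono sum_nonneg)
qed

lemma energy_increment:
  fixes \<eta> :: real
  assumes fin: "finite V" and A: "A \<subseteq> V" and B: "B \<subseteq> V" and \<eta>: "0 \<le> \<eta>"
    and ref: "\<And>x y. x \<in> V \<Longrightarrow> y \<in> V \<Longrightarrow> \<psi> x = \<psi> y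
      \<Longrightarrow> \<phi> x = \<phi> y \<and> (x \<in> A \<longleftrightarrow> y \<in> A) \<and> (x \<in> B \<longleftrightarrow> y \<in> B)"
    and deviation: "\<eta> * (real (card V))\<^sup>2 < \<bar>\<Sum>x\<in>A. \<Sum>y\<in>B. h x y - block_avg2 V \<phi> h x y\<bar>"
  shows "(\<Sum>x\<in>V. \<Sum>y\<in>V. (block_avg2 V \<phi> h x y)\<^sup>2) + \<eta>\<^sup>2 * (real (card V))\<^sup>2
    \<le> (\<Sum>x\<in>V. \<Sum>y\<in>V. (block_avg2 V \<psi> h x y)\<^sup>2)"
proof -
  let ?P = "block_avg2 V \<psi> h" and ?W = "block_avg2 V \<phi> h" and ?n = "real (card V)"
  let ?g = "\<lambda>x y. of_bool (x \<in> A) * of_bool (y \<in> B) :: real"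
  have "(\<Sum>x\<in>V. \<Sum>y\<in>V. ?P x y * ?g x y) = (\<Sum>x\<in>V. \<Sum>y\<in>V. h x y * ?g x y)"
  proof (rule sum_block_avg2[OF fin])
    fix x x' y y' assume "x \<in> V" "x' \<in> V" "y \<in> V" "y' \<in> V" "\<psi> x = \<psi> x'" "\<psi> y = \<psi> y'"
    then have "x \<in> A \<longleftrightarrow> x' \<in> A" "y \<in> B \<longleftrightarrow> y' \<in> B" using ref by blast+
    then show "?g x y = ?g x' y'" by simp
  qed
  then have "(\<Sum>x\<in>A. \<Sum>y\<in>B. h x y - ?W x y) = (\<Sum>x\<in>A. \<Sum>y\<in>B. ?P x y - ?W x y)"
    unfolding double_sum_restrict[OF fin A B] by (simp add: sum_subtractf)
  then have "(\<eta> * ?n\<^sup>2)\<^sup>2 \<le> (\<Sum>x\<in>A. \<Sum>y\<in>B. ?P x y - ?W x y)\<^sup>2"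
    using deviation \<eta> by (subst abs_le_square_iff[symmetric]) auto
  also have "\<dots> \<le> (\<Sum>x\<in>V. \<Sum>y\<in>V. (?P x y - ?W x y)\<^sup>2) * ?n\<^sup>2"
    using square_cut_sum_le[OF fin A B] by simp
  finally have "\<eta>\<^sup>2 * ?n\<^sup>2 * ?n\<^sup>2 \<le> (\<Sum>x\<in>V. \<Sum>y\<in>V. (?P x y - ?W x y)\<^sup>2) * ?n\<^sup>2"
    by (simp add: power2_eq_square algebra_simps)
  moreover have "0 < ?n" using deviation A fin by (cases "V = {}") (auto simp: card_gt_0_iff)
  ultimately have "\<eta>\<^sup>2 * ?n\<^sup>2 \<le> (\<Sum>x\<in>V. \<Sum>y\<in>V. (?P x y - ?W x y)\<^sup>2)" by simp
  also have "\<dots> = (\<Sum>x\<in>V. \<Sum>y\<in>V. (?P x y)\<^sup>2) - (\<Sum>x\<in>V. \<Sum>y\<in>V. (?W x y)\<^sup>2)"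
    by (rule sum_block_avg2_refinement[OF fin]) (use ref in blast)
  finally show ?thesis by simp
qed

lemma energy_increment_partition:
  fixes \<eta> :: real
  assumes fin: "finite V" and \<eta>: "0 \<le> \<eta>" and \<phi>: "\<phi> ` V \<subseteq> {..<m}"
    and "\<not> cut_close V \<eta> h (block_avg2 V \<phi> h)"
  obtains \<psi> where "\<psi> ` V \<subseteq> {..<4 * m}"
    "(\<Sum>x\<in>V. \<Sum>y\<in>V. (block_avg2 V \<phi> h x y)\<^sup>2) + \<eta>\<^sup>2 * (real (card V))\<^sup>2
      \<le> (\<Sum>x\<in>V. \<Sum>y\<in>V. (block_avg2 V \<psi> h x y)\<^sup>2)"
proof -
  obtain A B where AB: "A \<subseteq> V" "B \<subseteq> V"
    "\<eta> * (real (card V))\<^sup>2 < \<bar>\<Sum>x\<in>A. \<Sum>y\<in>B. h x y - block_avg2 V \<phi> h x y\<bar>"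
    using assms(4) by (auto simp: cut_close_def not_le)
  define \<psi> where "\<psi> x = 4 * \<phi> x + 2 * of_bool (x \<in> A) + of_bool (x \<in> B)" for x
  have "\<phi> x = \<phi> y \<and> (x \<in> A \<longleftrightarrow> y \<in> A) \<and> (x \<in> B \<longleftrightarrow> y \<in> B)" if "\<psi> x = \<psi> y" for x y
    using that unfolding \<psi>_def
    by (cases "x \<in> A"; cases "y \<in> A"; cases "x \<in> B"; cases "y \<in> B"; simp; presburger)
  moreover have "\<psi> ` V \<subseteq> {..<4 * m}" using \<phi> by (force simp: \<psi>_def of_bool_def)
  ultimately show thesis using energy_increment[OF fin AB(1,2) \<eta> _ AB(3), of \<psi>] that by blast
qed

lemma weak_regularity:
  fixes h :: "'a \<Rightarrow> 'a \<Rightarrow> real" and \<eta> :: real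
  assumes fin: "finite V" and h: "unit_kernel V h" and \<eta>: "0 < \<eta>"
  obtains \<phi> where "\<phi> ` V \<subseteq> {..<4 ^ nat \<lceil>1 / \<eta>\<^sup>2\<rceil>}" "cut_close V \<eta> h (block_avg2 V \<phi> h)"
proof (rule ccontr)
  let ?n = "real (card V)" and ?m = "nat \<lceil>1 / \<eta>\<^sup>2\<rceil>"
  let ?E = "\<lambda>\<phi>. \<Sum>x\<in>V. \<Sum>y\<in>V. (block_avg2 V \<phi> h x y)\<^sup>2"
  assume "\<not> thesis"
  with that have no_partition: "\<phi> ` V \<subseteq> {..<4 ^ ?m} \<Longrightarrow> \<not> cut_close V \<eta> h (block_avg2 V \<phi> h)" for \<phi>
    by blast
  have "\<exists>\<phi>. \<phi> ` V \<subseteq> {..<4 ^ j} \<and> j * (\<eta>\<^sup>2 * ?n\<^sup>2) \<le> ?E \<phi>" if "j \<le> Suc ?m" for j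
    using that
  proof (induction j)
    case 0
    show ?case by (rule exI[of _ "\<lambda>_. 0"]) (auto simp: sum_nonneg)
  next
    case (Suc j)
    then obtain \<phi> where \<phi>: "\<phi> ` V \<subseteq> {..<4 ^ j}" and E: "j * (\<eta>\<^sup>2 * ?n\<^sup>2) \<le> ?E \<phi>" by auto
    have "{..<(4::nat) ^ j} \<subseteq> {..<4 ^ ?m}" using Suc.prems by (simp add: power_increasing)
    with \<phi> have "\<phi> ` V \<subseteq> {..<4 ^ ?m}" by (rule subset_trans)
    then have irregular: "\<not> cut_close V \<eta> h (block_avg2 V \<phi> h)" by (rule no_partition)
    obtain \<psi> where \<psi>: "\<psi> ` V \<subseteq> {..<4 * 4 ^ j}" "?E \<phi> + \<eta>\<^sup>2 * ?n\<^sup>2 \<le> ?E \<psi>"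
      using energy_increment_partition[OF fin less_imp_le[OF \<eta>] \<phi> irregular] .
    then have "Suc j * (\<eta>\<^sup>2 * ?n\<^sup>2) \<le> ?E \<psi>" using E by (simp add: algebra_simps)
    then show ?case using \<psi>(1) by (intro exI[of _ \<psi>]) simp
  qed
  from this[of "Suc ?m"] obtain \<phi> where "Suc ?m * (\<eta>\<^sup>2 * ?n\<^sup>2) \<le> ?E \<phi>" by auto
  also have "?E \<phi> \<le> (\<Sum>x\<in>V. \<Sum>y\<in>V. 1)"
    using unit_kernel_block_avg2[OF h, of \<phi>] by (intro sum_mono) (auto simp: unit_kernel_def power_le_one)
  finally have "Suc ?m * \<eta>\<^sup>2 * ?n\<^sup>2 \<le> 1 * ?n\<^sup>2" by (simp add: power2_eq_square mult.assoc)
  moreover have "V \<noteq> {}" using no_partition[of "\<lambda>_. 0"] by (auto simp: cut_close_def)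
  then have "0 < ?n" using fin by (simp add: card_gt_0_iff)
  ultimately have "Suc ?m * \<eta>\<^sup>2 \<le> 1" by simp
  moreover have "1 / \<eta>\<^sup>2 < Suc ?m" by linarith
  ultimately show False using \<eta> by (simp add: divide_simps split: if_splits)
qed

section \<open>Counting closed walks\<close>

primrec kernel_prod :: "'a set \<Rightarrow> ('a \<Rightarrow> 'a \<Rightarrow> real) list \<Rightarrow> 'a \<Rightarrow> 'a \<Rightarrow> real" where
  "kernel_prod V [] = (\<lambda>x y. of_bool (x = y))"
| "kernel_prod V (A # As) = (\<lambda>x y. \<Sum>z\<in>V. A x z * kernel_prod V As z y)"

definition kernel_trace :: "'a set \<Rightarrow> ('a \<Rightarrow> 'a \<Rightarrow> real) list \<Rightarrow> real" where
  "kernel_trace V As = (\<Sum>x\<in>V. kernel_prod V As x x)"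

lemma kernel_prod_single: "finite V \<Longrightarrow> y \<in> V \<Longrightarrow> kernel_prod V [A] x y = A x y"
  by (simp add: if_distrib cong: if_cong)

lemma kernel_prod_append:
  assumes "finite V" "x \<in> V"
  shows "kernel_prod V (As @ Bs) x y = (\<Sum>z\<in>V. kernel_prod V As x z * kernel_prod V Bs z y)"
  using assms(2)
proof (induction As arbitrary: x)
  case Nil
  then show ?case using assms(1) by (simp add: if_distrib if_distribR cong: if_cong)
next
  case (Cons A As)
  have "kernel_prod V ((A # As) @ Bs) x y
      = (\<Sum>w\<in>V. \<Sum>z\<in>V. A x w * (kernel_prod V As w z * kernel_prod V Bs z y))"
    using Cons.IH by (simp add: sum_distrib_left)
  also have "\<dots> = (\<Sum>z\<in>V. \<Sum>w\<in>V. A x w * (kernel_prod V As w z * kernel_prod V Bs z y))"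
    by (rule sum.swap)
  finally show ?case by (simp add: sum_distrib_right mult.assoc)
qed

lemma kernel_trace_append_commute:
  assumes "finite V"
  shows "kernel_trace V (As @ Bs) = kernel_trace V (Bs @ As)"
proof -
  have "kernel_trace V (As @ Bs) = (\<Sum>x\<in>V. \<Sum>z\<in>V. kernel_prod V As x z * kernel_prod V Bs z x)"
    using assms by (simp add: kernel_trace_def kernel_prod_append)
  also have "\<dots> = (\<Sum>z\<in>V. \<Sum>x\<in>V. kernel_prod V As x z * kernel_prod V Bs z x)" by (rule sum.swap)
  also have "\<dots> = kernel_trace V (Bs @ As)"
    using assms by (simp add: kernel_trace_def kernel_prod_append mult.commute)
  finally show ?thesis .
qed

lemma kernel_prod_nonneg:
  assumes "\<And>A x y. A \<in> set As \<Longrightarrow> x \<in> V \<Longrightarrow> y \<in> V \<Longrightarrow> 0 \<le> A x y" "x \<in> V" "y \<in> V"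
  shows "0 \<le> kernel_prod V As x y"
  using assms by (induction As arbitrary: x) (auto intro!: sum_nonneg mult_nonneg_nonneg)

lemma kernel_prod_le:
  assumes fin: "finite V" and "\<And>B. B \<in> set (A # As) \<Longrightarrow> unit_kernel V B" "x \<in> V" "y \<in> V"
  shows "kernel_prod V (A # As) x y \<le> real (card V) ^ length As"
  using assms(2-)
proof (induction As arbitrary: A x)
  case Nil
  then show ?case using kernel_prod_single[OF fin \<open>y \<in> V\<close>, of A x] by (simp add: unit_kernel_def)
next
  case (Cons B As)
  have "kernel_prod V (A # B # As) x y \<le> card V * (1 * real (card V) ^ length As)"
    unfolding kernel_prod.simps(2)[of V A]
  proof (rule sum_bounded_above)
    fix z assume z: "z \<in> V"
    then have "0 \<le> A x z" "A x z \<le> 1" using Cons.prems by (auto simp: unit_kernel_def)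
    moreover have "kernel_prod V (B # As) z y \<le> real (card V) ^ length As"
      using Cons.prems z by (intro Cons.IH) auto
    moreover have "0 \<le> kernel_prod V (B # As) z y"
      using Cons.prems z by (intro kernel_prod_nonneg) (auto simp: unit_kernel_def)
    ultimately show "A x z * kernel_prod V (B # As) z y \<le> 1 * real (card V) ^ length As"
      by (intro mult_mono) auto
  qed
  then show ?case by simp
qed

lemma sum_mult_le_sum_positive_part:
  fixes w d :: "'a \<Rightarrow> real"
  assumes "finite V" "\<And>x. x \<in> V \<Longrightarrow> 0 \<le> w x \<and> w x \<le> \<gamma>"
  shows "(\<Sum>x\<in>V. w x * d x) \<le> \<gamma> * (\<Sum>x | x \<in> V \<and> 0 < d x. d x)"
proof -
  have "(\<Sum>x\<in>V. w x * d x) \<le> (\<Sum>x\<in>V. if 0 < d x then \<gamma> * d x else 0)"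
    using assms(2) by (intro sum_mono) (auto intro!: mult_right_mono simp: mult_nonneg_nonpos not_less)
  also have "\<dots> = (\<Sum>x | x \<in> V \<and> 0 < d x. \<gamma> * d x)"
    using assms(1) by (simp add: sum.If_cases Int_def)
  finally show ?thesis by (simp add: sum_distrib_left)
qed

lemma weighted_sum_le_cut_bound:
  fixes D :: "'a \<Rightarrow> 'a \<Rightarrow> real" and \<theta> :: real
  assumes fin: "finite V"
    and D: "\<And>A B. A \<subseteq> V \<Longrightarrow> B \<subseteq> V \<Longrightarrow> (\<Sum>x\<in>A. \<Sum>y\<in>B. D x y) \<le> \<theta>"
    and u: "\<And>x. x \<in> V \<Longrightarrow> 0 \<le> u x \<and> u x \<le> \<alpha>" and v: "\<And>x. x \<in> V \<Longrightarrow> 0 \<le> v x \<and> v x \<le> \<beta>"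
    and "0 \<le> \<alpha>" "0 \<le> \<beta>"
  shows "(\<Sum>x\<in>V. \<Sum>y\<in>V. D x y * u x * v y) \<le> \<alpha> * \<beta> * \<theta>"
proof -
  define A where "A = {x \<in> V. 0 < (\<Sum>y\<in>V. D x y * v y)}"
  define B where "B = {y \<in> V. 0 < (\<Sum>x\<in>A. D x y)}"
  have "(\<Sum>x\<in>V. \<Sum>y\<in>V. D x y * u x * v y) = (\<Sum>x\<in>V. u x * (\<Sum>y\<in>V. D x y * v y))"
    by (simp add: sum_distrib_left mult_ac)
  also have "\<dots> \<le> \<alpha> * (\<Sum>x\<in>A. \<Sum>y\<in>V. D x y * v y)"
    unfolding A_def using fin u by (rule sum_mult_le_sum_positive_part)
  also have "(\<Sum>x\<in>A. \<Sum>y\<in>V. D x y * v y) = (\<Sum>y\<in>V. v y * (\<Sum>x\<in>A. D x y))"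
    by (subst sum.swap) (simp add: sum_distrib_left mult_ac)
  also have "\<alpha> * \<dots> \<le> \<alpha> * (\<beta> * (\<Sum>y\<in>B. \<Sum>x\<in>A. D x y))"
    unfolding B_def using fin v \<open>0 \<le> \<alpha>\<close> by (intro mult_left_mono sum_mult_le_sum_positive_part) auto
  also have "(\<Sum>y\<in>B. \<Sum>x\<in>A. D x y) = (\<Sum>x\<in>A. \<Sum>y\<in>B. D x y)" by (rule sum.swap)
  also have "\<alpha> * (\<beta> * \<dots>) \<le> \<alpha> * (\<beta> * \<theta>)"
    using \<open>0 \<le> \<alpha>\<close> \<open>0 \<le> \<beta>\<close> by (intro mult_left_mono D) (auto simp: A_def B_def)
  finally show ?thesis by (simp add: mult.assoc)
qed

lemma kernel_trace_exchange:
  fixes W h :: "'a \<Rightarrow> 'a \<Rightarrow> real"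
  assumes fin: "finite V" and unit: "\<And>C. C \<in> set (A # B # Ks) \<Longrightarrow> unit_kernel V C"
    and cut: "\<And>X Y. X \<subseteq> V \<Longrightarrow> Y \<subseteq> V \<Longrightarrow> (\<Sum>x\<in>X. \<Sum>y\<in>Y. W x y - h x y) \<le> \<theta>"
  shows "kernel_trace V (W # A # B # Ks)
    \<le> kernel_trace V (h # A # B # Ks) + real (card V) ^ Suc (length Ks) * \<theta>"
proof -
  let ?P = "kernel_prod V (B # Ks)"
  have "kernel_trace V (W # A # B # Ks) - kernel_trace V (h # A # B # Ks)
      = (\<Sum>z\<in>V. \<Sum>w\<in>V. \<Sum>x\<in>V. (W z w - h z w) * ?P x z * A w x)"
    unfolding kernel_trace_def kernel_prod.simps(2)[of V W] kernel_prod.simps(2)[of V h]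
      kernel_prod.simps(2)[of V A]
    by (simp add: sum_distrib_left left_diff_distrib right_diff_distrib sum_subtractf mult_ac
        del: kernel_prod.simps)
  also have "\<dots> = (\<Sum>z\<in>V. \<Sum>x\<in>V. \<Sum>w\<in>V. (W z w - h z w) * ?P x z * A w x)"
    by (intro sum.cong refl sum.swap)
  also have "\<dots> = (\<Sum>x\<in>V. \<Sum>z\<in>V. \<Sum>w\<in>V. (W z w - h z w) * ?P x z * A w x)" by (rule sum.swap)
  also have "\<dots> \<le> card V * (real (card V) ^ length Ks * 1 * \<theta>)"
  proof (intro sum_bounded_above weighted_sum_le_cut_bound[OF fin cut])
    fix x z assume "x \<in> V" "z \<in> V"
    then show "0 \<le> ?P x z \<and> ?P x z \<le> real (card V) ^ length Ks"
      using unit by (intro conjI kernel_prod_nonneg kernel_prod_le[OF fin]) (auto simp: unit_kernel_def)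
    show "0 \<le> A z x \<and> A z x \<le> 1"
      using unit \<open>x \<in> V\<close> \<open>z \<in> V\<close> by (auto simp: unit_kernel_def)
  qed auto
  finally show ?thesis by simp
qed

lemma kernel_trace_power_le:
  fixes h W :: "'a \<Rightarrow> 'a \<Rightarrow> real"
  assumes fin: "finite V" and k: "3 \<le> k" and unit: "unit_kernel V h" "unit_kernel V W"
    and close: "cut_close V \<eta> h W"
  shows "kernel_trace V (replicate k W) \<le> kernel_trace V (replicate k h) + real k * (\<eta> * real (card V) ^ k)"
proof -
  define T where "T j = kernel_trace V (replicate j W @ replicate (k - j) h)" for j
  have cut: "(\<Sum>x\<in>X. \<Sum>y\<in>Y. W x y - h x y) \<le> \<eta> * (real (card V))\<^sup>2" if "X \<subseteq> V" "Y \<subseteq> V" for X Y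
    using close[unfolded cut_close_def, rule_format, OF that] by (simp add: sum_subtractf)
  have exchange: "T (Suc j) \<le> T j + \<eta> * real (card V) ^ k" if "j < k" for j
  proof -
    define Ks where "Ks = replicate (k - Suc j) h @ replicate j W"
    have unit_Ks: "unit_kernel V C" if "C \<in> set Ks" for C using that unit by (auto simp: Ks_def)
    have "length Ks = Suc (Suc (k - 3))" using k that by (simp add: Ks_def)
    then obtain A B Ls where Ks: "Ks = A # B # Ls" "length Ls = k - 3" by (auto simp: length_Suc_conv)
    have rotate: "kernel_trace V (replicate j W @ C # replicate (k - Suc j) h) = kernel_trace V (C # Ks)"
      for C
      using kernel_trace_append_commute[OF fin, of "replicate j W" "C # replicate (k - Suc j) h"]
      by (simp add: Ks_def)
    have "T (Suc j) = kernel_trace V (W # Ks)"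
      using rotate[of W] by (simp add: T_def replicate_app_Cons_same)
    also have "\<dots> \<le> kernel_trace V (h # Ks) + real (card V) ^ Suc (k - 3) * (\<eta> * (real (card V))\<^sup>2)"
      using kernel_trace_exchange[OF fin _ cut, of A B Ls] unit_Ks unfolding Ks by simp
    also have "kernel_trace V (h # Ks) = T j"
      using rotate[of h] that by (simp add: T_def Cons_replicate_eq Suc_diff_Suc flip: replicate_Suc)
    also have "real (card V) ^ Suc (k - 3) * (\<eta> * (real (card V))\<^sup>2) = \<eta> * real (card V) ^ (Suc (k - 3) + 2)"
      by (simp only: power_add mult_ac)
    also have "Suc (k - 3) + 2 = k" using k by simp
    finally show ?thesis .
  qed
  have "T j \<le> T 0 + real j * (\<eta> * real (card V) ^ k)" if "j \<le> k" for j
    using that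
  proof (induction j)
    case (Suc j)
    then show ?case using exchange[of j] by (simp add: algebra_simps)
  qed simp
  from this[of k] show ?thesis by (simp add: T_def)
qed

lemma kernel_prod_ge_along_sets:
  assumes fin: "finite V" and W: "\<And>x y. x \<in> V \<Longrightarrow> y \<in> V \<Longrightarrow> 0 \<le> W x y" and nonneg: "0 \<le> e" "0 \<le> t"
    and "successively (\<lambda>A B. \<forall>x\<in>A. t \<le> (\<Sum>z\<in>B. W x z)) As"
    and "\<And>A. A \<in> set As \<Longrightarrow> A \<subseteq> V" and "As \<noteq> []"
    and "\<And>z. z \<in> last As \<Longrightarrow> e \<le> W z y" and "x \<in> hd As" "y \<in> V"
  shows "t ^ (length As - 1) * e \<le> kernel_prod V (replicate (length As) W) x y"
  using assms(5-)
proof (induction As arbitrary: x rule: induct_list012)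
  case (2 A)
  then show ?case using kernel_prod_single[OF fin \<open>y \<in> V\<close>, of W x] by auto
next
  case (3 A B As)
  let ?K = "kernel_prod V (replicate (length (B # As)) W)" and ?c = "t ^ length As * e"
  have AB: "x \<in> V" "B \<subseteq> V" "t \<le> (\<Sum>z\<in>B. W x z)" using "3.prems" by auto
  have K: "?c \<le> ?K z y" if "z \<in> B" for z
    using "3.prems" that "3.IH"(2)[of z] by auto
  have "t * ?c \<le> (\<Sum>z\<in>B. W x z) * ?c" using AB nonneg by (intro mult_right_mono) auto
  also have "\<dots> \<le> (\<Sum>z\<in>B. W x z * ?K z y)"
    unfolding sum_distrib_right using AB K W by (intro sum_mono mult_left_mono) auto
  also have "\<dots> \<le> (\<Sum>z\<in>V. W x z * ?K z y)"
    using fin AB W \<open>y \<in> V\<close> by (intro sum_mono2 mult_nonneg_nonneg kernel_prod_nonneg) auto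
  finally show ?case by (simp add: mult_ac)
qed simp

section \<open>Supersaturation of closed walks\<close>

lemma card_le_delete_vertex:
  assumes "finite X"
  shows "card (R \<inter> X \<times> X) \<le> card (R \<inter> (X - {a}) \<times> (X - {a})) + card (R `` {a} \<inter> X) + card (R\<inverse> `` {a} \<inter> X)"
proof -
  let ?R' = "R \<inter> (X - {a}) \<times> (X - {a})"
  have "R \<inter> X \<times> X \<subseteq> ?R' \<union> Pair a ` (R `` {a} \<inter> X) \<union> (\<lambda>b. (b, a)) ` (R\<inverse> `` {a} \<inter> X)"
    by auto
  then have "card (R \<inter> X \<times> X) \<le> card (?R' \<union> Pair a ` (R `` {a} \<inter> X) \<union> (\<lambda>b. (b, a)) ` (R\<inverse> `` {a} \<inter> X))"
    using assms by (intro card_mono) auto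
  also have "\<dots> \<le> card ?R' + card (Pair a ` (R `` {a} \<inter> X)) + card ((\<lambda>b. (b, a)) ` (R\<inverse> `` {a} \<inter> X))"
    by (meson add_mono card_Un_le le_refl le_trans)
  also have "\<dots> \<le> card ?R' + card (R `` {a} \<inter> X) + card (R\<inverse> `` {a} \<inter> X)"
    using assms by (intro add_mono card_image_le) auto
  finally show ?thesis .
qed

text \<open>Any \<open>X\<close> maximizing the difference between the number of arcs inside \<open>X\<close> and \<open>g |X|\<close> will do.\<close>

lemma exists_subset_large_degrees:
  fixes g :: "nat \<Rightarrow> real"
  assumes "finite V"
  obtains X where "X \<subseteq> V" "real (card (R \<inter> V \<times> V)) - g (card V) \<le> real (card (R \<inter> X \<times> X)) - g (card X)"
    "\<forall>a\<in>X. g (card X) - g (card X - 1) \<le> real (card (R `` {a} \<inter> X)) + real (card (R\<inverse> `` {a} \<inter> X))"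
proof -
  let ?\<Phi> = "\<lambda>X. real (card (R \<inter> X \<times> X)) - g (card X)"
  have "Max (?\<Phi> ` Pow V) \<in> ?\<Phi> ` Pow V" using assms by (intro Max_in) auto
  then obtain X where X: "X \<subseteq> V" and "?\<Phi> X = Max (?\<Phi> ` Pow V)" by auto
  then have max: "?\<Phi> Y \<le> ?\<Phi> X" if "Y \<subseteq> V" for Y using assms that by auto
  have finX: "finite X" using X assms by (rule finite_subset)
  show thesis
  proof (rule that[OF X], intro max subset_refl, intro ballI)
    fix a assume a: "a \<in> X"
    have "?\<Phi> (X - {a}) \<le> ?\<Phi> X" using X by (intro max) auto
    then show "g (card X) - g (card X - 1) \<le> real (card (R `` {a} \<inter> X)) + real (card (R\<inverse> `` {a} \<inter> X))"
      using card_le_delete_vertex[OF finX, of R a] a by simp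
  qed
qed

lemma real_card_diff_one: "finite X \<Longrightarrow> a \<in> X \<Longrightarrow> real (card X - Suc 0) = real (card X) - 1"
  by (cases "card X") auto

lemma dense_digraph_min_degree_subset:
  fixes \<beta> :: real
  assumes fin: "finite V" and \<beta>: "0 < \<beta>" "\<beta> \<le> 1 / 2" and n: "1 / \<beta>\<^sup>2 \<le> real (card V)"
    and S: "(1 / 2 + 2 * \<beta>) * (real (card V))\<^sup>2 \<le> real (card (S \<inter> V \<times> V))"
  obtains X where "X \<subseteq> V" "\<beta> * card V \<le> real (card X)"
    "\<forall>a\<in>X. (1 + \<beta>) * card X \<le> real (card (S `` {a} \<inter> X)) + real (card (S\<inverse> `` {a} \<inter> X))"
proof -
  define g where "g m = (1 / 2 + \<beta>) * (real m)\<^sup>2" for m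
  let ?n = "real (card V)"
  obtain X where X: "X \<subseteq> V"
    and \<Phi>: "real (card (S \<inter> V \<times> V)) - g (card V) \<le> real (card (S \<inter> X \<times> X)) - g (card X)"
    and deg: "\<forall>a\<in>X. g (card X) - g (card X - 1) \<le> real (card (S `` {a} \<inter> X)) + real (card (S\<inverse> `` {a} \<inter> X))"
    using exists_subset_large_degrees[OF fin, of S g] .
  have finX: "finite X" using X fin by (rule finite_subset)
  have "(\<beta> * ?n)\<^sup>2 \<le> \<beta> * ?n\<^sup>2"
    unfolding power_mult_distrib
    using \<beta> by (intro mult_right_mono) (auto simp: power2_eq_square mult_le_cancel_left1)
  also have "\<dots> \<le> real (card (S \<inter> X \<times> X)) - g (card X)"
    using S \<Phi> by (simp add: g_def algebra_simps)
  also have "\<dots> \<le> real (card (S \<inter> X \<times> X))" using \<beta> by (simp add: g_def)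
  also have "\<dots> \<le> real (card (X \<times> X))" using finX by (intro of_nat_mono card_mono) auto
  finally have "(\<beta> * ?n)\<^sup>2 \<le> (real (card X))\<^sup>2"
    by (simp only: card_cartesian_product power2_eq_square of_nat_mult)
  then have "\<beta> * ?n \<le> real (card X)" by (rule power2_le_imp_le) simp
  moreover have "1 \<le> \<beta> * (\<beta> * ?n)" using n \<beta> by (simp add: field_simps power2_eq_square)
  ultimately have large: "1 \<le> \<beta> * real (card X)"
    using \<beta> mult_left_mono[of "\<beta> * ?n" "real (card X)" \<beta>] by linarith
  have gap: "(1 + \<beta>) * card X \<le> g (card X) - g (card X - 1)" if "a \<in> X" for a
  proof -
    have "g (card X) - g (card X - 1) = (1 + 2 * \<beta>) * card X - (1 / 2 + \<beta>)"
      by (simp add: g_def real_card_diff_one[OF finX that] power2_eq_square algebra_simps)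
    then show ?thesis using large \<beta> by (simp add: algebra_simps)
  qed
  show thesis
  proof (rule that[OF X \<open>\<beta> * ?n \<le> real (card X)\<close>], rule ballI)
    fix a assume "a \<in> X"
    then show "(1 + \<beta>) * card X \<le> real (card (S `` {a} \<inter> X)) + real (card (S\<inverse> `` {a} \<inter> X))"
      using deg order_trans[OF gap] by blast
  qed
qed

definition bipartite_cover :: "'a rel \<Rightarrow> ('a \<times> bool) rel" where
  "bipartite_cover B = (\<lambda>(a, b). ((a, False), (b, True))) ` B"

lemma bipartite_cover_Image:
  "bipartite_cover B `` {(a, False)} = (\<lambda>b. (b, True)) ` (B `` {a})" "bipartite_cover B `` {(b, True)} = {}"
  "(bipartite_cover B)\<inverse> `` {(b, True)} = (\<lambda>a. (a, False)) ` (B\<inverse> `` {b})"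
  "(bipartite_cover B)\<inverse> `` {(a, False)} = {}"
  by (auto simp: bipartite_cover_def)

lemma card_bipartite_cover: "card (bipartite_cover B) = card B"
  by (simp add: bipartite_cover_def card_image inj_on_def split_def prod_eq_iff)

lemma card_Pair_image_Int: "card ((\<lambda>b. (b, t)) ` B \<inter> Z) = card (B \<inter> {b. (b, t) \<in> Z})"
proof -
  have "(\<lambda>b. (b, t)) ` B \<inter> Z = (\<lambda>b. (b, t)) ` (B \<inter> {b. (b, t) \<in> Z})" by auto
  then show ?thesis by (simp add: card_image inj_on_def)
qed

lemma bipartite_min_degree_subsets:
  fixes d :: real
  assumes fin: "finite V" and B: "B \<subseteq> V \<times> V" "4 * d * card V \<le> real (card B)" and "B \<noteq> {}" "0 < d"
  obtains X Y where "X \<subseteq> V" "Y \<subseteq> V" "d \<le> real (card X)"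
    "\<forall>a\<in>X. d \<le> real (card (B `` {a} \<inter> Y))" "\<forall>b\<in>Y. d \<le> real (card (B\<inverse> `` {b} \<inter> X))"
proof -
  let ?R = "bipartite_cover B" and ?V = "V \<times> (UNIV :: bool set)"
  have "?R \<inter> ?V \<times> ?V = ?R" using B(1) by (auto simp: bipartite_cover_def)
  then obtain Z where Z: "Z \<subseteq> ?V" "real (card B) - d * card ?V \<le> real (card (?R \<inter> Z \<times> Z)) - d * card Z"
    and deg: "\<forall>z\<in>Z. d * card Z - d * (card Z - 1)
      \<le> real (card (?R `` {z} \<inter> Z)) + real (card (?R\<inverse> `` {z} \<inter> Z))"
    using exists_subset_large_degrees[where V = ?V and R = ?R and g = "\<lambda>m. d * m"] fin
      card_bipartite_cover[of B] by auto
  define X where "X = {a. (a, False) \<in> Z}"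
  define Y where "Y = {b. (b, True) \<in> Z}"
  have XY: "X \<subseteq> V" "Y \<subseteq> V" using Z(1) by (auto simp: X_def Y_def)
  have finZ: "finite Z" by (rule finite_subset[OF Z(1)]) (simp add: fin)
  have deg_Z: "d \<le> real (card (?R `` {z} \<inter> Z)) + real (card (?R\<inverse> `` {z} \<inter> Z))" if "z \<in> Z" for z
    using bspec[OF deg that] by (simp add: real_card_diff_one[OF finZ that] right_diff_distrib)
  have row: "d \<le> real (card (B `` {a} \<inter> Y))" if "a \<in> X" for a
    using deg_Z[of "(a, False)"] that by (simp add: bipartite_cover_Image card_Pair_image_Int X_def Y_def)
  have col: "d \<le> real (card (B\<inverse> `` {b} \<inter> X))" if "b \<in> Y" for b
    using deg_Z[of "(b, True)"] that by (simp add: bipartite_cover_Image card_Pair_image_Int X_def Y_def)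
  have "0 < card B" using \<open>B \<noteq> {}\<close> finite_subset[OF B(1)] fin by (simp add: card_gt_0_iff)
  then have "0 < real (card (?R \<inter> Z \<times> Z)) - d * card Z"
    using Z(2) B(2) \<open>0 < d\<close> by (simp add: card_cartesian_product)
  moreover have "0 \<le> d * card Z" using \<open>0 < d\<close> by simp
  ultimately have "0 < card (?R \<inter> Z \<times> Z)" by linarith
  then have "?R \<inter> Z \<times> Z \<noteq> {}" by (metis card.empty less_irrefl)
  then obtain b where "b \<in> Y" by (auto simp: bipartite_cover_def Y_def)
  then have "d \<le> real (card (B\<inverse> `` {b} \<inter> X))" by (rule col)
  moreover have "card (B\<inverse> `` {b} \<inter> X) \<le> card X" using XY fin by (intro card_mono) (auto intro: finite_subset)
  ultimately have "d \<le> real (card X)" by linarith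
  then show thesis using that[OF XY] row col by blast
qed

text \<open>A germ at \<open>c\<close> is a two-way arc \<open>a\<close>--\<open>b\<close>; zigzagging along germs from \<open>c\<close> to \<open>c\<close> gives closed
  walks of length \<open>k\<close>, which end in \<open>b\<close> or \<open>a\<close> according to the parity of \<open>k\<close>.\<close>

definition germs :: "'a rel \<Rightarrow> nat \<Rightarrow> 'a \<Rightarrow> 'a rel" where
  "germs S k c = {(a, b). (a, b) \<in> S \<and> (b, a) \<in> S \<and> (c, a) \<in> S \<and> (if odd k then b else a, c) \<in> S}"

lemma card_Int_ge:
  assumes "finite X" "A \<subseteq> X" "B \<subseteq> X"
  shows "real (card A) + real (card B) - real (card X) \<le> real (card (A \<inter> B))"
proof -
  have "card A + card B = card (A \<union> B) + card (A \<inter> B)"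
    using assms by (intro card_Un_Int) (auto intro: finite_subset)
  moreover have "card (A \<union> B) \<le> card X" using assms by (intro card_mono) auto
  ultimately show ?thesis by linarith
qed

lemma card_two_way_neighbours_ge:
  fixes t :: real
  assumes "finite X" and "card X + t \<le> real (card (S `` {a} \<inter> X)) + real (card (S\<inverse> `` {a} \<inter> X))"
  shows "t \<le> real (card ((S \<inter> S\<inverse>) `` {a} \<inter> X))"
proof -
  have "(S \<inter> S\<inverse>) `` {a} \<inter> X = (S `` {a} \<inter> X) \<inter> (S\<inverse> `` {a} \<inter> X)" by auto
  then show ?thesis
    using card_Int_ge[OF assms(1), of "S `` {a} \<inter> X" "S\<inverse> `` {a} \<inter> X"] assms(2) by simp
qed

lemma sum_card_triangles_on_two_way_arcs:
  fixes t :: real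
  assumes fin: "finite X" and "0 \<le> t"
    and deg: "\<forall>a\<in>X. card X + t \<le> real (card (S `` {a} \<inter> X)) + real (card (S\<inverse> `` {a} \<inter> X))"
  shows "card X * (t * t) \<le> (\<Sum>a\<in>X. \<Sum>b\<in>(S \<inter> S\<inverse>) `` {a} \<inter> X. real (card (S\<inverse> `` {a} \<inter> S `` {b} \<inter> X)))"
proof -
  let ?U = "\<lambda>a. (S \<inter> S\<inverse>) `` {a} \<inter> X"
  let ?p = "\<lambda>a b. real (card (S\<inverse> `` {a} \<inter> S `` {b} \<inter> X))"
  have "(\<Sum>a\<in>X. \<Sum>b\<in>?U a. ?p a b) = (\<Sum>a\<in>X. \<Sum>b | b \<in> X \<and> (a, b) \<in> S \<and> (b, a) \<in> S. ?p a b)"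
    by (intro sum.cong refl) auto
  also have "\<dots> = (\<Sum>b\<in>X. \<Sum>a | a \<in> X \<and> (a, b) \<in> S \<and> (b, a) \<in> S. ?p a b)"
    by (rule sum.swap_restrict[OF fin fin])
  also have "\<dots> = (\<Sum>a\<in>X. \<Sum>b\<in>?U a. ?p b a)"
    by (intro sum.cong refl) auto
  finally have sym: "(\<Sum>a\<in>X. \<Sum>b\<in>?U a. ?p a b) = (\<Sum>a\<in>X. \<Sum>b\<in>?U a. ?p b a)" .
  have both: "2 * t \<le> ?p a b + ?p b a" if "a \<in> X" "b \<in> ?U a" for a b
  proof -
    have Int: "S\<inverse> `` {a} \<inter> S `` {b} \<inter> X = (S\<inverse> `` {a} \<inter> X) \<inter> (S `` {b} \<inter> X)" for a b by auto
    have "b \<in> X" using that by simp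
    then show ?thesis
      unfolding Int using bspec[OF deg that(1)] bspec[OF deg]
        card_Int_ge[OF fin, of "S\<inverse> `` {a} \<inter> X" "S `` {b} \<inter> X"]
        card_Int_ge[OF fin, of "S\<inverse> `` {b} \<inter> X" "S `` {a} \<inter> X"] by fastforce
  qed
  have "card X * (t * (2 * t)) \<le> (\<Sum>a\<in>X. card (?U a) * (2 * t))"
    using card_two_way_neighbours_ge[OF fin] deg \<open>0 \<le> t\<close> by (intro sum_bounded_below mult_right_mono) auto
  also have "\<dots> \<le> (\<Sum>a\<in>X. \<Sum>b\<in>?U a. ?p a b + ?p b a)"
    using both by (intro sum_mono sum_bounded_below)
  also have "\<dots> = 2 * (\<Sum>a\<in>X. \<Sum>b\<in>?U a. ?p a b)" using sym by (simp add: sum.distrib)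
  finally show ?thesis by simp
qed

lemma sum_card_germs_odd:
  fixes t :: real
  assumes fin: "finite X" and "0 \<le> t" "odd k"
    and deg: "\<forall>a\<in>X. card X + t \<le> real (card (S `` {a} \<inter> X)) + real (card (S\<inverse> `` {a} \<inter> X))"
  shows "card X * (t * t) \<le> (\<Sum>c\<in>X. real (card (germs S k c \<inter> X \<times> X)))"
proof -
  let ?U = "\<lambda>a. (S \<inter> S\<inverse>) `` {a} \<inter> X"
  have finU: "finite (?U a)" for a using fin by simp
  have "card X * (t * t) \<le> (\<Sum>a\<in>X. \<Sum>b\<in>?U a. real (card (S\<inverse> `` {a} \<inter> S `` {b} \<inter> X)))"
    by (rule sum_card_triangles_on_two_way_arcs[OF fin \<open>0 \<le> t\<close> deg])
  also have "\<dots> = (\<Sum>p\<in>Sigma X ?U. real (card {c \<in> X. p \<in> germs S k c}))"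
    using fin finU \<open>odd k\<close> by (subst sum.Sigma) (auto simp: germs_def intro!: sum.cong arg_cong[of _ _ card])
  also have "\<dots> = (\<Sum>c\<in>X. real (card {p \<in> Sigma X ?U. p \<in> germs S k c}))"
    using sum.swap_restrict[of X "Sigma X ?U" "\<lambda>_ _. 1 :: real" "\<lambda>c p. p \<in> germs S k c"] fin finU by simp
  also have "\<dots> \<le> (\<Sum>c\<in>X. real (card (germs S k c \<inter> X \<times> X)))"
    using fin by (intro sum_mono of_nat_mono card_mono) auto
  finally show ?thesis .
qed

lemma card_germs_even:
  fixes t :: real
  assumes fin: "finite X" and "0 \<le> t" "even k" "c \<in> X"
    and deg: "\<forall>a\<in>X. card X + t \<le> real (card (S `` {a} \<inter> X)) + real (card (S\<inverse> `` {a} \<inter> X))"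
  shows "t * t \<le> real (card (germs S k c \<inter> X \<times> X))"
proof -
  let ?U = "\<lambda>a. (S \<inter> S\<inverse>) `` {a} \<inter> X"
  have U: "t \<le> real (card (?U a))" if "a \<in> X" for a
    using card_two_way_neighbours_ge[OF fin] deg that by blast
  have "t * t \<le> card (?U c) * t" using U[OF \<open>c \<in> X\<close>] \<open>0 \<le> t\<close> by (rule mult_right_mono)
  also have "\<dots> \<le> (\<Sum>a\<in>?U c. real (card (?U a)))" using U by (intro sum_bounded_below) simp
  also have "\<dots> = real (card (Sigma (?U c) ?U))" using fin by simp
  also have "\<dots> \<le> real (card (germs S k c \<inter> X \<times> X))"
    using fin \<open>even k\<close> by (intro of_nat_mono card_mono) (auto simp: germs_def)
  finally show ?thesis .
qed

lemma sum_card_germs_min_degree: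
  fixes t :: real
  assumes "finite X" "0 \<le> t"
    and "\<forall>a\<in>X. card X + t \<le> real (card (S `` {a} \<inter> X)) + real (card (S\<inverse> `` {a} \<inter> X))"
  shows "card X * (t * t) \<le> (\<Sum>c\<in>X. real (card (germs S k c \<inter> X \<times> X)))"
proof (cases "odd k")
  case True
  then show ?thesis using assms by (intro sum_card_germs_odd)
next
  case False
  then show ?thesis using assms by (intro sum_bounded_below card_germs_even) auto
qed

lemma sum_card_germs_ge:
  fixes \<beta> :: real
  assumes fin: "finite V" and "S \<subseteq> V \<times> V" and \<beta>: "0 < \<beta>" "\<beta> \<le> 1 / 2" and n: "1 / \<beta>\<^sup>2 \<le> real (card V)"
    and dense: "(1 / 2 + 2 * \<beta>) * (real (card V))\<^sup>2 \<le> real (card S)"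
  shows "\<beta> ^ 5 * real (card V) ^ 3 \<le> (\<Sum>c\<in>V. real (card (germs S k c)))"
proof -
  have "S \<inter> V \<times> V = S" using assms(2) by auto
  then obtain X where X: "X \<subseteq> V" and large: "\<beta> * card V \<le> real (card X)"
    and deg: "\<forall>a\<in>X. (1 + \<beta>) * card X \<le> real (card (S `` {a} \<inter> X)) + real (card (S\<inverse> `` {a} \<inter> X))"
    using dense_digraph_min_degree_subset[OF fin \<beta> n, of S] dense by metis
  have finX: "finite X" using X fin by (rule finite_subset)
  have fin_germs: "finite (germs S k c)" for c
    using assms(2) fin by (auto simp: germs_def intro: finite_subset[of _ "V \<times> V"])
  have "\<beta>\<^sup>2 * (\<beta> * card V) ^ 3 \<le> \<beta>\<^sup>2 * real (card X) ^ 3"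
    using large \<beta> by (intro mult_left_mono power_mono) auto
  then have "\<beta> ^ 5 * real (card V) ^ 3 \<le> card X * (\<beta> * card X * (\<beta> * card X))"
    by (simp add: power_mult_distrib power2_eq_square power3_eq_cube mult_ac eval_nat_numeral)
  also have "\<dots> \<le> (\<Sum>c\<in>X. real (card (germs S k c \<inter> X \<times> X)))"
    using deg \<beta> by (intro sum_card_germs_min_degree[OF finX]) (auto simp: distrib_right)
  also have "\<dots> \<le> (\<Sum>c\<in>V. real (card (germs S k c)))"
    using X fin fin_germs by (intro order_trans[OF sum_mono sum_mono2] of_nat_mono card_mono) auto
  finally show ?thesis .
qed

lemma sum_level_set_ge:
  fixes W :: "'a \<Rightarrow> 'a \<Rightarrow> real"
  assumes "finite B" "\<And>z. z \<in> B \<Longrightarrow> 0 \<le> W x z" "\<And>z. z \<in> A \<Longrightarrow> e \<le> W x z" "A \<subseteq> B" "0 \<le> e" "d \<le> real (card A)"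
  shows "e * d \<le> (\<Sum>z\<in>B. W x z)"
proof -
  have "e * d \<le> card A * e" using mult_left_mono[OF assms(6,5)] by (simp add: mult.commute)
  also have "\<dots> \<le> (\<Sum>z\<in>A. W x z)" using assms(3) by (rule sum_bounded_below)
  also have "\<dots> \<le> (\<Sum>z\<in>B. W x z)" using assms(1,2,4) by (intro sum_mono2) auto
  finally show ?thesis .
qed

lemma zigzag_sets_of_germs:
  fixes d :: real
  assumes fin: "finite V"
    and S: "S \<subseteq> V \<times> V" and "V \<noteq> {}" and d: "0 < d" "4 * d * card V \<le> real (card (germs S k c))"
  obtains X Y where "X \<subseteq> V" "Y \<subseteq> V" "d \<le> real (card X)"
    "\<forall>a\<in>X. (c, a) \<in> S \<and> d \<le> real (card (S `` {a} \<inter> Y))" "\<forall>b\<in>Y. d \<le> real (card (S `` {b} \<inter> X))"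
    "\<forall>z\<in>if odd k then Y else X. (z, c) \<in> S"
proof -
  let ?B = "germs S k c"
  have B: "?B \<subseteq> V \<times> V" using S by (auto simp: germs_def)
  have "0 < 4 * d * card V" using d(1) fin \<open>V \<noteq> {}\<close> by (simp add: card_gt_0_iff)
  then have "0 < real (card ?B)" using d(2) by linarith
  then have "?B \<noteq> {}" by auto
  then obtain X Y where XY: "X \<subseteq> V" "Y \<subseteq> V" and cX: "d \<le> real (card X)"
    and row: "\<forall>a\<in>X. d \<le> real (card (?B `` {a} \<inter> Y))" and col: "\<forall>b\<in>Y. d \<le> real (card (?B\<inverse> `` {b} \<inter> X))"
    using bipartite_min_degree_subsets[OF fin B d(2) _ d(1)] by blast
  have finXY: "finite X" "finite Y" using XY fin by (auto intro: finite_subset)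
  have X: "(c, a) \<in> S \<and> d \<le> real (card (S `` {a} \<inter> Y)) \<and> (even k \<longrightarrow> (a, c) \<in> S)" if "a \<in> X" for a
  proof -
    have "?B `` {a} \<noteq> {}" using bspec[OF row that] d(1) by auto
    moreover have "card (?B `` {a} \<inter> Y) \<le> card (S `` {a} \<inter> Y)"
      using finXY by (intro card_mono) (auto simp: germs_def)
    ultimately show ?thesis using bspec[OF row that] by (auto simp: germs_def)
  qed
  have Y: "d \<le> real (card (S `` {b} \<inter> X)) \<and> (odd k \<longrightarrow> (b, c) \<in> S)" if "b \<in> Y" for b
  proof -
    have "?B\<inverse> `` {b} \<noteq> {}" using bspec[OF col that] d(1) by auto
    moreover have "card (?B\<inverse> `` {b} \<inter> X) \<le> card (S `` {b} \<inter> X)"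
      using finXY by (intro card_mono) (auto simp: germs_def)
    ultimately show ?thesis using bspec[OF col that] by (auto simp: germs_def)
  qed
  show thesis using that[OF XY cX] X Y by auto
qed

lemma kernel_prod_diag_ge_of_germs:
  fixes W :: "'a \<Rightarrow> 'a \<Rightarrow> real" and d e :: real
  assumes fin: "finite V" and W: "\<And>x y. x \<in> V \<Longrightarrow> y \<in> V \<Longrightarrow> 0 \<le> W x y" and "c \<in> V" "2 \<le> k" "0 \<le> e"
    and S: "S \<subseteq> V \<times> V" "\<And>x y. (x, y) \<in> S \<Longrightarrow> e \<le> W x y"
    and d: "0 < d" "4 * d * card V \<le> real (card (germs S k c))"
  shows "(e * d) ^ (k - 1) * e \<le> kernel_prod V (replicate k W) c c"
proof -
  have "V \<noteq> {}" using \<open>c \<in> V\<close> by auto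
  then obtain X Y where XY: "X \<subseteq> V" "Y \<subseteq> V" and cX: "d \<le> real (card X)"
    and X: "\<forall>a\<in>X. (c, a) \<in> S \<and> d \<le> real (card (S `` {a} \<inter> Y))"
    and Y: "\<forall>b\<in>Y. d \<le> real (card (S `` {b} \<inter> X))" and last_arc: "\<forall>z\<in>if odd k then Y else X. (z, c) \<in> S"
    using zigzag_sets_of_germs[OF fin S(1) _ d] by blast
  have level_sum: "e * d \<le> (\<Sum>z\<in>B. W x z)" if "x \<in> V" "B \<subseteq> V" "d \<le> real (card (S `` {x} \<inter> B))" for x B
    using that fin W S(2) \<open>0 \<le> e\<close>
    by (intro sum_level_set_ge[where A = "S `` {x} \<inter> B"]) (auto intro: finite_subset)
  have "S `` {c} \<inter> X = X" using X by auto
  then have from_c: "e * d \<le> (\<Sum>z\<in>X. W c z)" using level_sum[OF \<open>c \<in> V\<close> XY(1)] cX by simp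
  have from_X: "e * d \<le> (\<Sum>z\<in>Y. W a z)" if "a \<in> X" for a using level_sum[OF _ XY(2)] X XY that by blast
  have from_Y: "e * d \<le> (\<Sum>z\<in>X. W b z)" if "b \<in> Y" for b using level_sum[OF _ XY(1)] Y XY that by blast
  define A where "A j = (if j = 0 then {c} else if odd j then X else Y)" for j :: nat
  define As where "As = map A [0..<k]"
  have "successively (\<lambda>A B. \<forall>x\<in>A. e * d \<le> (\<Sum>z\<in>B. W x z)) As"
    using from_c from_X from_Y by (auto simp: As_def A_def successively_conv_nth)
  moreover have "last As = (if odd k then Y else X)" using \<open>2 \<le> k\<close> by (auto simp: As_def A_def last_map)
  then have "e \<le> W z c" if "z \<in> last As" for z using that last_arc S(2) by auto
  moreover have "As \<noteq> []" "hd As = {c}" using \<open>2 \<le> k\<close> by (auto simp: As_def A_def hd_map)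
  moreover have "Z \<subseteq> V" if "Z \<in> set As" for Z using that XY \<open>c \<in> V\<close> by (auto simp: As_def A_def)
  ultimately have "(e * d) ^ (length As - 1) * e \<le> kernel_prod V (replicate (length As) W) c c"
    using \<open>0 \<le> e\<close> d(1) \<open>c \<in> V\<close> by (intro kernel_prod_ge_along_sets[OF fin W]) auto
  then show ?thesis by (simp add: As_def)
qed

lemma card_large_values_ge:
  fixes f :: "'a \<Rightarrow> real" and a b :: real
  assumes fin: "finite V" and f: "\<And>c. c \<in> V \<Longrightarrow> f c \<le> b" and "0 \<le> a"
    and sum: "2 * a * card V \<le> (\<Sum>c\<in>V. f c)"
  shows "a * card V \<le> card {c \<in> V. a \<le> f c} * b"
proof -
  let ?G = "{c \<in> V. a \<le> f c}"
  have "(\<Sum>c\<in>V. f c) \<le> (\<Sum>c\<in>V. (if a \<le> f c then b else 0) + a)"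
    using f \<open>0 \<le> a\<close> by (intro sum_mono) force
  also have "\<dots> = card ?G * b + card V * a" using fin by (simp add: sum.distrib sum.If_cases Int_def)
  finally show ?thesis using sum by (simp add: algebra_simps)
qed

lemma closed_walk_supersaturation:
  fixes W :: "'a \<Rightarrow> 'a \<Rightarrow> real" and \<beta> e :: real
  assumes fin: "finite V" and W: "\<And>x y. x \<in> V \<Longrightarrow> y \<in> V \<Longrightarrow> 0 \<le> W x y" and "2 \<le> k" "0 \<le> e"
    and S: "S \<subseteq> V \<times> V" "\<And>x y. (x, y) \<in> S \<Longrightarrow> e \<le> W x y"
    and \<beta>: "0 < \<beta>" "\<beta> \<le> 1 / 2" and n: "1 / \<beta>\<^sup>2 \<le> real (card V)"
    and dense: "(1 / 2 + 2 * \<beta>) * (real (card V))\<^sup>2 \<le> real (card S)"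
  shows "(e * (\<beta> ^ 5 / 8 * card V)) ^ k \<le> kernel_trace V (replicate k W)"
proof -
  let ?n = "real (card V)"
  define d where "d = \<beta> ^ 5 / 8 * ?n"
  have "0 < 1 / \<beta>\<^sup>2" using \<beta> by simp
  then have "0 < ?n" using n by linarith
  then have d: "0 < d" using \<beta> by (simp add: d_def)
  define G where "G = {c \<in> V. 4 * d * ?n \<le> real (card (germs S k c))}"
  have G: "G \<subseteq> V" by (auto simp: G_def)
  have "4 * d * ?n * ?n \<le> card G * (?n * ?n)"
    unfolding G_def
  proof (rule card_large_values_ge[OF fin])
    fix c
    have "card (germs S k c) \<le> card (V \<times> V)" using fin S(1) by (intro card_mono) (auto simp: germs_def)
    then show "real (card (germs S k c)) \<le> ?n * ?n"
      by (metis card_cartesian_product of_nat_le_iff of_nat_mult)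
    show "2 * (4 * d * ?n) * ?n \<le> (\<Sum>c\<in>V. real (card (germs S k c)))"
      using sum_card_germs_ge[OF fin S(1) \<beta> n dense, of k] by (simp add: d_def power3_eq_cube mult_ac)
  qed (use d in simp)
  then have "4 * d \<le> card G" using \<open>0 < ?n\<close> by (simp add: mult.assoc)
  then have cG: "d \<le> card G" using d by linarith
  have "(e * d) ^ k = d * ((e * d) ^ (k - 1) * e)"
    using \<open>2 \<le> k\<close> by (simp add: power_eq_if)
  also have "\<dots> \<le> card G * ((e * d) ^ (k - 1) * e)"
    using cG d \<open>0 \<le> e\<close> by (intro mult_right_mono) auto
  also have "\<dots> \<le> (\<Sum>c\<in>G. kernel_prod V (replicate k W) c c)"
    using \<open>2 \<le> k\<close> \<open>0 \<le> e\<close> d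
    by (intro sum_bounded_below kernel_prod_diag_ge_of_germs[OF fin W _ _ _ S]) (auto simp: G_def)
  also have "\<dots> \<le> kernel_trace V (replicate k W)"
    unfolding kernel_trace_def using fin G W by (intro sum_mono2 kernel_prod_nonneg) auto
  finally show ?thesis by (simp add: d_def)
qed

section \<open>Cycles in dense subgraphs of quasirandom digraphs\<close>

definition adj :: "'a rel \<Rightarrow> 'a \<Rightarrow> 'a \<Rightarrow> real" where
  "adj H u v = of_bool ((u, v) \<in> H)"

definition walks :: "'a set \<Rightarrow> 'a rel \<Rightarrow> nat \<Rightarrow> 'a \<Rightarrow> 'a \<Rightarrow> 'a list set" where
  "walks V H j x y = {ws. length ws = j \<and> set ws \<subseteq> V \<and> successively (\<lambda>u v. (u, v) \<in> H) (x # ws @ [y])}"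

definition quasirandom :: "real \<Rightarrow> 'a set \<Rightarrow> 'a rel \<Rightarrow> bool" where
  "quasirandom \<delta> V T \<longleftrightarrow> (\<forall>A\<subseteq>V. \<forall>B\<subseteq>V.
     real (card (T \<inter> A \<times> B)) \<le> real (card A) * real (card B) / 2 + \<delta> * (real (card V))\<^sup>2)"

definition dense_in_quasirandom :: "real \<Rightarrow> real \<Rightarrow> 'a set \<Rightarrow> 'a rel \<Rightarrow> bool" where
  "dense_in_quasirandom \<delta> \<epsilon> V H \<longleftrightarrow> finite V \<and> (1 / 4 + \<epsilon>) * (real (card V))\<^sup>2 \<le> real (card H) \<and>
     (\<exists>T. H \<subseteq> T \<and> T \<subseteq> V \<times> V \<and> quasirandom \<delta> V T)"

lemma unit_kernel_adj: "unit_kernel V (adj H)"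
  by (simp add: unit_kernel_def adj_def)

lemma sum_adj:
  assumes "finite A" "finite B"
  shows "(\<Sum>x\<in>A. \<Sum>y\<in>B. adj H x y) = card (H \<inter> A \<times> B)"
proof -
  have "(\<Sum>x\<in>A. \<Sum>y\<in>B. adj H x y) = (\<Sum>p\<in>A \<times> B. of_bool (p \<in> H))"
    by (simp add: adj_def sum.cartesian_product split_def)
  then show ?thesis using assms by (simp add: Int_commute)
qed

lemma finite_walks: "finite V \<Longrightarrow> finite (walks V H j x y)"
  by (rule finite_subset[OF _ finite_lists_length_eq[of V j]]) (auto simp: walks_def)

lemma kernel_prod_adj:
  assumes fin: "finite V" and "y \<in> V"
  shows "kernel_prod V (replicate (Suc j) (adj H)) x y = card (walks V H j x y)"
proof (induction j arbitrary: x)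
  case 0
  have "walks V H 0 x y = (if (x, y) \<in> H then {[]} else {})" by (auto simp: walks_def)
  then show ?case using kernel_prod_single[OF fin \<open>y \<in> V\<close>, of "adj H" x] by (simp add: adj_def)
next
  case (Suc j)
  let ?Z = "{z \<in> V. (x, z) \<in> H}"
  have "kernel_prod V (replicate (Suc (Suc j)) (adj H)) x y
      = (\<Sum>z\<in>V. adj H x z * kernel_prod V (replicate (Suc j) (adj H)) z y)" by simp
  also have "\<dots> = (\<Sum>z\<in>V. if (x, z) \<in> H then real (card (walks V H j z y)) else 0)"
    unfolding Suc.IH by (intro sum.cong) (auto simp: adj_def)
  also have "\<dots> = (\<Sum>z\<in>?Z. real (card ((#) z ` walks V H j z y)))"
    using fin by (simp add: sum.If_cases Int_def card_image)
  also have "\<dots> = real (card (\<Union>z\<in>?Z. (#) z ` walks V H j z y))"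
    using fin by (subst card_UN_disjoint) (auto simp: finite_walks)
  also have "(\<Union>z\<in>?Z. (#) z ` walks V H j z y) = walks V H (Suc j) x y"
    by (auto simp: walks_def length_Suc_conv image_iff)
  finally show ?case .
qed

lemma kernel_trace_adj:
  assumes fin: "finite V" and "0 < k"
  shows "kernel_trace V (replicate k (adj H)) = card {ws. length ws = k \<and> set ws \<subseteq> V \<and> cycle_arcs ws \<subseteq> H}"
proof -
  obtain j where k: "k = Suc j" using \<open>0 < k\<close> by (cases k) auto
  have "kernel_trace V (replicate k (adj H)) = (\<Sum>x\<in>V. real (card ((#) x ` walks V H j x x)))"
    unfolding kernel_trace_def k
    by (intro sum.cong refl) (simp add: kernel_prod_adj fin card_image del: kernel_prod.simps replicate.simps)
  also have "\<dots> = real (card (\<Union>x\<in>V. (#) x ` walks V H j x x))"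
    using fin by (subst card_UN_disjoint) (auto simp: finite_walks)
  also have "(\<Union>x\<in>V. (#) x ` walks V H j x x) = {ws. length ws = k \<and> set ws \<subseteq> V \<and> cycle_arcs ws \<subseteq> H}"
    by (auto simp: walks_def k length_Suc_conv successively_closed_walk_iff image_iff)
  finally show ?thesis .
qed

lemma card_nondistinct_lists_le:
  assumes fin: "finite V"
  shows "card {ws. length ws = k \<and> set ws \<subseteq> V \<and> \<not> distinct ws} \<le> k\<^sup>2 * card V ^ (k - 1)"
proof (induction k)
  case (Suc k)
  let ?bad = "\<lambda>k. {ws. length ws = k \<and> set ws \<subseteq> V \<and> \<not> distinct ws}"
  let ?all = "{ws. set ws \<subseteq> V \<and> length ws = k}"
  have fin_all: "finite ?all" using fin by (rule finite_lists_length_eq)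
  then have fin_bad: "finite (?bad k)" by (rule rev_finite_subset) auto
  have "?bad (Suc k) \<subseteq> (\<lambda>(x, ws). x # ws) ` (V \<times> ?bad k) \<union> (\<lambda>(i, ws). ws ! i # ws) ` ({..<k} \<times> ?all)"
  proof
    fix us assume "us \<in> ?bad (Suc k)"
    then obtain x ws where us: "us = x # ws" "length ws = k" "x \<in> V" "set ws \<subseteq> V" "x \<in> set ws \<or> \<not> distinct ws"
      by (auto simp: length_Suc_conv)
    then show "us \<in> (\<lambda>(x, ws). x # ws) ` (V \<times> ?bad k) \<union> (\<lambda>(i, ws). ws ! i # ws) ` ({..<k} \<times> ?all)"
      by (auto simp: in_set_conv_nth)
  qed
  then have "card (?bad (Suc k))
      \<le> card ((\<lambda>(x, ws). x # ws) ` (V \<times> ?bad k) \<union> (\<lambda>(i, ws). ws ! i # ws) ` ({..<k} \<times> ?all))"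
    using fin fin_all fin_bad by (intro card_mono) auto
  also have "\<dots> \<le> card (V \<times> ?bad k) + card ({..<k} \<times> ?all)"
    using fin fin_all fin_bad by (intro order_trans[OF card_Un_le] add_mono card_image_le) auto
  also have "\<dots> \<le> card V * (k\<^sup>2 * card V ^ (k - 1)) + k * card V ^ k"
    using Suc.IH fin by (simp add: card_cartesian_product card_lists_length_eq)
  also have "card V * (k\<^sup>2 * card V ^ (k - 1)) = k\<^sup>2 * card V ^ k" by (cases k) auto
  also have "k\<^sup>2 * card V ^ k + k * card V ^ k \<le> (Suc k)\<^sup>2 * card V ^ k"
    unfolding distrib_right[symmetric] by (intro mult_right_mono) (auto simp: power2_eq_square)
  finally show ?case by simp
qed simp

lemma cycle_of_many_closed_walks:
  assumes fin: "finite V" and "0 < k"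
    and many: "(real k)\<^sup>2 * real (card V) ^ (k - 1) < kernel_trace V (replicate k (adj H))"
  shows "\<exists>ws\<in>cycles_on V k. cycle_arcs ws \<subseteq> H"
proof (rule ccontr)
  assume no_cycle: "\<not> ?thesis"
  let ?nondistinct = "{ws. length ws = k \<and> set ws \<subseteq> V \<and> \<not> distinct ws}"
  have "finite ?nondistinct"
    by (rule finite_subset[OF _ finite_lists_length_eq[OF fin, of k]]) auto
  then have "card {ws. length ws = k \<and> set ws \<subseteq> V \<and> cycle_arcs ws \<subseteq> H} \<le> card ?nondistinct"
    using no_cycle by (intro card_mono) (auto simp: cycles_on_def)
  also have "\<dots> \<le> k\<^sup>2 * card V ^ (k - 1)" by (rule card_nondistinct_lists_le[OF fin])
  finally have "kernel_trace V (replicate k (adj H)) \<le> real (k\<^sup>2 * card V ^ (k - 1))"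
    unfolding kernel_trace_adj[OF fin \<open>0 < k\<close>] by (rule of_nat_mono)
  then show False using many by simp
qed

lemma block_avg2_adj_le:
  assumes fin: "finite V" and HT: "H \<subseteq> T" "T \<subseteq> V \<times> V" and qr: "quasirandom \<delta> V T"
    and large: "0 < s" "s \<le> real (card (block V \<phi> x))" "s \<le> real (card (block V \<phi> y))"
    and "0 \<le> e" "\<delta> * (real (card V))\<^sup>2 \<le> e * (s * s)"
  shows "block_avg2 V \<phi> (adj H) x y \<le> 1 / 2 + e"
proof -
  let ?X = "block V \<phi> x" and ?Y = "block V \<phi> y"
  let ?b = "real (card ?X) * real (card ?Y)"
  have "s * s \<le> ?b" using large by (intro mult_mono) auto
  then have "e * (s * s) \<le> e * ?b" using \<open>0 \<le> e\<close> by (rule mult_left_mono)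
  moreover have b: "0 < ?b" using large by simp
  moreover have finT: "finite T" by (rule finite_subset[OF HT(2)]) (simp add: fin)
  have "card (H \<inter> ?X \<times> ?Y) \<le> card (T \<inter> ?X \<times> ?Y)" using HT finT by (intro card_mono) auto
  moreover have "real (card (T \<inter> ?X \<times> ?Y)) \<le> ?b / 2 + \<delta> * (real (card V))\<^sup>2"
    using qr[unfolded quasirandom_def, rule_format, OF block_subset block_subset] .
  ultimately have "real (card (H \<inter> ?X \<times> ?Y)) \<le> (1 / 2 + e) * ?b"
    using assms(9) by (simp add: distrib_right)
  then show ?thesis using b fin by (simp add: block_avg2_eq sum_adj divide_le_eq)
qed

lemma card_small_blocks_le:
  fixes s :: real and M :: nat
  assumes fin: "finite V" and \<phi>: "\<phi> ` V \<subseteq> {..<M}" and "0 \<le> s"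
  shows "card {x \<in> V. card (block V \<phi> x) < s} \<le> M * s"
proof -
  let ?Z = "{x \<in> V. card (block V \<phi> x) < s}"
  have colour: "card {x \<in> ?Z. \<phi> x = i} \<le> s" for i
  proof (cases "{x \<in> ?Z. \<phi> x = i} = {}")
    case True
    then show ?thesis unfolding True using \<open>0 \<le> s\<close> by simp
  next
    case False
    then obtain x where x: "x \<in> ?Z" "\<phi> x = i" by auto
    have "card {x \<in> ?Z. \<phi> x = i} \<le> card (block V \<phi> x)"
      using fin x by (intro card_mono) (auto simp: block_def)
    then show ?thesis using x by simp
  qed
  have "?Z \<subseteq> (\<Union>i<M. {x \<in> ?Z. \<phi> x = i})" using \<phi> by blast
  then have "card ?Z \<le> card (\<Union>i<M. {x \<in> ?Z. \<phi> x = i})"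
    by (rule card_mono[rotated]) (simp add: fin)
  also have "\<dots> \<le> (\<Sum>i<M. card {x \<in> ?Z. \<phi> x = i})" by (rule card_UN_le) simp
  finally have "real (card ?Z) \<le> real (\<Sum>i<M. card {x \<in> ?Z. \<phi> x = i})" by (rule of_nat_mono)
  also have "\<dots> = (\<Sum>i<M. real (card {x \<in> ?Z. \<phi> x = i}))" by (rule of_nat_sum)
  also have "\<dots> \<le> of_nat (card {..<M}) * s" using colour by (rule sum_bounded_above)
  finally show ?thesis by simp
qed

lemma sum_le_card_level_set:
  fixes W :: "'a \<Rightarrow> 'a \<Rightarrow> real" and e :: real
  assumes fin: "finite V" and W: "unit_kernel V W" and "0 \<le> e"
    and Z: "Z \<subseteq> V" "real (card Z) \<le> e * card V" "\<And>x y. x \<in> V - Z \<Longrightarrow> y \<in> V - Z \<Longrightarrow> W x y \<le> 1 / 2 + e"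
  shows "(\<Sum>x\<in>V. \<Sum>y\<in>V. W x y) \<le> card {(x, y) \<in> V \<times> V. e \<le> W x y} / 2 + 4 * (e * (real (card V))\<^sup>2)"
proof -
  let ?n = "real (card V)" and ?S = "{(x, y). e \<le> W x y}"
  have S: "{(x, y) \<in> V \<times> V. e \<le> W x y} = ?S \<inter> V \<times> V" by auto
  define \<kappa> where "\<kappa> = 1 / 2 + e"
  have "(\<Sum>x\<in>V. \<Sum>y\<in>V. W x y)
      \<le> (\<Sum>x\<in>V. \<Sum>y\<in>V. (\<kappa> * adj ?S x y + e) + (of_bool (x \<in> Z) + of_bool (y \<in> Z)))"
  proof (intro sum_mono)
    fix x y assume xy: "x \<in> V" "y \<in> V"
    have nonneg: "0 \<le> \<kappa> * adj ?S x y" using \<open>0 \<le> e\<close> by (simp add: adj_def \<kappa>_def)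
    have "W x y \<le> 1" using W xy by (auto simp: unit_kernel_def)
    then show "W x y \<le> (\<kappa> * adj ?S x y + e) + (of_bool (x \<in> Z) + of_bool (y \<in> Z))"
      using nonneg \<open>0 \<le> e\<close> Z(3)[of x y] xy by (cases "e \<le> W x y") (auto simp: adj_def \<kappa>_def)
  qed
  also have "\<dots> = \<kappa> * (\<Sum>x\<in>V. \<Sum>y\<in>V. adj ?S x y) + e * ?n\<^sup>2 + 2 * (?n * card Z)"
    using fin Z(1)
    by (simp add: sum.distrib power2_eq_square algebra_simps Int_absorb1
        flip: sum_distrib_left sum_distrib_right)
  also have "(\<Sum>x\<in>V. \<Sum>y\<in>V. adj ?S x y) = card (?S \<inter> V \<times> V)" using fin by (simp add: sum_adj)
  finally have "(\<Sum>x\<in>V. \<Sum>y\<in>V. W x y) \<le> \<kappa> * card (?S \<inter> V \<times> V) + e * ?n\<^sup>2 + 2 * (?n * card Z)" .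
  moreover have "\<kappa> * card (?S \<inter> V \<times> V) \<le> card (?S \<inter> V \<times> V) / 2 + e * ?n\<^sup>2"
  proof -
    have "card (?S \<inter> V \<times> V) \<le> card (V \<times> V)" using fin by (intro card_mono) auto
    then have "real (card (?S \<inter> V \<times> V)) \<le> ?n\<^sup>2"
      by (metis card_cartesian_product of_nat_le_iff of_nat_mult power2_eq_square)
    from mult_left_mono[OF this \<open>0 \<le> e\<close>] show ?thesis by (simp add: \<kappa>_def distrib_right)
  qed
  moreover have "?n * card Z \<le> e * ?n\<^sup>2"
    using mult_left_mono[OF Z(2), of ?n] by (simp add: power2_eq_square mult_ac)
  ultimately show ?thesis unfolding S by linarith
qed

lemma card_level_set_block_avg2_ge:
  fixes e \<epsilon> :: real
  assumes dense: "dense_in_quasirandom \<delta> \<epsilon> V H" and "V \<noteq> {}"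
    and \<phi>: "\<phi> ` V \<subseteq> {..<M}" and "0 < e" "\<delta> \<le> e ^ 3 / (real M)\<^sup>2"
  shows "(1 / 2 + 2 * \<epsilon> - 8 * e) * (real (card V))\<^sup>2 \<le> card {(x, y) \<in> V \<times> V. e \<le> block_avg2 V \<phi> (adj H) x y}"
proof -
  let ?n = "real (card V)" and ?W = "block_avg2 V \<phi> (adj H)"
  obtain T where fin: "finite V" and HT: "H \<subseteq> T" "T \<subseteq> V \<times> V" and qr: "quasirandom \<delta> V T"
    and H: "(1 / 4 + \<epsilon>) * ?n\<^sup>2 \<le> real (card H)"
    using dense unfolding dense_in_quasirandom_def by blast
  define s where "s = e * ?n / M"
  define Z where "Z = {x \<in> V. card (block V \<phi> x) < s}"
  have n: "0 < ?n" using fin \<open>V \<noteq> {}\<close> by (simp add: card_gt_0_iff)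
  have M: "0 < M" using \<phi> \<open>V \<noteq> {}\<close> by (auto intro: gr0I)
  have s: "0 < s" "M * s = e * ?n" using \<open>0 < e\<close> n M by (simp_all add: s_def)
  have "\<delta> * ?n\<^sup>2 \<le> e ^ 3 / (real M)\<^sup>2 * ?n\<^sup>2" using assms(5) by (rule mult_right_mono) simp
  also have "\<dots> = e * (s * s)" by (simp add: s_def power2_eq_square power3_eq_cube)
  finally have \<delta>: "\<delta> * ?n\<^sup>2 \<le> e * (s * s)" .
  have "H \<inter> V \<times> V = H" using HT by auto
  then have "real (card H) = (\<Sum>x\<in>V. \<Sum>y\<in>V. adj H x y)" using fin by (simp add: sum_adj)
  also have "\<dots> = (\<Sum>x\<in>V. \<Sum>y\<in>V. ?W x y)"
    using sum_block_avg2[OF fin, of \<phi> "\<lambda>_ _. 1" "adj H"] by simp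
  also have "\<dots> \<le> card {(x, y) \<in> V \<times> V. e \<le> ?W x y} / 2 + 4 * (e * ?n\<^sup>2)"
  proof (rule sum_le_card_level_set[OF fin unit_kernel_block_avg2[OF unit_kernel_adj]])
    show "real (card Z) \<le> e * ?n"
      using card_small_blocks_le[OF fin \<phi>, where s = s] s by (simp add: Z_def)
    show "?W x y \<le> 1 / 2 + e" if "x \<in> V - Z" "y \<in> V - Z" for x y
      using that s \<delta> \<open>0 < e\<close> by (intro block_avg2_adj_le[OF fin HT qr, where s = s]) (auto simp: Z_def)
  qed (use \<open>0 < e\<close> in \<open>auto simp: Z_def\<close>)
  finally show ?thesis using H by (simp add: algebra_simps)
qed

lemma kernel_trace_block_avg2_ge:
  fixes \<epsilon> :: real
  assumes dense: "dense_in_quasirandom \<delta> \<epsilon> V H" and \<epsilon>: "0 < \<epsilon>" "\<epsilon> \<le> 1" and "2 \<le> k"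
    and \<phi>: "\<phi> ` V \<subseteq> {..<M}" "\<delta> \<le> (\<epsilon> / 8) ^ 3 / (real M)\<^sup>2" and n: "4 / \<epsilon>\<^sup>2 \<le> real (card V)"
  shows "(\<epsilon> / 8 * ((\<epsilon> / 2) ^ 5 / 8 * card V)) ^ k \<le> kernel_trace V (replicate k (block_avg2 V \<phi> (adj H)))"
proof -
  let ?W = "block_avg2 V \<phi> (adj H)"
  have fin: "finite V" using dense by (simp add: dense_in_quasirandom_def)
  have W: "unit_kernel V ?W" by (rule unit_kernel_block_avg2[OF unit_kernel_adj])
  have "0 < 4 / \<epsilon>\<^sup>2" using \<epsilon> by simp
  then have "0 < real (card V)" using n by linarith
  then have "V \<noteq> {}" by auto
  then have "(1 / 2 + 2 * (\<epsilon> / 2)) * (real (card V))\<^sup>2 \<le> card {(x, y) \<in> V \<times> V. \<epsilon> / 8 \<le> ?W x y}"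
    using card_level_set_block_avg2_ge[OF dense _ \<phi>(1) _ \<phi>(2)] \<epsilon> by (simp add: add.commute[of \<epsilon>])
  then show ?thesis
    using W \<open>2 \<le> k\<close> \<epsilon> n
    by (intro closed_walk_supersaturation[OF fin]) (auto simp: unit_kernel_def power2_eq_square)
qed

lemma closed_walks_in_dense_subgraph:
  fixes \<epsilon> :: real
  assumes k: "3 \<le> k" and \<epsilon>: "0 < \<epsilon>" "\<epsilon> \<le> 1"
  obtains c \<delta> where "0 < c" "0 < \<delta>"
    "\<forall>(V :: 'a set) H. dense_in_quasirandom \<delta> \<epsilon> V H \<longrightarrow> 4 / \<epsilon>\<^sup>2 \<le> real (card V)
      \<longrightarrow> c * real (card V) ^ k \<le> kernel_trace V (replicate k (adj H))"
proof -
  define c where "c = (\<epsilon> / 8 * ((\<epsilon> / 2) ^ 5 / 8)) ^ k"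
  define \<eta> where "\<eta> = c / (2 * k)"
  define M where "M = (4::nat) ^ nat \<lceil>1 / \<eta>\<^sup>2\<rceil>"
  define \<delta> where "\<delta> = (\<epsilon> / 8) ^ 3 / (real M)\<^sup>2"
  have c: "0 < c" using \<epsilon> by (simp add: c_def)
  have \<eta>: "0 < \<eta>" using c k by (simp add: \<eta>_def)
  have \<delta>: "0 < \<delta>" using \<epsilon> by (simp add: \<delta>_def M_def)
  have "c / 2 * real (card V) ^ k \<le> kernel_trace V (replicate k (adj H))"
    if dense: "dense_in_quasirandom \<delta> \<epsilon> V H" and n: "4 / \<epsilon>\<^sup>2 \<le> real (card V)" for V :: "'a set" and H
  proof -
    let ?n = "real (card V)"
    have fin: "finite V" using dense by (simp add: dense_in_quasirandom_def)
    obtain \<phi> where \<phi>: "\<phi> ` V \<subseteq> {..<M}" and close: "cut_close V \<eta> (adj H) (block_avg2 V \<phi> (adj H))"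
      using weak_regularity[OF fin unit_kernel_adj \<eta>] unfolding M_def .
    have "c * ?n ^ k = (\<epsilon> / 8 * ((\<epsilon> / 2) ^ 5 / 8 * ?n)) ^ k"
      unfolding c_def by (simp only: power_mult_distrib mult.assoc)
    also have "\<dots> \<le> kernel_trace V (replicate k (block_avg2 V \<phi> (adj H)))"
      by (rule kernel_trace_block_avg2_ge[OF dense \<epsilon> _ \<phi> _ n]) (use k in \<open>simp_all add: \<delta>_def\<close>)
    also have "\<dots> \<le> kernel_trace V (replicate k (adj H)) + real k * (\<eta> * ?n ^ k)"
      using close by (intro kernel_trace_power_le[OF fin k] unit_kernel_block_avg2 unit_kernel_adj)
    finally show ?thesis using k by (simp add: \<eta>_def)
  qed
  then show thesis using that[of "c / 2" \<delta>] c \<delta> by simp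
qed

theorem dense_subgraph_of_quasirandom_has_cycle:
  fixes \<epsilon> :: real
  assumes k: "3 \<le> k" and \<epsilon>: "0 < \<epsilon>" "\<epsilon> \<le> 1"
  obtains \<delta> N where "0 < \<delta>"
    "\<forall>(V :: 'a set) H. dense_in_quasirandom \<delta> \<epsilon> V H \<longrightarrow> N \<le> card V \<longrightarrow> (\<exists>ws\<in>cycles_on V k. cycle_arcs ws \<subseteq> H)"
proof -
  obtain c \<delta> where c: "0 < c" and \<delta>: "0 < \<delta>"
    and trace: "\<forall>(V :: 'a set) H. dense_in_quasirandom \<delta> \<epsilon> V H \<longrightarrow> 4 / \<epsilon>\<^sup>2 \<le> real (card V)
      \<longrightarrow> c * real (card V) ^ k \<le> kernel_trace V (replicate k (adj H))"
    using closed_walks_in_dense_subgraph[OF assms] .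
  define N where "N = nat \<lceil>max (4 / \<epsilon>\<^sup>2) ((real k)\<^sup>2 / c)\<rceil> + 1"
  have "\<exists>ws\<in>cycles_on V k. cycle_arcs ws \<subseteq> H"
    if dense: "dense_in_quasirandom \<delta> \<epsilon> V H" and N: "N \<le> card V" for V :: "'a set" and H
  proof (rule cycle_of_many_closed_walks)
    let ?n = "real (card V)"
    have "max (4 / \<epsilon>\<^sup>2) ((real k)\<^sup>2 / c) < ?n"
      using N real_nat_ceiling_ge[of "max (4 / \<epsilon>\<^sup>2) ((real k)\<^sup>2 / c)"] unfolding N_def by linarith
    then have n: "4 / \<epsilon>\<^sup>2 \<le> ?n" "(real k)\<^sup>2 / c < ?n" by simp_all
    then have "(real k)\<^sup>2 < c * ?n" using c by (simp add: pos_divide_less_eq mult.commute)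
    moreover have "0 < ?n" using N by (simp add: N_def)
    ultimately have "(real k)\<^sup>2 * ?n ^ (k - 1) < c * ?n * ?n ^ (k - 1)"
      by (intro mult_strict_right_mono) auto
    also have "\<dots> = c * ?n ^ k" using k by (simp add: power_eq_if)
    also have "\<dots> \<le> kernel_trace V (replicate k (adj H))" using trace dense n(1) by blast
    finally show "(real k)\<^sup>2 * ?n ^ (k - 1) < kernel_trace V (replicate k (adj H))" .
    show "finite V" using dense by (simp add: dense_in_quasirandom_def)
  qed (use k in simp)
  then show thesis using that[OF \<delta>] by blast
qed

section \<open>Decomposing complete graphs into cycles\<close>

locale cycle_decomposition =
  fixes k :: nat and V :: "'a set" and C :: "'a list set"
  assumes three_le: "3 \<le> k" and finite_verts: "finite V" and cycles: "C \<subseteq> cycles_on V k"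
    and edges_disjoint: "pairwise (\<lambda>ws ws'. disjnt (cycle_edges ws) (cycle_edges ws')) C"
    and edges_cover: "\<lbrakk>u \<in> V; v \<in> V; u \<noteq> v\<rbrakk> \<Longrightarrow> \<exists>ws\<in>C. (u, v) \<in> cycle_edges ws"

lemma pairwise_disjnt_of_card_UN:
  assumes fin: "finite I" "\<And>i. i \<in> I \<Longrightarrow> finite (A i)" and card_le: "(\<Sum>i\<in>I. card (A i)) \<le> card (\<Union>i\<in>I. A i)"
  shows "pairwise (\<lambda>i j. disjnt (A i) (A j)) I"
proof (rule pairwiseI, rule ccontr)
  fix i j assume ij: "i \<in> I" "j \<in> I" "i \<noteq> j" and "\<not> disjnt (A i) (A j)"
  then obtain x where x: "x \<in> A i" "x \<in> A j" by (auto simp: disjnt_iff)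
  have "(\<Union>i\<in>I. A i) = (A i - {x}) \<union> (\<Union>j\<in>I - {i}. A j)" using ij x by auto
  then have "card (\<Union>i\<in>I. A i) \<le> card (A i - {x}) + card (\<Union>j\<in>I - {i}. A j)"
    by (simp only: card_Un_le)
  also have "card (\<Union>j\<in>I - {i}. A j) \<le> (\<Sum>j\<in>I - {i}. card (A j))" using fin by (intro card_UN_le) auto
  also have "card (A i - {x}) < card (A i)" using fin(2)[OF ij(1)] x by (intro card_Diff1_less)
  also have "card (A i) + (\<Sum>j\<in>I - {i}. card (A j)) = (\<Sum>i\<in>I. card (A i))"
    using sum.remove[OF fin(1) ij(1), of "\<lambda>i. card (A i)"] by simp
  finally show False using card_le by simp
qed

lemma card_off_diagonal:
  assumes "finite V"
  shows "card (V \<times> V - Id) = card V * (card V - 1)"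
proof -
  have "V \<times> V - Id = V \<times> V - Id_on V" by auto
  moreover have "card (Id_on V) = card V" by (simp add: Id_on_def card_UN_disjoint assms)
  moreover have "finite (Id_on V)" "Id_on V \<subseteq> V \<times> V" using assms by (auto simp: Id_on_def)
  ultimately show ?thesis
    by (simp add: card_Diff_subset card_cartesian_product diff_mult_distrib2)
qed

lemma sum_card_cycle_edges:
  assumes "3 \<le> k" "C \<subseteq> cycles_on V k"
  shows "(\<Sum>ws\<in>C. card (cycle_edges ws)) = 2 * k * card C"
proof -
  have "card (cycle_edges ws) = 2 * k" if "ws \<in> C" for ws
    using assms that card_cycle_edges[of ws] by (auto simp: cycles_on_def)
  then show ?thesis by simp
qed

lemma Union_cycle_edges_eq:
  assumes "3 \<le> k" "C \<subseteq> cycles_on V k" "\<And>u v. u \<in> V \<Longrightarrow> v \<in> V \<Longrightarrow> u \<noteq> v \<Longrightarrow> \<exists>ws\<in>C. (u, v) \<in> cycle_edges ws"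
  shows "(\<Union>ws\<in>C. cycle_edges ws) = V \<times> V - Id"
proof -
  have "cycle_edges ws \<subseteq> V \<times> V - Id" if "ws \<in> C" for ws
    using assms(1,2) that cycle_edges_subset[of ws] cycle_edges_irrefl[of ws] by (force simp: cycles_on_def)
  then have "(\<Union>ws\<in>C. cycle_edges ws) \<subseteq> V \<times> V - Id" by (rule UN_least)
  moreover have "V \<times> V - Id \<subseteq> (\<Union>ws\<in>C. cycle_edges ws)" using assms(3) by auto
  ultimately show ?thesis by (rule equalityI)
qed

lemma cycle_decompositionI_card:
  assumes "3 \<le> k" "finite V" "C \<subseteq> cycles_on V k"
    and "\<And>u v. u \<in> V \<Longrightarrow> v \<in> V \<Longrightarrow> u \<noteq> v \<Longrightarrow> \<exists>ws\<in>C. (u, v) \<in> cycle_edges ws"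
    and "2 * k * card C \<le> card V * (card V - 1)"
  shows "cycle_decomposition k V C"
proof
  have "finite C" using assms(2,3) finite_cycles_on by (metis finite_subset)
  moreover have "(\<Union>ws\<in>C. cycle_edges ws) = V \<times> V - Id"
    using assms(4) by (rule Union_cycle_edges_eq[OF assms(1,3)])
  then have "(\<Sum>ws\<in>C. card (cycle_edges ws)) \<le> card (\<Union>ws\<in>C. cycle_edges ws)"
    using assms(5) by (simp add: sum_card_cycle_edges[OF assms(1,3)] card_off_diagonal[OF assms(2)])
  ultimately show "pairwise (\<lambda>ws ws'. disjnt (cycle_edges ws) (cycle_edges ws')) C"
    by (intro pairwise_disjnt_of_card_UN) auto
qed (use assms in auto)

context cycle_decomposition
begin

lemma finite_cycles: "finite C"
  using cycles finite_cycles_on[OF finite_verts] by (rule finite_subset)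

lemma cycle_decomposition_card: "2 * k * card C = card V * (card V - 1)"
proof -
  have "2 * k * card C = (\<Sum>ws\<in>C. card (cycle_edges ws))"
    using sum_card_cycle_edges[OF three_le cycles] by simp
  also have "\<dots> = card (\<Union>ws\<in>C. cycle_edges ws)"
    using finite_cycles edges_disjoint
    by (intro card_UN_disjoint[symmetric]) (auto simp: pairwise_def disjnt_def)
  also have "\<dots> = card V * (card V - 1)"
    using Union_cycle_edges_eq[OF three_le cycles edges_cover] card_off_diagonal[OF finite_verts] by simp
  finally show ?thesis .
qed

lemma cycle_decomposition_bij_betw:
  assumes f: "bij_betw f V V'"
  shows "cycle_decomposition k V' (map f ` C)"
proof (rule cycle_decompositionI_card)
  have inj: "inj_on f V" and im: "f ` V = V'" using f by (auto simp: bij_betw_def)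
  show "map f ` C \<subseteq> cycles_on V' k" using cycles map_in_cycles_on[OF _ inj, of _ k V'] im by blast
  show "\<exists>ws\<in>map f ` C. (u, v) \<in> cycle_edges ws" if uv: "u \<in> V'" "v \<in> V'" "u \<noteq> v" for u v
  proof -
    obtain u' v' where uv': "u = f u'" "v = f v'" "u' \<in> V" "v' \<in> V" using uv im by auto
    then obtain ws where "ws \<in> C" "(u', v') \<in> cycle_edges ws" using edges_cover[of u' v'] uv by auto
    then show ?thesis using uv' by (force simp: cycle_edges_map)
  qed
  have "2 * k * card (map f ` C) \<le> 2 * k * card C" by (simp add: card_image_le finite_cycles)
  then show "2 * k * card (map f ` C) \<le> card V' * (card V' - 1)"
    using cycle_decomposition_card bij_betw_same_card[OF f] by simp
qed (use three_le finite_verts bij_betw_finite[OF f] in auto)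

end

lemma cycle_decomposition_transfer:
  assumes "cycle_decomposition k V C" "finite V'" "card V = card V'"
  shows "\<exists>C'. cycle_decomposition k V' C'"
proof -
  have "finite V" using assms(1) by (rule cycle_decomposition.finite_verts)
  then obtain f where "bij_betw f V V'" using assms(2,3) finite_same_card_bij by blast
  then show ?thesis using cycle_decomposition.cycle_decomposition_bij_betw[OF assms(1)] by blast
qed

lemma symmetric_difference_cover:
  fixes n m :: int
  assumes n: "n = 2 * m + 1" and "sym E" and small: "\<And>d. 1 \<le> d \<Longrightarrow> d \<le> m \<Longrightarrow> \<exists>(x, y)\<in>E. n dvd y - x - d"
    and "0 \<le> m" "\<not> n dvd c"
  shows "\<exists>(x, y)\<in>E. n dvd y - x - c"
proof -
  define d where "d = c mod n"
  have d: "n dvd d - c" by (simp add: d_def mod_eq_dvd_iff[symmetric])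
  have "0 < n" using \<open>0 \<le> m\<close> n by simp
  then have "d \<noteq> 0" "0 \<le> d" "d < n" using \<open>\<not> n dvd c\<close> by (simp_all add: d_def mod_eq_0_iff_dvd)
  then consider "1 \<le> d" "d \<le> m" | "1 \<le> n - d" "n - d \<le> m" using n by linarith
  then show ?thesis
  proof cases
    case 1
    then obtain x y where "(x, y) \<in> E" "n dvd y - x - d" using small by blast
    moreover have "y - x - c = (y - x - d) + (d - c)" by simp
    ultimately show ?thesis using d by (metis (no_types, lifting) case_prodI dvd_add)
  next
    case 2
    then obtain x y where "(x, y) \<in> E" "n dvd y - x - (n - d)" using small by blast
    moreover have "x - y - c = (d - c) - (y - x - (n - d)) - n" by simp
    ultimately show ?thesis
      using d \<open>sym E\<close> by (metis (no_types, lifting) case_prodI symD dvd_diff dvd_refl)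
  qed
qed

definition cyclic_shift :: "int \<Rightarrow> int \<Rightarrow> int list \<Rightarrow> int list" where
  "cyclic_shift n t = map (\<lambda>x. (x + t) mod n)"

lemma cyclic_shift_in_cycles_on:
  assumes "0 < n" "distinct (map (\<lambda>x. x mod n) ws)"
  shows "cyclic_shift n t ws \<in> cycles_on {0..<n} (length ws)"
proof -
  have "distinct ws" and inj: "inj_on (\<lambda>x. x mod n) (set ws)" using assms(2) by (simp_all add: distinct_map)
  have "inj_on (\<lambda>x. (x + t) mod n) (set ws)"
  proof (rule inj_onI)
    fix x y assume "x \<in> set ws" "y \<in> set ws" "(x + t) mod n = (y + t) mod n"
    moreover from this(3) have "x mod n = y mod n" by (simp add: mod_eq_dvd_iff)
    ultimately show "x = y" using inj by (simp add: inj_on_def)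
  qed
  then show ?thesis
    using \<open>0 < n\<close> \<open>distinct ws\<close> by (auto simp: cycles_on_def cyclic_shift_def distinct_map)
qed

lemma cyclic_shift_edge:
  assumes "(x, y) \<in> cycle_edges ws" "n dvd y - x - (v - u)" "u \<in> {0..<n}" "v \<in> {0..<n}"
  shows "(u, v) \<in> cycle_edges (cyclic_shift n ((u - x) mod n) ws)"
proof -
  have "(x + (u - x) mod n) mod n = u" using assms(3) by (simp add: mod_simps)
  moreover have "(y + (u - x)) mod n = v mod n" using assms(2) by (simp add: mod_eq_dvd_iff algebra_simps)
  then have "(y + (u - x) mod n) mod n = v" using assms(4) by (simp add: mod_simps)
  ultimately show ?thesis
    unfolding cyclic_shift_def cycle_edges_map using assms(1) by (force intro: rev_image_eqI)
qed

lemma cyclic_cycle_decomposition: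
  fixes B :: "int list set" and n :: int
  assumes k: "3 \<le> k" and B: "finite B" "\<And>ws. ws \<in> B \<Longrightarrow> length ws = k \<and> distinct (map (\<lambda>x. x mod n) ws)"
    and n: "n = 2 * int (k * card B) + 1"
    and differences: "\<And>d. 1 \<le> d \<Longrightarrow> d \<le> int (k * card B) \<Longrightarrow> \<exists>(x, y)\<in>(\<Union>ws\<in>B. cycle_edges ws). n dvd y - x - d"
  shows "\<exists>C. cycle_decomposition k {0..<n} C"
proof
  define C where "C = (\<lambda>(ws, t). cyclic_shift n t ws) ` (B \<times> {0..<n})"
  have "0 < n" by (simp add: n)
  show "cycle_decomposition k {0..<n} C"
  proof (rule cycle_decompositionI_card[OF k])
    show "C \<subseteq> cycles_on {0..<n} k"
      using cyclic_shift_in_cycles_on[OF \<open>0 < n\<close>] B(2) by (auto simp: C_def)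
    show "\<exists>ws\<in>C. (u, v) \<in> cycle_edges ws" if uv: "u \<in> {0..<n}" "v \<in> {0..<n}" "u \<noteq> v" for u v
    proof -
      have "\<not> n dvd v - u" using uv by (metis atLeastLessThan_iff mod_eq_dvd_iff mod_pos_pos_trivial)
      moreover have "sym (\<Union>ws\<in>B. cycle_edges ws)" by (auto simp: sym_def intro: cycle_edges_sym)
      ultimately obtain ws x y where ws: "ws \<in> B" "(x, y) \<in> cycle_edges ws" "n dvd y - x - (v - u)"
        using symmetric_difference_cover[OF n _ differences] by fastforce
      have "cyclic_shift n ((u - x) mod n) ws \<in> C" using ws(1) \<open>0 < n\<close> by (auto simp: C_def)
      then show ?thesis using cyclic_shift_edge[OF ws(2,3) uv(1,2)] by blast
    qed
    have "card C \<le> card (B \<times> {0..<n})" unfolding C_def using B(1) by (intro card_image_le) auto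
    then have "2 * k * card C \<le> 2 * k * card B * nat n" by (simp add: card_cartesian_product)
    also have "2 * k * card B = nat n - 1" by (simp add: n nat_add_distrib nat_mult_distrib)
    finally show "2 * k * card C \<le> card {0..<n} * (card {0..<n} - 1)" by (simp add: mult.commute)
  qed simp
qed

section \<open>Zigzag labellings of cycles\<close>

text \<open>A labelling of the \<open>k\<close>-cycle whose edge differences are \<open>1, \<dots>, k\<close>, except that \<open>k\<close> becomes
  \<open>k + 1\<close> when \<open>k mod 4 \<in> {1, 2}\<close>. The low labels run upwards at even positions, the high ones
  downwards at odd positions; one difference is skipped halfway and supplied by the closing edge.\<close>

definition zig_shift :: "nat \<Rightarrow> nat" where
  "zig_shift k = (k + 1) div 2 mod 2"

definition zig :: "nat \<Rightarrow> nat \<Rightarrow> int" where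
  "zig k j = (let i = j div 2 in
     if even j then int i + (if 0 < i then int (zig_shift k) else 0)
     else int k + int (zig_shift k) - int i - (if (k + 1) div 4 \<le> i then 1 else 0))"

definition zig_diff :: "nat \<Rightarrow> nat \<Rightarrow> int" where
  "zig_diff k d = int d + (if d = k then int (zig_shift k) else 0)"

lemma zig_even: "zig k (2 * i) = int i + (if 0 < i then int (zig_shift k) else 0)"
  by (simp add: zig_def)

lemma zig_odd: "zig k (2 * i + 1) = int k + int (zig_shift k) - int i - (if (k + 1) div 4 \<le> i then 1 else 0)"
  by (simp add: zig_def)

lemma zig_shift_le: "zig_shift k \<le> 1"
  by (simp add: zig_shift_def)

lemma zig_quarter: "k + 1 = 4 * ((k + 1) div 4) + 2 * zig_shift k + of_bool (even k)"
proof -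
  have "(k + 1) div 4 = (k + 1) div 2 div 2" by (simp flip: div_mult2_eq)
  then have "(k + 1) div 2 = 2 * ((k + 1) div 4) + zig_shift k" by (simp add: zig_shift_def)
  moreover have "k + 1 = 2 * ((k + 1) div 2) + of_bool (even k)" by (simp add: mod2_eq_if)
  ultimately show ?thesis by linarith
qed

lemma zig_low_less_high:
  assumes "2 * i < k" "2 * j + 1 < k"
  shows "0 \<le> zig k (2 * i)" "zig k (2 * i) < zig k (2 * j + 1)" "zig k (2 * j + 1) \<le> int k + 1"
  unfolding zig_even zig_odd using assms zig_quarter[of k] zig_shift_le[of k]
  by (auto split: if_splits)

lemma zig_range:
  assumes "2 \<le> k" "j < k"
  shows "zig k j \<in> {0..int k + 1}"
proof (cases "even j")
  case True
  then obtain i where "j = 2 * i" by (elim evenE)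
  then show ?thesis using zig_low_less_high[of i k 0] assms by auto
next
  case False
  then obtain i where "j = 2 * i + 1" by (elim oddE)
  then show ?thesis using zig_low_less_high[of 0 k i] assms by auto
qed

lemma inj_on_zig: "inj_on (zig k) {..<k}"
proof (rule inj_onI)
  fix i j assume ij: "i \<in> {..<k}" "j \<in> {..<k}" and eq: "zig k i = zig k j"
  have False if "even i" "odd j" "i < k" "j < k" "zig k i = zig k j" for i j
    using that zig_low_less_high(2)[of "i div 2" k "j div 2"] by (auto elim!: evenE oddE)
  then have "even i = even j" using ij eq by (metis lessThan_iff)
  then consider a b where "i = 2 * a" "j = 2 * b" | a b where "i = 2 * a + 1" "j = 2 * b + 1"
    by (cases "even i") (auto elim!: evenE oddE)
  then show "i = j"
  proof cases
    case 1
    then show ?thesis using eq by (auto simp: zig_even split: if_splits)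
  next
    case 2
    then show ?thesis using eq unfolding 2 zig_odd by (auto split: if_splits)
  qed
qed

lemma cycle_edges_upt:
  assumes "Suc j < k"
  shows "(j, Suc j) \<in> cycle_edges [0..<k]" "(Suc j, j) \<in> cycle_edges [0..<k]"
    "(0, k - 1) \<in> cycle_edges [0..<k]"
proof -
  have "(j, Suc j) \<in> cycle_arcs [0..<k]" "(k - 1, 0) \<in> cycle_arcs [0..<k]"
    using assms by (auto simp: cycle_arcs_conv_nth image_iff intro: bexI[of _ j] bexI[of _ "k - 1"])
  then show "(j, Suc j) \<in> cycle_edges [0..<k]" "(Suc j, j) \<in> cycle_edges [0..<k]"
    "(0, k - 1) \<in> cycle_edges [0..<k]"
    by (auto simp: cycle_edges_def)
qed

lemma zig_closing_edge:
  assumes k: "3 \<le> k" and d: "d = k - 2 * ((k + 1) div 4)"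
  shows "zig k (k - 1) - zig k 0 = zig_diff k d"
proof (cases "even k")
  case even: True
  then obtain i where "k = 2 * i" by (elim evenE)
  then have i: "k - 1 = 2 * (i - 1) + 1" "k = 2 * i" "1 < i" using k by auto
  show ?thesis
    unfolding i(1) zig_odd zig_diff_def
    using d even i(2,3) zig_quarter[of k] zig_shift_le[of k] zig_even[of k 0]
    by (auto split: if_splits)
next
  case odd: False
  then obtain i where i: "k = 2 * i + 1" by (elim oddE)
  then have "k - 1 = 2 * i" by simp
  then show ?thesis
    using d odd i k zig_quarter[of k] zig_shift_le[of k] zig_even[of k i] zig_even[of k 0]
    by (auto simp: zig_diff_def)
qed

lemma zig_edge:
  assumes k: "3 \<le> k" and d: "1 \<le> d" "d \<le> k"
  shows "\<exists>(a, b)\<in>cycle_edges [0..<k]. zig k b - zig k a = zig_diff k d \<and> (even k \<longrightarrow> even a \<and> odd b)"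
proof (cases "d = k - 2 * ((k + 1) div 4)")
  case True
  then show ?thesis
    using zig_closing_edge[OF k] cycle_edges_upt(3)[of 0 k] k by (intro bexI[of _ "(0, k - 1)"]) auto
next
  case False
  define j where "j = (if k - 2 * ((k + 1) div 4) < d then k - d else k - 1 - d)"
  obtain q where q: "(k + 1) div 4 = q" by simp
  have "1 \<le> q" "2 * q < k"
    using k zig_quarter[of k] zig_shift_le[of k] unfolding q by (cases "even k"; simp)+
  then have j: "int d = int k - int j - (if 2 * ((k + 1) div 4) \<le> j then 1 else 0)"
      "j = 0 \<longleftrightarrow> d = k" "Suc j < k"
    unfolding j_def q using False[unfolded q] d by auto
  show ?thesis
  proof (cases "even j")
    case True
    then obtain i where i: "j = 2 * i" by (elim evenE)
    have "zig k (2 * i + 1) - zig k (2 * i) = zig_diff k d"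
      unfolding zig_even zig_odd zig_diff_def using i j by auto
    then show ?thesis using cycle_edges_upt(1)[OF j(3)] i by (intro bexI[of _ "(j, Suc j)"]) auto
  next
    case False
    then obtain i where i: "j = 2 * i + 1" by (elim oddE)
    have "zig k (2 * i + 1) - zig k (2 * (i + 1)) = zig_diff k d"
      unfolding zig_even zig_odd zig_diff_def using i j by auto
    then show ?thesis using cycle_edges_upt(2)[OF j(3)] i by (intro bexI[of _ "(Suc j, j)"]) auto
  qed
qed

lemma zig_diff_cover:
  assumes "1 \<le> c" "c \<le> 2 * int k"
  shows "\<exists>d. 1 \<le> d \<and> d \<le> k \<and> (zig_diff k d = c \<or> zig_diff k d = 2 * int k + 1 - c)"
proof -
  consider "c \<le> int k - 1" | "c \<in> {int k, int k + 1}" | "int k + 2 \<le> c" by force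
  then show ?thesis
  proof cases
    case 1
    then show ?thesis using assms by (intro exI[of _ "nat c"]) (auto simp: zig_diff_def)
  next
    case 2
    then show ?thesis using assms zig_shift_le[of k] by (intro exI[of _ k]) (auto simp: zig_diff_def)
  next
    case 3
    then show ?thesis using assms by (intro exI[of _ "nat (2 * int k + 1 - c)"]) (auto simp: zig_diff_def)
  qed
qed

lemma cycle_decomposition_2k_plus_1:
  assumes k: "3 \<le> k" and V: "finite V" "card V = 2 * k + 1"
  shows "\<exists>C. cycle_decomposition k V C"
proof -
  let ?n = "2 * int k + 1" and ?ws = "map (zig k) [0..<k]"
  have "\<exists>C. cycle_decomposition k {0..<?n} C"
  proof (rule cyclic_cycle_decomposition[OF k, of "{?ws}"])
    have "zig k j mod ?n = zig k j" if "j < k" for j using zig_range[of k j] k that by auto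
    then have "inj_on (\<lambda>j. zig k j mod ?n) {..<k}" using inj_on_zig[of k] by (auto simp: inj_on_def)
    then show "length ws = k \<and> distinct (map (\<lambda>x. x mod ?n) ws)" if "ws \<in> {?ws}" for ws
      using that by (simp add: distinct_map o_def atLeast0LessThan)
    fix c assume "1 \<le> c" "c \<le> int (k * card {?ws})"
    then obtain d where d: "1 \<le> d" "d \<le> k" "zig_diff k d = c \<or> zig_diff k d = ?n - c"
      using zig_diff_cover[of c k] by auto
    obtain a b where ab: "(a, b) \<in> cycle_edges [0..<k]" "zig k b - zig k a = zig_diff k d"
      using zig_edge[OF k d(1,2)] by blast
    have edges: "(zig k a, zig k b) \<in> cycle_edges ?ws" "(zig k b, zig k a) \<in> cycle_edges ?ws"
      using ab(1) cycle_edges_sym[OF ab(1)] by (auto simp: cycle_edges_map)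
    from d(3) have "\<exists>(x, y)\<in>cycle_edges ?ws. ?n dvd y - x - c"
    proof
      assume "zig_diff k d = c"
      then show ?thesis using edges(1) ab(2) by (intro bexI[of _ "(zig k a, zig k b)"]) auto
    next
      assume "zig_diff k d = ?n - c"
      then have "zig k a - zig k b - c = - ?n" using ab(2) by simp
      then show ?thesis
        using edges(2) by (intro bexI[of _ "(zig k b, zig k a)"]) (auto simp del: minus_add_distrib)
    qed
    then show "\<exists>(x, y)\<in>(\<Union>ws\<in>{?ws}. cycle_edges ws). ?n dvd y - x - c" by simp
  qed auto
  then obtain C where "cycle_decomposition k {0..<?n} C" ..
  then show ?thesis
    by (rule cycle_decomposition_transfer[OF _ V(1)]) (simp add: V(2) nat_add_distrib nat_mult_distrib)
qed

section \<open>Decompositions into even cycles\<close>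

lemma cycle_decomposition_Union:
  assumes k: "3 \<le> k" and V: "finite V" and G: "finite G"
    and B: "\<And>g. g \<in> G \<Longrightarrow> cycle_decomposition k (P g) (B g)" "\<And>g. g \<in> G \<Longrightarrow> P g \<subseteq> V"
    and X: "X \<subseteq> cycles_on V k"
    and cover: "\<And>u v. \<lbrakk>u \<in> V; v \<in> V; u \<noteq> v; \<And>g. g \<in> G \<Longrightarrow> \<not> {u, v} \<subseteq> P g\<rbrakk> \<Longrightarrow> \<exists>ws\<in>X. (u, v) \<in> cycle_edges ws"
    and card: "2 * k * card X + (\<Sum>g\<in>G. card (P g) * (card (P g) - 1)) \<le> card V * (card V - 1)"
  shows "cycle_decomposition k V (X \<union> (\<Union>g\<in>G. B g))"
proof (rule cycle_decompositionI_card[OF k V])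
  have "B g \<subseteq> cycles_on V k" if "g \<in> G" for g
    using cycle_decomposition.cycles[OF B(1)] cycles_on_mono[OF B(2)] that by blast
  then show "X \<union> (\<Union>g\<in>G. B g) \<subseteq> cycles_on V k" using X by blast
  show "\<exists>ws\<in>X \<union> (\<Union>g\<in>G. B g). (u, v) \<in> cycle_edges ws" if uv: "u \<in> V" "v \<in> V" "u \<noteq> v" for u v
  proof (cases "\<exists>g\<in>G. {u, v} \<subseteq> P g")
    case True
    then obtain g where g: "g \<in> G" "u \<in> P g" "v \<in> P g" by blast
    then have "\<exists>ws\<in>B g. (u, v) \<in> cycle_edges ws"
      using uv(3) by (intro cycle_decomposition.edges_cover[OF B(1)])
    then show ?thesis using g(1) by blast
  next
    case False
    then show ?thesis using cover[OF uv] by blast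
  qed
  have "card (X \<union> (\<Union>g\<in>G. B g)) \<le> card X + (\<Sum>g\<in>G. card (B g))"
    by (intro order_trans[OF card_Un_le] add_left_mono card_UN_le G)
  then have "2 * k * card (X \<union> (\<Union>g\<in>G. B g)) \<le> 2 * k * (card X + (\<Sum>g\<in>G. card (B g)))"
    by (rule mult_left_mono) simp
  also have "\<dots> = 2 * k * card X + (\<Sum>g\<in>G. card (P g) * (card (P g) - 1))"
    using cycle_decomposition.cycle_decomposition_card[OF B(1)] by (simp add: distrib_left sum_distrib_left)
  finally show "2 * k * card (X \<union> (\<Union>g\<in>G. B g)) \<le> card V * (card V - 1)" using card by (rule order_trans)
qed

text \<open>Each group together with the point \<open>None\<close> has \<open>2k + 1\<close> points, so that only the edges between
  different groups remain to be covered.\<close>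

lemma cycle_decomposition_of_groups:
  fixes G :: "'g set" and F :: "'z set"
  assumes k: "3 \<le> k" and G: "finite G" and F: "finite F" "card F = 2 * k"
    and X: "X \<subseteq> cycles_on (Some ` (G \<times> F)) k" "card X \<le> 2 * k * (card G * (card G - 1))"
    and cross: "\<And>g h a b. \<lbrakk>g \<in> G; h \<in> G; g \<noteq> h; a \<in> F; b \<in> F\<rbrakk>
      \<Longrightarrow> \<exists>ws\<in>X. (Some (g, a), Some (h, b)) \<in> cycle_edges ws"
  shows "\<exists>C. cycle_decomposition k (insert None (Some ` (G \<times> F))) C"
proof -
  let ?V = "insert None (Some ` (G \<times> F))"
  define P where "P g = insert None (Some ` ({g} \<times> F))" for g :: 'g
  have P: "finite (P g)" "card (P g) = 2 * k + 1" for g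
    using F by (simp_all add: P_def card_image card_cartesian_product)
  have card_V: "card ?V = 2 * k * card G + 1"
    using G F by (simp add: card_image card_cartesian_product mult.commute)
  obtain B where B: "\<And>g. cycle_decomposition k (P g) (B g)"
    using cycle_decomposition_2k_plus_1[OF k P] by metis
  have "cycle_decomposition k ?V (X \<union> (\<Union>g\<in>G. B g))"
  proof (rule cycle_decomposition_Union[OF k _ G B])
    show "X \<subseteq> cycles_on ?V k" using X(1) cycles_on_mono[of "Some ` (G \<times> F)" ?V k] by blast
    show "\<exists>ws\<in>X. (u, v) \<in> cycle_edges ws"
      if uv: "u \<in> ?V" "v \<in> ?V" "u \<noteq> v" and apart: "\<And>g. g \<in> G \<Longrightarrow> \<not> {u, v} \<subseteq> P g" for u v
    proof -
      have "u \<noteq> None" "v \<noteq> None" using uv apart by (auto simp: P_def)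
      then obtain g a h b where gh: "u = Some (g, a)" "v = Some (h, b)" "g \<in> G" "a \<in> F" "h \<in> G" "b \<in> F"
        using uv by auto
      then have "g \<noteq> h" using apart[of g] by (auto simp: P_def)
      then show ?thesis using cross[of g h a b] gh by blast
    qed
    have "2 * k * card X + card G * ((2 * k + 1) * (2 * k))
        \<le> 2 * k * (2 * k * (card G * (card G - 1))) + card G * ((2 * k + 1) * (2 * k))"
      using X(2) by simp
    also have "\<dots> = card ?V * (card ?V - 1)" unfolding card_V by (cases "card G") (simp_all add: algebra_simps)
    finally show "2 * k * card X + (\<Sum>g\<in>G. card (P g) * (card (P g) - 1)) \<le> card ?V * (card ?V - 1)"
      by (simp add: P(2))
  qed (use G F in \<open>auto simp: P_def\<close>)
  then show ?thesis ..
qed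

lemma card_strictly_increasing_pairs:
  fixes G :: "'g :: linorder set"
  assumes "finite G"
  shows "2 * card {(g, h) \<in> G \<times> G. g < h} = card G * (card G - 1)"
proof -
  let ?L = "{(g, h) \<in> G \<times> G. g < h}"
  have "finite ?L" by (rule finite_subset[of _ "G \<times> G"]) (use assms in auto)
  moreover have "G \<times> G - Id = ?L \<union> ?L\<inverse>" by auto
  moreover have "?L \<inter> ?L\<inverse> = {}" by auto
  ultimately show ?thesis
    using card_off_diagonal[OF assms] by (simp add: card_Un_disjoint)
qed

definition zig_cycle :: "nat \<Rightarrow> 'g \<Rightarrow> 'g \<Rightarrow> bool \<Rightarrow> int \<Rightarrow> ('g \<times> int) option list" where
  "zig_cycle k g h flip t = map (\<lambda>j. Some (if even j then g else h,
     ((if flip then of_bool (odd j) - zig k j else zig k j) + t) mod (2 * int k))) [0..<k]"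

lemma zig_cycle_in_cycles_on:
  assumes k: "2 \<le> k" and "g \<noteq> h" "g \<in> G" "h \<in> G"
  shows "zig_cycle k g h flip t \<in> cycles_on (Some ` (G \<times> {0..<2 * int k})) k"
proof -
  let ?v = "\<lambda>j. ((if flip then of_bool (odd j) - zig k j else zig k j) + t) mod (2 * int k)"
  have "inj_on (\<lambda>j. Some (if even j then g else h, ?v j)) {..<k}"
  proof (rule inj_onI)
    fix i j assume ij: "i \<in> {..<k}" "j \<in> {..<k}"
      and "Some (if even i then g else h, ?v i) = Some (if even j then g else h, ?v j)"
    then have "even i = even j" "?v i = ?v j" using \<open>g \<noteq> h\<close> by (auto split: if_splits)
    then have "2 * int k dvd zig k i - zig k j"
      by (cases flip) (simp_all add: mod_eq_dvd_iff dvd_diff_commute)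
    moreover have "\<bar>zig k i - zig k j\<bar> < 2 * int k"
      using zig_range[OF k, of i] zig_range[OF k, of j] ij k by auto
    ultimately have "zig k i = zig k j" using zdvd_not_zless[of "\<bar>zig k i - zig k j\<bar>" "2 * int k"] by auto
    with inj_on_zig show "i = j" using ij by (rule inj_onD)
  qed
  then show ?thesis using assms by (auto simp: cycles_on_def zig_cycle_def distinct_map atLeast0LessThan)
qed

lemma zig_cycle_edge:
  assumes k: "3 \<le> k" "even k" and ab: "a \<in> {0..<2 * int k}" "b \<in> {0..<2 * int k}"
  shows "\<exists>flip. \<exists>t\<in>{0..<2 * int k}. (Some (g, a), Some (h, b)) \<in> cycle_edges (zig_cycle k g h flip t)"
proof -
  let ?n = "2 * int k"
  define c where "c = (b - a - 1) mod ?n + 1"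
  have "0 < ?n" using k by simp
  then have c: "1 \<le> c" "c \<le> ?n" by (simp_all add: c_def zless_imp_add1_zle)
  have dvd: "?n dvd a + c - b" using dvd_minus_mod[of ?n "b - a - 1"]
    by (simp add: c_def algebra_simps dvd_diff_commute)
  obtain d where d: "1 \<le> d" "d \<le> k" "zig_diff k d = c \<or> zig_diff k d = ?n + 1 - c"
    using zig_diff_cover[OF c] by blast
  obtain p q where pq: "(p, q) \<in> cycle_edges [0..<k]" "zig k q - zig k p = zig_diff k d" "even p" "odd q"
    using zig_edge[OF k(1) d(1,2)] k(2) by blast
  define flip where "flip = (zig_diff k d \<noteq> c)"
  define t where "t = (if flip then a + zig k p else a - zig k p) mod ?n"
  have "((if flip then of_bool (odd p) - zig k p else zig k p) + t) mod ?n = a"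
    using ab pq(3) by (simp add: t_def mod_simps)
  moreover have "((if flip then of_bool (odd q) - zig k q else zig k q) + t) mod ?n = b mod ?n"
  proof (cases flip)
    case True
    then have "1 - zig k q + (a + zig k p) - b = (a + c - b) - ?n" using d(3) pq(2) by (auto simp: flip_def)
    then have "?n dvd 1 - zig k q + (a + zig k p) - b" using dvd by (metis dvd_diff dvd_refl)
    then show ?thesis using True pq(4) by (simp add: t_def mod_simps mod_eq_dvd_iff)
  next
    case False
    then have "zig k q + (a - zig k p) - b = a + c - b" using pq(2) by (auto simp: flip_def)
    with dvd have "?n dvd zig k q + (a - zig k p) - b" by (simp only:)
    then show ?thesis using False by (simp add: t_def mod_simps mod_eq_dvd_iff)
  qed
  ultimately have "(Some (g, a), Some (h, b)) \<in> cycle_edges (zig_cycle k g h flip t)"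
    unfolding zig_cycle_def cycle_edges_map using pq ab by (intro rev_image_eqI[OF pq(1)]) simp
  moreover have "t \<in> {0..<?n}" using k by (simp add: t_def)
  ultimately show ?thesis by blast
qed

lemma cycle_decomposition_even:
  fixes G :: "'g :: linorder set"
  assumes k: "3 \<le> k" "even k" and G: "finite G"
  shows "\<exists>C. cycle_decomposition k (insert None (Some ` (G \<times> {0..<2 * int k}))) C"
proof (rule cycle_decomposition_of_groups[OF k(1) G])
  let ?F = "{0..<2 * int k}" and ?L = "{(g, h) \<in> G \<times> G. g < h}"
  define X where "X = (\<lambda>((g, h), flip, t). zig_cycle k g h flip t) ` (?L \<times> (UNIV :: bool set) \<times> ?F)"
  have finL: "finite ?L" by (rule finite_subset[of _ "G \<times> G"]) (use G in auto)
  show "X \<subseteq> cycles_on (Some ` (G \<times> ?F)) k"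
    using k zig_cycle_in_cycles_on[of k _ _ G] by (auto simp: X_def)
  have "card X \<le> card (?L \<times> (UNIV :: bool set) \<times> ?F)"
    unfolding X_def using finL by (intro card_image_le) auto
  then show "card X \<le> 2 * k * (card G * (card G - 1))"
    unfolding card_strictly_increasing_pairs[OF G, symmetric]
    by (simp add: card_cartesian_product nat_mult_distrib mult_ac)
  show "\<exists>ws\<in>X. (Some (g, a), Some (h, b)) \<in> cycle_edges ws"
    if "g \<in> G" "h \<in> G" "g \<noteq> h" "a \<in> ?F" "b \<in> ?F" for g h a b
  proof -
    have increasing: "\<exists>ws\<in>X. (Some (g, a), Some (h, b)) \<in> cycle_edges ws"
      if "g \<in> G" "h \<in> G" "g < h" "a \<in> ?F" "b \<in> ?F" for g h a b
      using zig_cycle_edge[OF k that(4,5), of g h] that by (force simp: X_def)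
    show ?thesis
    proof (cases "g < h")
      case True
      then show ?thesis using that by (intro increasing)
    next
      case False
      then have "\<exists>ws\<in>X. (Some (h, b), Some (g, a)) \<in> cycle_edges ws" using that by (intro increasing) auto
      then show ?thesis by (metis cycle_edges_sym)
    qed
  qed
qed auto

section \<open>Commutative quasigroups with holes\<close>

definition half_mod :: "int \<Rightarrow> int \<Rightarrow> int" where
  "half_mod m z = (z * ((m + 1) div 2)) mod m"

lemma half_mod_bounds: "0 < m \<Longrightarrow> 0 \<le> half_mod m z" "0 < m \<Longrightarrow> half_mod m z < m"
  by (simp_all add: half_mod_def)

lemma dvd_double_iff: "odd m \<Longrightarrow> m dvd 2 * x \<longleftrightarrow> m dvd x" for m x :: int
  by (simp add: coprime_dvd_mult_right_iff)

lemma half_mod_eq_iff: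
  assumes "odd m" "0 < m"
  shows "half_mod m z = y \<longleftrightarrow> 0 \<le> y \<and> y < m \<and> m dvd z - 2 * y"
proof -
  have "2 * ((m + 1) div 2) = m + 1" using assms by presburger
  then have double: "2 * (z * ((m + 1) div 2)) = z + m * z" by (simp add: algebra_simps)
  have "m dvd z * ((m + 1) div 2) - half_mod m z" by (simp add: half_mod_def mod_eq_dvd_iff[symmetric])
  then obtain c where "z * ((m + 1) div 2) - half_mod m z = m * c" by (elim dvdE)
  then have "2 * (half_mod m z - y) = (z - 2 * y) + (z - 2 * c) * m"
    using double by (simp add: algebra_simps)
  then have "m dvd 2 * (half_mod m z - y) \<longleftrightarrow> m dvd z - 2 * y" by (simp only: dvd_add_times_triv_right_iff)
  then have dvd: "m dvd half_mod m z - y \<longleftrightarrow> m dvd z - 2 * y"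
    by (simp only: dvd_double_iff[OF assms(1)])
  show ?thesis
  proof
    assume "half_mod m z = y"
    then show "0 \<le> y \<and> y < m \<and> m dvd z - 2 * y" using dvd half_mod_bounds[OF assms(2), of z] by auto
  next
    assume y: "0 \<le> y \<and> y < m \<and> m dvd z - 2 * y"
    then have "half_mod m z mod m = y mod m" using dvd by (simp only: mod_eq_dvd_iff)
    then show "half_mod m z = y" using y half_mod_bounds[OF assms(2), of z] by simp
  qed
qed

text \<open>The first component of an element is its hole; only elements of distinct holes are multiplied.\<close>

definition holey_quasigroup :: "int \<Rightarrow> (int \<times> bool \<Rightarrow> int \<times> bool \<Rightarrow> int \<times> bool) \<Rightarrow> bool" where
  "holey_quasigroup p f \<longleftrightarrow> (\<forall>X \<in> {0..<p} \<times> UNIV. \<forall>Y \<in> {0..<p} \<times> UNIV. fst X \<noteq> fst Y \<longrightarrow>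
     f X Y = f Y X \<and> f X Y \<in> {0..<p} \<times> UNIV \<and> f X Y \<noteq> X \<and> f X Y \<noteq> Y \<and>
     (\<exists>W \<in> {0..<p} \<times> UNIV. fst W \<noteq> fst X \<and> f X W = Y))"

lemma holey_quasigroup_solve:
  assumes "X \<in> {0..<p} \<times> UNIV" "Y \<in> {0..<p} \<times> UNIV" "holey_quasigroup p f" "fst X \<noteq> fst Y"
  obtains W where "W \<in> {0..<p} \<times> UNIV" "fst W \<noteq> fst X" "f X W = Y" "f W X = Y"
proof -
  note f = assms(3)[unfolded holey_quasigroup_def, rule_format]
  obtain W where W: "W \<in> {0..<p} \<times> UNIV" "fst W \<noteq> fst X" "f X W = Y"
    using f[OF assms(1,2,4)] by blast
  moreover have "f X W = f W X" using f[OF assms(1) W(1)] W(2) by simp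
  ultimately show thesis using that by simp
qed

lemma half_mod_reflect:
  assumes "odd m" "0 < m" "0 \<le> y" "y < m"
  shows "half_mod m (x + (2 * y - x) mod m) = y"
proof -
  have "m dvd (2 * y - x) mod m - (2 * y - x)" by (simp add: mod_eq_dvd_iff[symmetric])
  then show ?thesis using assms by (simp add: half_mod_eq_iff algebra_simps)
qed

lemma reflect_neq:
  fixes m :: int
  assumes "odd m" "0 \<le> x" "x < m" "0 \<le> y" "y < m" "x \<noteq> y"
  shows "(2 * y - x) mod m \<noteq> x"
proof
  assume "(2 * y - x) mod m = x"
  then have "(2 * y - x) mod m = x mod m" using assms by simp
  then have "m dvd 2 * (y - x)" by (simp add: mod_eq_dvd_iff right_diff_distrib)
  then have "m dvd y - x" by (simp only: dvd_double_iff[OF assms(1)])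
  then have "y mod m = x mod m" by (simp add: mod_eq_dvd_iff)
  then show False using assms by simp
qed

lemma half_mod_add_neq:
  assumes "odd m" "0 < m" "0 \<le> x" "x < m" "0 \<le> y" "y < m" "x \<noteq> y"
  shows "half_mod m (x + y) \<noteq> x" "half_mod m (x + y) \<noteq> y"
proof -
  have "x mod m \<noteq> y mod m" using assms by simp
  then have "\<not> m dvd x - y" "\<not> m dvd y - x" by (simp_all add: mod_eq_dvd_iff[symmetric])
  then show "half_mod m (x + y) \<noteq> x" "half_mod m (x + y) \<noteq> y"
    using assms(1,2) by (simp_all add: half_mod_eq_iff)
qed

lemma holey_quasigroup_odd:
  assumes m: "odd m" "0 < m"
  shows "holey_quasigroup m (\<lambda>(x, a) (y, b). (half_mod m (x + y), a \<noteq> b))"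
proof -
  have "\<exists>w\<in>{0..<m}. \<exists>c. w \<noteq> x \<and> half_mod m (x + w) = y \<and> (a \<noteq> c) = b"
    if "x \<in> {0..<m}" "y \<in> {0..<m}" "x \<noteq> y" for x y and a b :: bool
    using that m half_mod_reflect[OF m, of y x] reflect_neq[OF m(1), of x y]
    by (intro bexI[of _ "(2 * y - x) mod m"] exI[of _ "a \<noteq> b"]) auto
  then show ?thesis
    using half_mod_bounds[OF m(2)] half_mod_add_neq[OF m]
    by (auto simp: holey_quasigroup_def add.commute)
qed

text \<open>The prolongation of the previous quasigroup by a new hole \<open>m\<close>: the products of \<open>(x, a)\<close> and
  \<open>(x \<plusminus> 2, b)\<close> with \<open>a \<noteq> b\<close> move to the new hole.\<close>

definition infinity_op :: "int \<Rightarrow> bool \<Rightarrow> int \<times> bool \<Rightarrow> int \<times> bool" where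
  "infinity_op m c = (\<lambda>(y, b). ((y + (if c = b then - 1 else 1)) mod m, b))"

definition finite_op :: "int \<Rightarrow> int \<times> bool \<Rightarrow> int \<times> bool \<Rightarrow> int \<times> bool" where
  "finite_op m = (\<lambda>(x, a) (y, b). let t = half_mod m (y - x) in
     if t = 1 \<or> t = m - 1
     then if a = b then (half_mod m (x + y), \<not> a) else (m, (t = 1) \<noteq> a)
     else (half_mod m (x + y), a \<noteq> b))"

definition prolonged_op :: "int \<Rightarrow> int \<times> bool \<Rightarrow> int \<times> bool \<Rightarrow> int \<times> bool" where
  "prolonged_op m X Y = (if fst X = m then infinity_op m (snd X) Y
     else if fst Y = m then infinity_op m (snd Y) X else finite_op m X Y)"

lemma add_mod_neq: "\<not> m dvd c \<Longrightarrow> (y + c) mod m \<noteq> y" for m c y :: int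
  by (metis add_diff_cancel_left' mod_eq_dvd_iff mod_mod_trivial)

lemma half_mod_minus:
  assumes "odd m" "0 < m" "\<not> m dvd z"
  shows "half_mod m (- z) = m - half_mod m z"
proof -
  have z: "0 \<le> half_mod m z" "half_mod m z < m" "m dvd z - 2 * half_mod m z"
    using half_mod_eq_iff[OF assms(1,2), of z "half_mod m z"] by simp_all
  moreover have "0 < half_mod m z" using z(1,3) assms(3) by (cases "half_mod m z = 0") auto
  moreover have "- z - 2 * (m - half_mod m z) = - (z - 2 * half_mod m z) - 2 * m" by simp
  then have "m dvd - z - 2 * (m - half_mod m z)"
    using z(3) by (simp only: dvd_diff dvd_minus_iff dvd_triv_right)
  ultimately show ?thesis by (simp add: half_mod_eq_iff[OF assms(1,2)])
qed

lemma half_mod_double: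
  assumes "odd m" "0 < m" "0 \<le> t" "t < m"
  shows "half_mod m ((x + 2 * t) mod m - x) = t"
proof -
  have "m dvd (x + 2 * t) mod m - (x + 2 * t)" by (simp add: mod_eq_dvd_iff[symmetric])
  then show ?thesis using assms by (simp add: half_mod_eq_iff algebra_simps)
qed

lemma finite_op_commute:
  assumes m: "odd m" "3 \<le> m" and "\<not> m dvd fst Y - fst X"
  shows "finite_op m X Y = finite_op m Y X"
proof -
  have "half_mod m (fst X - fst Y) = m - half_mod m (fst Y - fst X)"
    using half_mod_minus[OF m(1) _ assms(3)] m(2) by simp
  then show ?thesis using m(2) by (auto simp: finite_op_def Let_def split_def add.commute)
qed

lemma infinity_op_solve:
  assumes m: "3 \<le> m" and "y \<in> {0..<m}"
  shows "\<exists>w\<in>{0..<m}. infinity_op m c (w, b) = (y, b)"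
proof -
  let ?s = "if c = b then - 1 else 1 :: int"
  have "infinity_op m c ((y - ?s) mod m, b) = (y, b)"
    using assms by (simp add: infinity_op_def mod_simps)
  then show ?thesis using m by (intro bexI[of _ "(y - ?s) mod m"]) auto
qed

lemma finite_op_solve_infinity:
  assumes m: "odd m" "3 \<le> m"
  shows "\<exists>w\<in>{0..<m}. \<exists>c. w \<noteq> x \<and> finite_op m (x, a) (w, c) = (m, b)"
proof -
  define t where "t = (if b \<noteq> a then 1 else m - 1)"
  have "\<not> m dvd 1" "\<not> m dvd 2" using m zdvd_imp_le[of m 1] zdvd_imp_le[of m 2] by auto
  then have "\<not> m dvd 2 * t"
    using dvd_diff_commute[of m m 1] by (auto simp: t_def dvd_double_iff[OF m(1)] dvd_diff_right_iff)
  then have "(x + 2 * t) mod m \<noteq> x" by (rule add_mod_neq)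
  moreover have "half_mod m ((x + 2 * t) mod m - x) = t"
    using m by (intro half_mod_double) (auto simp: t_def)
  ultimately show ?thesis using m
    by (intro bexI[of _ "(x + 2 * t) mod m"] exI[of _ "\<not> a"]) (auto simp: finite_op_def t_def)
qed

lemma prolonged_op_solve_finite:
  assumes m: "odd m" "3 \<le> m" and xy: "x \<in> {0..<m}" "y \<in> {0..<m}" "x \<noteq> y"
  shows "\<exists>w\<in>{0..m}. \<exists>c. w \<noteq> x \<and> prolonged_op m (x, a) (w, c) = (y, b)"
proof -
  have "0 < m" using m by simp
  define t where "t = (y - x) mod m"
  define w where "w = (2 * y - x) mod m"
  have w: "0 \<le> w" "w < m" "w \<noteq> x" "half_mod m (x + w) = y"
    using half_mod_reflect[OF m(1) \<open>0 < m\<close>, of y x] reflect_neq[OF m(1), of x y] xy m by (auto simp: w_def)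
  have "(x + 2 * t) mod m = (x + 2 * (y - x)) mod m"
    unfolding t_def by (metis mod_add_right_eq mod_mult_right_eq)
  then have "w = (x + 2 * t) mod m" by (simp add: w_def)
  then have t: "half_mod m (w - x) = t"
    using half_mod_double[OF m(1) \<open>0 < m\<close>, of t x] \<open>0 < m\<close> by (simp add: t_def)
  show ?thesis
  proof (cases "(t = 1 \<or> t = m - 1) \<and> a = b")
    case True
    have "y = (x + t) mod m" using xy by (simp add: t_def mod_simps)
    moreover have "x + (m - 1) = (x - 1) + m" by simp
    then have "(x + (m - 1)) mod m = (x - 1) mod m" by (simp only: mod_add_self2)
    ultimately have "y = (x + (if t = 1 then 1 else - 1)) mod m" using True by auto
    then have "prolonged_op m (x, a) (m, (t = 1) \<noteq> a) = (y, b)"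
      using True xy by (auto simp: prolonged_op_def infinity_op_def)
    then show ?thesis using xy \<open>0 < m\<close> by (intro bexI[of _ m]) auto
  next
    case False
    have "prolonged_op m (x, a) (w, if t = 1 \<or> t = m - 1 then a else a \<noteq> b) = (y, b)"
      using False w t xy by (auto simp: prolonged_op_def finite_op_def Let_def)
    then show ?thesis using w by (intro bexI[of _ w]) auto
  qed
qed

lemma prolonged_op_solve:
  assumes m: "odd m" "3 \<le> m" and "fst X \<in> {0..m}" "fst Y \<in> {0..m}" "fst X \<noteq> fst Y"
  shows "\<exists>W\<in>{0..m} \<times> UNIV. fst W \<noteq> fst X \<and> prolonged_op m X W = Y"
proof -
  obtain x a y b where XY: "X = (x, a)" "Y = (y, b)" by (cases X; cases Y)
  have xy: "0 \<le> x" "x \<le> m" "0 \<le> y" "y \<le> m" "x \<noteq> y" using assms(3-5) by (simp_all add: XY)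
  then consider "x = m" "y < m" | "x < m" "y = m" | "x < m" "y < m" by linarith
  then have "\<exists>w\<in>{0..m}. \<exists>c. w \<noteq> x \<and> prolonged_op m (x, a) (w, c) = (y, b)"
  proof cases
    case 1
    then obtain w where "w \<in> {0..<m}" "infinity_op m a (w, b) = (y, b)"
      using infinity_op_solve[OF m(2), of y a b] xy by auto
    then show ?thesis using 1 by (intro bexI[of _ w] exI[of _ b]) (auto simp: prolonged_op_def)
  next
    case 2
    obtain w c where "w \<in> {0..<m}" "w \<noteq> x" "finite_op m (x, a) (w, c) = (m, b)"
      using finite_op_solve_infinity[OF m, of x a b] by blast
    then show ?thesis using 2 by (intro bexI[of _ w] exI[of _ c]) (auto simp: prolonged_op_def)
  next
    case 3
    then show ?thesis using prolonged_op_solve_finite[OF m, of x y a b] xy by simp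
  qed
  then obtain w c where "w \<in> {0..m}" "w \<noteq> x" "prolonged_op m (x, a) (w, c) = (y, b)" by blast
  then show ?thesis by (intro bexI[of _ "(w, c)"]) (auto simp: XY)
qed

lemma prolonged_op_avoids:
  assumes m: "odd m" "3 \<le> m" and "fst X \<in> {0..m}" "fst Y \<in> {0..m}" "fst X \<noteq> fst Y"
  shows "fst (prolonged_op m X Y) \<in> {0..m}" "fst (prolonged_op m X Y) \<noteq> fst X"
    "fst (prolonged_op m X Y) \<noteq> fst Y"
proof -
  have "0 < m" using m by simp
  note bounds = pos_mod_bound[OF this] pos_mod_sign[OF this] half_mod_bounds[OF this]
  have "\<not> m dvd 1" using m zdvd_imp_le[of m 1] by auto
  then have neq: "(z + 1) mod m \<noteq> z" "(z - 1) mod m \<noteq> z" for z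
    using add_mod_neq[of m 1 z] add_mod_neq[of m "- 1" z] by auto
  show "fst (prolonged_op m X Y) \<in> {0..m}"
    unfolding prolonged_op_def infinity_op_def finite_op_def Let_def split_def
    using bounds(1,4)[THEN less_imp_le] bounds(2,3) m by simp
  have "half_mod m (fst X + fst Y) \<noteq> fst X \<and> half_mod m (fst X + fst Y) \<noteq> fst Y" if "fst X \<noteq> m" "fst Y \<noteq> m"
    using half_mod_add_neq[OF m(1) \<open>0 < m\<close>, of "fst X" "fst Y"] assms(3-5) that by auto
  moreover have "z mod m \<noteq> m" for z using bounds(1)[of z] by auto
  ultimately show "fst (prolonged_op m X Y) \<noteq> fst X" "fst (prolonged_op m X Y) \<noteq> fst Y"
    using neq assms(5) by (auto simp: prolonged_op_def infinity_op_def finite_op_def Let_def split_def)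
qed

lemma holey_quasigroup_even:
  assumes m: "odd m" "3 \<le> m"
  shows "holey_quasigroup (m + 1) (prolonged_op m)"
  unfolding holey_quasigroup_def
proof (intro ballI impI conjI)
  fix X Y :: "int \<times> bool"
  assume "X \<in> {0..<m + 1} \<times> UNIV" "Y \<in> {0..<m + 1} \<times> UNIV" and neq: "fst X \<noteq> fst Y"
  then have XY: "fst X \<in> {0..m}" "fst Y \<in> {0..m}" by auto
  have "finite_op m X Y = finite_op m Y X" if "fst X \<noteq> m" "fst Y \<noteq> m"
  proof (rule finite_op_commute[OF m])
    have "fst Y mod m \<noteq> fst X mod m" using XY neq that by simp
    then show "\<not> m dvd fst Y - fst X" by (simp only: mod_eq_dvd_iff not_False_eq_True)
  qed
  then show "prolonged_op m X Y = prolonged_op m Y X" using neq by (auto simp: prolonged_op_def)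
  show "prolonged_op m X Y \<in> {0..<m + 1} \<times> UNIV"
    using prolonged_op_avoids(1)[OF m XY neq] by (cases "prolonged_op m X Y") auto
  show "prolonged_op m X Y \<noteq> X" "prolonged_op m X Y \<noteq> Y" using prolonged_op_avoids(2,3)[OF m XY neq] by auto
  show "\<exists>W\<in>{0..<m + 1} \<times> UNIV. fst W \<noteq> fst X \<and> prolonged_op m X W = Y"
    using prolonged_op_solve[OF m XY neq] by (simp add: atLeastLessThanPlusOne_atLeastAtMost_int)
qed

lemma holey_quasigroup_exists:
  assumes "3 \<le> p"
  shows "\<exists>f. holey_quasigroup p f"
proof (cases "odd p")
  case True
  then show ?thesis using assms holey_quasigroup_odd[of p] by auto
next
  case False
  then have "odd (p - 1)" "3 \<le> p - 1" using assms by presburger+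
  then show ?thesis using holey_quasigroup_even[of "p - 1"] by auto
qed

section \<open>Decompositions into odd cycles\<close>

definition level_vertex :: "nat \<Rightarrow> 'g \<times> bool \<Rightarrow> int \<Rightarrow> ('g \<times> bool \<times> int) option" where
  "level_vertex r X i = Some (fst X, snd X, i mod (2 * int r + 3))"

text \<open>A zigzag between the levels \<open>X\<close> and \<open>Y\<close> with the offsets \<open>-r, \<dots>, r\<close>, closed up through a vertex
  on level \<open>Z\<close>; the two remaining offsets \<open>\<plusminus>(r + 1)\<close> occur at the edges to level \<open>Z\<close>.\<close>

definition level_cycle_vertex ::
    "nat \<Rightarrow> 'g \<times> bool \<Rightarrow> 'g \<times> bool \<Rightarrow> 'g \<times> bool \<Rightarrow> int \<Rightarrow> nat \<Rightarrow> ('g \<times> bool \<times> int) option" where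
  "level_cycle_vertex r X Y Z i e = (
     if e = 2 * r + 2 then level_vertex r Z (i + int r + 1)
     else if even e then level_vertex r X (i - int (e div 2))
     else level_vertex r Y (i - int r + int (e div 2)))"

definition level_cycle ::
    "nat \<Rightarrow> 'g \<times> bool \<Rightarrow> 'g \<times> bool \<Rightarrow> 'g \<times> bool \<Rightarrow> int \<Rightarrow> ('g \<times> bool \<times> int) option list" where
  "level_cycle r X Y Z i = map (level_cycle_vertex r X Y Z i) [0..<2 * r + 3]"

definition level_cycles ::
    "nat \<Rightarrow> int \<Rightarrow> (int \<times> bool \<Rightarrow> int \<times> bool \<Rightarrow> int \<times> bool) \<Rightarrow> (int \<times> bool \<times> int) option list set" where
  "level_cycles r p f = {level_cycle r X Y (f X Y) i |X Y i.
     fst X \<in> {0..<p} \<and> fst Y \<in> {0..<p} \<and> fst X < fst Y}"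

lemma level_vertex_eq_iff: "level_vertex r X i = level_vertex r Y j \<longleftrightarrow> X = Y \<and> 2 * int r + 3 dvd i - j"
  by (auto simp: level_vertex_def prod_eq_iff mod_eq_dvd_iff)

lemma level_cycle_vertex_simps:
  shows "j \<le> r \<Longrightarrow> level_cycle_vertex r X Y Z i (2 * j) = level_vertex r X (i - int j)"
    and "j \<le> r \<Longrightarrow> level_cycle_vertex r X Y Z i (2 * j + 1) = level_vertex r Y (i - int r + int j)"
    and "level_cycle_vertex r X Y Z i (2 * r + 2) = level_vertex r Z (i + int r + 1)"
proof -
  have "2 * j + 1 \<noteq> 2 * r + 2" by presburger
  then show "j \<le> r \<Longrightarrow> level_cycle_vertex r X Y Z i (2 * j + 1) = level_vertex r Y (i - int r + int j)"
    by (simp add: level_cycle_vertex_def)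
qed (auto simp: level_cycle_vertex_def)

lemma inj_on_level_cycle_vertex:
  assumes "X \<noteq> Y" "Z \<noteq> X" "Z \<noteq> Y"
  shows "inj_on (level_cycle_vertex r X Y Z i) {..<2 * r + 3}"
proof (rule inj_onI)
  fix e e' assume e: "e \<in> {..<2 * r + 3}" "e' \<in> {..<2 * r + 3}"
    and eq: "level_cycle_vertex r X Y Z i e = level_cycle_vertex r X Y Z i e'"
  have apex: "e = 2 * r + 2 \<longleftrightarrow> e' = 2 * r + 2"
    using eq assms by (auto simp: level_cycle_vertex_def level_vertex_eq_iff split: if_splits)
  show "e = e'"
  proof (cases "e = 2 * r + 2")
    case False
    then have parity: "even e = even e'" and "2 * int r + 3 dvd int (e div 2) - int (e' div 2)"
      using eq apex assms
      by (auto simp: level_cycle_vertex_def level_vertex_eq_iff dvd_diff_commute split: if_splits)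
    moreover have "\<bar>int (e div 2) - int (e' div 2)\<bar> < 2 * int r + 3" using e by auto
    ultimately have "e div 2 = e' div 2"
      using zdvd_not_zless[of "\<bar>int (e div 2) - int (e' div 2)\<bar>" "2 * int r + 3"] by auto
    then show ?thesis using parity by (metis even_two_times_div_two odd_two_times_div_two_succ)
  qed (use apex in simp)
qed

lemma level_cycle_in_cycles_on:
  assumes "X \<noteq> Y" "Z \<noteq> X" "Z \<noteq> Y" and G: "fst X \<in> G" "fst Y \<in> G" "fst Z \<in> G"
  shows "level_cycle r X Y Z i \<in> cycles_on (Some ` (G \<times> UNIV \<times> {0..<2 * int r + 3})) (2 * r + 3)"
  using inj_on_level_cycle_vertex[OF assms(1-3), of r i] G
  by (auto simp: cycles_on_def level_cycle_def distinct_map atLeast0LessThan level_cycle_vertex_def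
      level_vertex_def)

lemma level_cycle_edgeI:
  "(e, e') \<in> cycle_edges [0..<2 * r + 3] \<Longrightarrow> level_cycle_vertex r X Y Z i e = u
    \<Longrightarrow> level_cycle_vertex r X Y Z i e' = v \<Longrightarrow> (u, v) \<in> cycle_edges (level_cycle r X Y Z i)"
  unfolding level_cycle_def cycle_edges_map by (metis map_prod_simp rev_image_eqI)

lemma level_cycle_offset_edge:
  assumes d: "\<bar>d\<bar> \<le> int r"
  shows "\<exists>i. (level_vertex r X u, level_vertex r Y (u + d)) \<in> cycle_edges (level_cycle r X Y Z i)"
proof -
  define e where "e = nat (d + int r)"
  have e: "int e = d + int r" "e \<le> 2 * r" "Suc e < 2 * r + 3" using d by (auto simp: e_def)
  note edges = cycle_edges_upt(1,2)[OF e(3)]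
  show ?thesis
  proof (cases "even e")
    case True
    then obtain j where j: "e = 2 * j" by (elim evenE)
    then have d_eq: "d = 2 * int j - int r" "j \<le> r" using e by auto
    show ?thesis
      using level_cycle_vertex_simps(1,2)[OF d_eq(2), of X Y Z "u + int j"] j
      by (intro exI[of _ "u + int j"] level_cycle_edgeI[OF edges(1)]) (simp_all add: d_eq algebra_simps)
  next
    case False
    then obtain j where j: "e = 2 * j + 1" by (elim oddE)
    then have d_eq: "d = 2 * int j + 1 - int r" "j \<le> r" "j + 1 \<le> r" "Suc e = 2 * (j + 1)" using e by auto
    show ?thesis
      using level_cycle_vertex_simps(1)[OF d_eq(3), of X Y Z "u + int j + 1"]
        level_cycle_vertex_simps(2)[OF d_eq(2), of X Y Z "u + int j + 1"] j
      by (intro exI[of _ "u + int j + 1"] level_cycle_edgeI[OF edges(2)]) (simp_all add: d_eq algebra_simps)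
  qed
qed

lemma level_cycle_apex_edges:
  shows "(level_vertex r X i, level_vertex r Z (i + int r + 1)) \<in> cycle_edges (level_cycle r X Y Z i)"
    and "(level_vertex r Y i, level_vertex r Z (i + int r + 1)) \<in> cycle_edges (level_cycle r X Y Z i)"
proof -
  have edges: "(2 * 0, 2 * r + 2) \<in> cycle_edges [0..<2 * r + 3]"
      "(2 * r + 1, 2 * r + 2) \<in> cycle_edges [0..<2 * r + 3]"
    using cycle_edges_upt(3)[of 0 "2 * r + 3"] cycle_edges_upt(1)[of "2 * r + 1" "2 * r + 3"] by simp_all
  show "(level_vertex r X i, level_vertex r Z (i + int r + 1)) \<in> cycle_edges (level_cycle r X Y Z i)"
    by (rule level_cycle_edgeI[OF edges(1)])
      (simp_all only: level_cycle_vertex_simps le0 of_nat_0 diff_0_right)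
  show "(level_vertex r Y i, level_vertex r Z (i + int r + 1)) \<in> cycle_edges (level_cycle r X Y Z i)"
    by (rule level_cycle_edgeI[OF edges(2)])
      (simp_all only: level_cycle_vertex_simps le_refl diff_add_cancel)
qed

lemma card_level_cycles_le:
  "card (level_cycles r (int p) f) \<le> 2 * (2 * r + 3) * (p * (p - 1))"
proof -
  let ?k = "2 * int r + 3" and ?G = "{0..<int p}"
  let ?L = "{(x, y) \<in> ?G \<times> ?G. x < y}"
  let ?I = "?L \<times> (UNIV :: (bool \<times> bool) set) \<times> {0..<?k}"
  define cyc where "cyc = (\<lambda>((x, y), (a, b), i). level_cycle r (x, a) (y, b) (f (x, a) (y, b)) i)"
  have mod: "level_cycle r X Y Z i = level_cycle r X Y Z (i mod ?k)" for X Y Z :: "int \<times> bool" and i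
    using dvd_minus_mod[of ?k i]
    by (auto simp: level_cycle_def level_cycle_vertex_def level_vertex_eq_iff)
  have "level_cycles r (int p) f \<subseteq> cyc ` ?I"
  proof
    fix ws assume "ws \<in> level_cycles r (int p) f"
    then obtain x a y b i where "ws = level_cycle r (x, a) (y, b) (f (x, a) (y, b)) i" "(x, y) \<in> ?L"
      by (auto simp: level_cycles_def)
    then show "ws \<in> cyc ` ?I"
      by (intro image_eqI[of _ _ "((x, y), (a, b), i mod ?k)"]) (auto simp: cyc_def mod[of _ _ _ i])
  qed
  moreover have "finite ?L" by (rule finite_subset[of _ "?G \<times> ?G"]) auto
  ultimately have "card (level_cycles r (int p) f) \<le> card ?I"
    by (intro surj_card_le[of _ _ cyc]) auto
  also have "\<dots> = 2 * (2 * r + 3) * (2 * card ?L)"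
    by (simp add: card_cartesian_product nat_add_distrib nat_mult_distrib)
  also have "2 * card ?L = p * (p - 1)" using card_strictly_increasing_pairs[of ?G] by simp
  finally show ?thesis .
qed

lemma level_cyclesI:
  "fst X \<in> {0..<p} \<Longrightarrow> fst Y \<in> {0..<p} \<Longrightarrow> fst X < fst Y \<Longrightarrow> level_cycle r X Y (f X Y) i \<in> level_cycles r p f"
  unfolding level_cycles_def by blast

lemma level_cycles_cover_offset:
  assumes "fst X \<in> {0..<p}" "fst Y \<in> {0..<p}" "fst X \<noteq> fst Y" "\<bar>d\<bar> \<le> int r"
  shows "\<exists>ws\<in>level_cycles r p f. (level_vertex r X u, level_vertex r Y (u + d)) \<in> cycle_edges ws"
proof (cases "fst X < fst Y")
  case True
  obtain i where "(level_vertex r X u, level_vertex r Y (u + d)) \<in> cycle_edges (level_cycle r X Y (f X Y) i)"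
    using level_cycle_offset_edge[OF assms(4)] by blast
  then show ?thesis using level_cyclesI[OF assms(1,2) True, of r f i] by (rule bexI)
next
  case False
  obtain i where "(level_vertex r Y (u + d), level_vertex r X (u + d + - d))
      \<in> cycle_edges (level_cycle r Y X (f Y X) i)"
    using level_cycle_offset_edge[of "- d" r Y "u + d" X "f Y X"] assms(4) by auto
  then have "(level_vertex r X u, level_vertex r Y (u + d)) \<in> cycle_edges (level_cycle r Y X (f Y X) i)"
    using cycle_edges_sym by simp
  then show ?thesis using level_cyclesI[OF assms(2,1), of r f i] False assms(3) by (intro bexI) simp_all
qed

lemma level_cycles_cover_apex:
  assumes f: "holey_quasigroup p f" and XY: "fst X \<in> {0..<p}" "fst Y \<in> {0..<p}" "fst X \<noteq> fst Y"
  shows "\<exists>ws\<in>level_cycles r p f. (level_vertex r X u, level_vertex r Y (u + int r + 1)) \<in> cycle_edges ws"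
proof -
  have "X \<in> {0..<p} \<times> UNIV" "Y \<in> {0..<p} \<times> UNIV" using XY by (simp_all add: mem_Times_iff)
  then obtain W where "W \<in> {0..<p} \<times> UNIV" and W: "fst W \<noteq> fst X" "f X W = Y" "f W X = Y"
    using f XY(3) by (rule holey_quasigroup_solve)
  then have "fst W \<in> {0..<p}" by auto
  show ?thesis
  proof (cases "fst X < fst W")
    case True
    then show ?thesis
      using level_cycle_apex_edges(1)[of r X u Y W] W \<open>fst W \<in> {0..<p}\<close> XY(1) level_cyclesI[of X p W r f u] by auto
  next
    case False
    then show ?thesis
      using level_cycle_apex_edges(2)[of r X u Y W] W \<open>fst W \<in> {0..<p}\<close> XY(1) level_cyclesI[of W p X r f u] by auto
  qed
qed

lemma level_cycles_cover:
  assumes f: "holey_quasigroup p f" and X: "fst X \<in> {0..<p}" and Y: "fst Y \<in> {0..<p}" and "fst X \<noteq> fst Y"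
  shows "\<exists>ws\<in>level_cycles r p f. (level_vertex r X i, level_vertex r Y j) \<in> cycle_edges ws"
proof -
  let ?k = "2 * int r + 3"
  define d where "d = (j - i + int r + 1) mod ?k - (int r + 1)"
  have "0 \<le> (j - i + int r + 1) mod ?k" "(j - i + int r + 1) mod ?k < ?k" by simp_all
  then consider "\<bar>d\<bar> \<le> int r" | "d = int r + 1" | "i = i + d + int r + 1" unfolding d_def by linarith
  moreover have "?k dvd j - (i + d)"
    using dvd_minus_mod[of ?k "j - i + int r + 1"] by (simp add: d_def algebra_simps)
  then have Yj: "level_vertex r Y j = level_vertex r Y (i + d)" by (simp add: level_vertex_eq_iff)
  ultimately show ?thesis
  proof cases
    case 1
    then show ?thesis unfolding Yj using assms by (intro level_cycles_cover_offset)
  next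
    case 2
    then show ?thesis using level_cycles_cover_apex[OF assms, of r i] unfolding Yj by (simp add: add.assoc)
  next
    case 3
    then show ?thesis
      using level_cycles_cover_apex[OF f Y X assms(4)[symmetric], of r "i + d"]
      unfolding Yj by (metis cycle_edges_sym)
  qed
qed

lemma level_cycles_subset:
  assumes f: "holey_quasigroup p f"
  shows "level_cycles r p f \<subseteq> cycles_on (Some ` ({0..<p} \<times> UNIV \<times> {0..<2 * int r + 3})) (2 * r + 3)"
proof
  fix ws assume "ws \<in> level_cycles r p f"
  then obtain X Y i where ws: "ws = level_cycle r X Y (f X Y) i"
    and XY: "fst X \<in> {0..<p}" "fst Y \<in> {0..<p}" "fst X < fst Y" by (auto simp: level_cycles_def)
  have "X \<in> {0..<p} \<times> UNIV" "Y \<in> {0..<p} \<times> UNIV" "fst X \<noteq> fst Y" using XY by (simp_all add: mem_Times_iff)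
  then have "f X Y \<in> {0..<p} \<times> UNIV \<and> f X Y \<noteq> X \<and> f X Y \<noteq> Y" using f unfolding holey_quasigroup_def by blast
  then show "ws \<in> cycles_on (Some ` ({0..<p} \<times> UNIV \<times> {0..<2 * int r + 3})) (2 * r + 3)"
    unfolding ws using XY by (intro level_cycle_in_cycles_on) (auto simp: mem_Times_iff)
qed

lemma cycle_decomposition_odd:
  assumes k: "odd k" "3 \<le> k" and p: "3 \<le> p"
  shows "\<exists>C. cycle_decomposition k (insert None (Some ` ({0..<int p} \<times> (UNIV :: bool set) \<times> {0..<int k}))) C"
proof -
  obtain r where k_eq: "k = 2 * r + 3" using k by (intro that[of "(k - 3) div 2"]) (auto elim!: oddE)
  obtain f where f: "holey_quasigroup (int p) f" using holey_quasigroup_exists[of "int p"] p by auto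
  show ?thesis
  proof (rule cycle_decomposition_of_groups[OF k(2)])
    show "level_cycles r (int p) f \<subseteq> cycles_on (Some ` ({0..<int p} \<times> (UNIV :: bool set) \<times> {0..<int k})) k"
      using level_cycles_subset[OF f, of r] by (simp add: k_eq)
    show "card (level_cycles r (int p) f) \<le> 2 * k * (card {0..<int p} * (card {0..<int p} - 1))"
      using card_level_cycles_le[of r p f] by (simp add: k_eq)
    show "card ((UNIV :: bool set) \<times> {0..<int k}) = 2 * k" by (simp add: card_cartesian_product)
    fix g h and a b :: "bool \<times> int"
    assume gh: "g \<in> {0..<int p}" "h \<in> {0..<int p}" "g \<noteq> h"
      and ab: "a \<in> UNIV \<times> {0..<int k}" "b \<in> UNIV \<times> {0..<int k}"
    have "Some (g, a) = level_vertex r (g, fst a) (snd a)" "Some (h, b) = level_vertex r (h, fst b) (snd b)"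
      using ab by (auto simp: level_vertex_def k_eq)
    then show "\<exists>ws\<in>level_cycles r (int p) f. (Some (g, a), Some (h, b)) \<in> cycle_edges ws"
      using level_cycles_cover[OF f, of "(g, fst a)" "(h, fst b)" r "snd a" "snd b"] gh by simp
  qed auto
qed

section \<open>The tournament of a cycle decomposition\<close>

definition decomposition_arcs :: "'a list set \<Rightarrow> 'a rel" where
  "decomposition_arcs C = (\<Union>ws\<in>C. cycle_arcs ws)"

definition reorient :: "('a list \<Rightarrow> bool) \<Rightarrow> 'a list \<Rightarrow> 'a list" where
  "reorient J ws = (if J ws then ws else rev ws)"

lemma cycle_edges_reorient: "cycle_edges (reorient J ws) = cycle_edges ws"
  by (simp add: reorient_def cycle_edges_rev)

lemma decomposition_arcs_rev: "decomposition_arcs (rev ` C) = (decomposition_arcs C)\<inverse>"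
  by (auto simp: decomposition_arcs_def cycle_arcs_rev)

context cycle_decomposition
begin

lemma cycle_props:
  assumes "ws \<in> C"
  shows "length ws = k" "distinct ws" "set ws \<subseteq> V" "3 \<le> length ws"
  using cycles assms three_le by (auto simp: cycles_on_def)

lemma cycle_decomposition_reorient: "cycle_decomposition k V (reorient J ` C)"
proof
  show "reorient J ` C \<subseteq> cycles_on V k"
    by (rule image_subsetI) (simp add: cycles_on_def reorient_def cycle_props)
  show "pairwise (\<lambda>ws ws'. disjnt (cycle_edges ws) (cycle_edges ws')) (reorient J ` C)"
    using edges_disjoint unfolding pairwise_def by (auto simp: cycle_edges_reorient)
  show "\<exists>ws\<in>reorient J ` C. (u, v) \<in> cycle_edges ws" if "u \<in> V" "v \<in> V" "u \<noteq> v" for u v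
    using edges_cover[OF that] by (simp add: cycle_edges_reorient)
qed (fact three_le finite_verts)+

lemma arcs_disjoint:
  assumes "ws \<in> C" "ws' \<in> C" "ws \<noteq> ws'"
  shows "cycle_arcs ws \<inter> cycle_arcs ws' = {}" "cycle_arcs ws \<inter> (cycle_arcs ws')\<inverse> = {}"
  using edges_disjoint assms by (auto simp: pairwise_def disjnt_def cycle_edges_def)

lemma decomposition_arcs_subset: "decomposition_arcs C \<subseteq> V \<times> V"
  using cycle_props(3) cycle_arcs_subset by (fastforce simp: decomposition_arcs_def)

lemma finite_decomposition_arcs: "finite (decomposition_arcs C)"
  by (simp add: decomposition_arcs_def finite_cycles)

lemma decomposition_arcs_antisym: "(u, v) \<in> decomposition_arcs C \<Longrightarrow> (v, u) \<notin> decomposition_arcs C"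
  using arcs_disjoint(2) cycle_arcs_disjoint_converse[OF cycle_props(2,4)]
  unfolding decomposition_arcs_def by blast

lemma decomposition_arcs_total:
  assumes "u \<in> V" "v \<in> V" "u \<noteq> v"
  shows "(u, v) \<in> decomposition_arcs C \<or> (v, u) \<in> decomposition_arcs C"
  using edges_cover[OF assms] by (auto simp: decomposition_arcs_def cycle_edges_def)

lemma card_decomposition_arcs: "card (decomposition_arcs C) = k * card C"
proof -
  have "card (decomposition_arcs C) = (\<Sum>ws\<in>C. card (cycle_arcs ws))"
    unfolding decomposition_arcs_def using arcs_disjoint(1) by (intro card_UN_disjoint finite_cycles) simp_all
  then show ?thesis by (simp add: card_cycle_arcs cycle_props)
qed

lemma card_decomposition_arcs_Image: "card (decomposition_arcs C `` {v}) = card {ws \<in> C. v \<in> set ws}"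
proof -
  have "decomposition_arcs C `` {v} = (\<Union>ws\<in>C. cycle_arcs ws `` {v})" by (auto simp: decomposition_arcs_def)
  also have "card \<dots> = (\<Sum>ws\<in>C. card (cycle_arcs ws `` {v}))"
    using arcs_disjoint(1) by (intro card_UN_disjoint finite_cycles) (auto simp: finite_Image)
  finally show ?thesis using finite_cycles by (simp add: card_cycle_arcs_Image cycle_props Int_def)
qed

lemma real_card_cycles: "2 * real k * real (card C) = real (card V) * (real (card V) - 1)"
proof -
  have "2 * real k * real (card C) = real (card V * (card V - 1))"
    using cycle_decomposition_card by (metis of_nat_mult of_nat_numeral)
  then show ?thesis by (cases "card V") (simp_all add: algebra_simps)
qed

lemma decomposition_arcs_regular:
  assumes v: "v \<in> V"
  shows "2 * card (decomposition_arcs C `` {v}) = card V - 1"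
proof -
  let ?out = "decomposition_arcs C `` {v}" and ?in = "(decomposition_arcs C)\<inverse> `` {v}"
  interpret rev: cycle_decomposition k V "rev ` C"
    using cycle_decomposition_reorient[of "\<lambda>_. False"] by (simp add: reorient_def)
  have "{ws \<in> rev ` C. v \<in> set ws} = rev ` {ws \<in> C. v \<in> set ws}" by auto
  then have "card ?in = card ?out"
    using rev.card_decomposition_arcs_Image[of v] card_decomposition_arcs_Image[of v]
    by (simp add: decomposition_arcs_rev card_image)
  moreover have "V - {v} = ?out \<union> ?in"
    using decomposition_arcs_subset decomposition_arcs_antisym decomposition_arcs_total v by blast
  then have "card V - 1 = card (?out \<union> ?in)" using card_Diff_singleton[OF v] by simp
  moreover have "?out \<inter> ?in = {}" using decomposition_arcs_antisym by blast
  then have "card (?out \<union> ?in) = card ?out + card ?in"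
    using finite_decomposition_arcs by (intro card_Un_disjoint finite_Image) simp_all
  ultimately show ?thesis by simp
qed

end

section \<open>Random orientations\<close>

abbreviation fair_coins :: "'c set \<Rightarrow> ('c \<Rightarrow> bool) pmf" where
  "fair_coins C \<equiv> Pi_pmf C False (\<lambda>_. bernoulli_pmf (1 / 2))"

lemma expectation_fair_coin:
  fixes x y :: real
  assumes "finite C" "c \<in> C"
  shows "measure_pmf.expectation (fair_coins C) (\<lambda>\<omega>. if \<omega> c then x else y) = (x + y) / 2"
proof -
  have "measure_pmf.expectation (fair_coins C) (\<lambda>\<omega>. if \<omega> c then x else y)
      = measure_pmf.expectation (map_pmf (\<lambda>\<omega>. \<omega> c) (fair_coins C)) (\<lambda>b. if b then x else y)"
    by simp
  also have "map_pmf (\<lambda>\<omega>. \<omega> c) (fair_coins C) = bernoulli_pmf (1 / 2)"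
    using assms by (simp add: Pi_pmf_component)
  finally show ?thesis by simp
qed

lemma Hoeffding_fair_coins:
  fixes x y :: "'c \<Rightarrow> real"
  assumes C: "finite C" "C \<noteq> {}" and K: "0 < K" and "0 \<le> \<epsilon>"
    and bounds: "\<And>c. c \<in> C \<Longrightarrow> x c \<in> {0..K}" "\<And>c. c \<in> C \<Longrightarrow> y c \<in> {0..K}"
  shows "measure_pmf.prob (fair_coins C)
      {\<omega>. (\<Sum>c\<in>C. (x c + y c) / 2) + \<epsilon> \<le> (\<Sum>c\<in>C. if \<omega> c then x c else y c)}
    \<le> exp (- 2 * \<epsilon>\<^sup>2 / (real (card C) * K\<^sup>2))"
proof -
  let ?P = "measure_pmf (fair_coins C)"
  let ?X = "\<lambda>c \<omega>. if \<omega> c then x c else y c"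
  interpret Hoeffding_ineq ?P C ?X "\<lambda>_. 0" "\<lambda>_. K"
    "\<Sum>c\<in>C. measure_pmf.expectation (fair_coins C) (?X c)"
  proof unfold_locales
    show "prob_space.indep_vars ?P (\<lambda>_. borel) ?X C"
      using prob_space.indep_vars_compose2[OF measure_pmf.prob_space_axioms indep_vars_Pi_pmf[OF C(1)],
          of "\<lambda>c b. if b then x c else y c" "\<lambda>_. borel"] by simp
    show "AE \<omega> in ?P. ?X c \<omega> \<in> {0..K}" if "c \<in> C" for c using bounds[OF that] by simp
  qed (rule C)
  have "0 < card C * K\<^sup>2" using C K by (simp add: card_gt_0_iff)
  then show ?thesis
    using Hoeffding_ineq_ge[OF \<open>0 \<le> \<epsilon>\<close>] C(1) by (simp add: expectation_fair_coin)
qed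

lemma four_power_mult_exp_less_one:
  assumes "0 < n"
  shows "4 ^ n * exp (- 4 * real n) < 1"
proof -
  have "4 < exp (4 :: real)" using exp_ge_add_one_self[of "4 :: real"] by linarith
  then have "4 ^ n < exp (4 :: real) ^ n" using assms by (intro power_strict_mono) simp_all
  then show ?thesis by (simp add: exp_minus field_simps flip: exp_of_nat_mult)
qed

lemma exists_outside_events:
  assumes "finite I" and small: "(\<Sum>i\<in>I. measure_pmf.prob p (E i)) < 1"
  shows "\<exists>\<omega>. \<forall>i\<in>I. \<omega> \<notin> E i"
proof (rule ccontr)
  assume "\<not> ?thesis"
  then have "(\<Union>i\<in>I. E i) = UNIV" by blast
  then have "1 = measure_pmf.prob p (\<Union>i\<in>I. E i)" by (simp add: measure_pmf.prob_space)
  also have "\<dots> \<le> (\<Sum>i\<in>I. measure_pmf.prob p (E i))"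
    using assms(1) by (intro measure_pmf.finite_measure_subadditive_finite) auto
  finally show False using small by simp
qed

context cycle_decomposition
begin

lemma sum_card_cycle_edges_Int_le:
  assumes "A \<subseteq> V" "B \<subseteq> V"
  shows "(\<Sum>ws\<in>C. card (cycle_edges ws \<inter> A \<times> B)) \<le> card A * card B"
proof -
  have "finite (A \<times> B)" using assms finite_verts by (auto intro: finite_subset)
  have "(\<Sum>ws\<in>C. card (cycle_edges ws \<inter> A \<times> B)) = card (\<Union>ws\<in>C. cycle_edges ws \<inter> A \<times> B)"
    using edges_disjoint finite_cycles
    by (intro card_UN_disjoint[symmetric]) (fastforce simp: pairwise_def disjnt_def)+
  also have "\<dots> \<le> card (A \<times> B)" using \<open>finite (A \<times> B)\<close> by (intro card_mono) auto
  finally show ?thesis by (simp add: card_cartesian_product)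
qed

lemma card_cycle_edges_Int:
  assumes "ws \<in> C"
  shows "card (cycle_edges ws \<inter> S) = card (cycle_arcs ws \<inter> S) + card (cycle_arcs (rev ws) \<inter> S)"
proof -
  have "(cycle_arcs ws \<inter> S) \<inter> (cycle_arcs (rev ws) \<inter> S) = {}"
    using cycle_arcs_disjoint_converse[OF cycle_props(2,4)[OF assms]] by (auto simp: cycle_arcs_rev)
  then show ?thesis
    by (subst card_Un_disjoint[symmetric]) (auto simp: cycle_edges_def cycle_arcs_rev Int_Un_distrib2)
qed

lemma card_decomposition_arcs_reorient_Int_le:
  "card (decomposition_arcs (reorient J ` C) \<inter> S) \<le> (\<Sum>ws\<in>C. card (cycle_arcs (reorient J ws) \<inter> S))"
proof -
  have "decomposition_arcs (reorient J ` C) \<inter> S = (\<Union>ws\<in>C. cycle_arcs (reorient J ws) \<inter> S)"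
    by (auto simp: decomposition_arcs_def)
  also have "card \<dots> \<le> (\<Sum>ws\<in>C. card (cycle_arcs (reorient J ws) \<inter> S))"
    by (rule card_UN_le[OF finite_cycles])
  finally show ?thesis .
qed

lemma prob_reorient_dense_le:
  fixes \<epsilon> :: real
  assumes AB: "A \<subseteq> V" "B \<subseteq> V" and "0 \<le> \<epsilon>" and "C \<noteq> {}"
  shows "measure_pmf.prob (fair_coins C)
      {J. real (card A) * real (card B) / 2 + \<epsilon> \<le> real (card (decomposition_arcs (reorient J ` C) \<inter> A \<times> B))}
    \<le> exp (- 2 * \<epsilon>\<^sup>2 / (real (card C) * (real k)\<^sup>2))"
proof -
  define x where "x ws = real (card (cycle_arcs ws \<inter> A \<times> B))" for ws
  define y where "y ws = real (card (cycle_arcs (rev ws) \<inter> A \<times> B))" for ws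
  have card_le: "card (cycle_arcs ws \<inter> A \<times> B) \<le> k" if "distinct ws" "length ws = k" for ws
    using card_mono[of "cycle_arcs ws" "cycle_arcs ws \<inter> A \<times> B"] card_cycle_arcs[OF that(1)] that(2) by simp
  have bounds: "x ws \<in> {0..real k}" "y ws \<in> {0..real k}" if "ws \<in> C" for ws
    using card_le[of ws] card_le[of "rev ws"] cycle_props[OF that] by (simp_all add: x_def y_def)
  have arcs_le: "real (card (decomposition_arcs (reorient J ` C) \<inter> A \<times> B))
      \<le> (\<Sum>ws\<in>C. if J ws then x ws else y ws)" for J
  proof -
    have "(\<Sum>ws\<in>C. if J ws then x ws else y ws) = real (\<Sum>ws\<in>C. card (cycle_arcs (reorient J ws) \<inter> A \<times> B))"
      unfolding of_nat_sum by (intro sum.cong refl) (simp add: reorient_def x_def y_def)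
    then show ?thesis
      using card_decomposition_arcs_reorient_Int_le[of J "A \<times> B"] by (simp only: of_nat_le_iff)
  qed
  have "(\<Sum>ws\<in>C. x ws + y ws) = real (\<Sum>ws\<in>C. card (cycle_edges ws \<inter> A \<times> B))"
    by (simp add: x_def y_def card_cycle_edges_Int)
  also have "\<dots> \<le> real (card A * card B)" using sum_card_cycle_edges_Int_le[OF AB] by (rule of_nat_mono)
  finally have mean: "(\<Sum>ws\<in>C. (x ws + y ws) / 2) \<le> real (card A) * real (card B) / 2"
    by (simp flip: sum_divide_distrib)
  have "real (card A) * real (card B) / 2 + \<epsilon> \<le> real (card (decomposition_arcs (reorient J ` C) \<inter> A \<times> B))
      \<longrightarrow> (\<Sum>ws\<in>C. (x ws + y ws) / 2) + \<epsilon> \<le> (\<Sum>ws\<in>C. if J ws then x ws else y ws)" for J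
    using arcs_le[of J] mean by linarith
  then have "measure_pmf.prob (fair_coins C)
      {J. real (card A) * real (card B) / 2 + \<epsilon> \<le> real (card (decomposition_arcs (reorient J ` C) \<inter> A \<times> B))}
    \<le> measure_pmf.prob (fair_coins C)
        {J. (\<Sum>ws\<in>C. (x ws + y ws) / 2) + \<epsilon> \<le> (\<Sum>ws\<in>C. if J ws then x ws else y ws)}"
    by (intro measure_pmf.finite_measure_mono Collect_mono) simp_all
  also have "\<dots> \<le> exp (- 2 * \<epsilon>\<^sup>2 / (real (card C) * (real k)\<^sup>2))"
    by (rule Hoeffding_fair_coins[of C "real k" \<epsilon> x y])
      (use finite_cycles assms(3,4) three_le bounds in simp_all)
  finally show ?thesis .
qed

lemma quasirandom_reorientation_exists:
  fixes \<delta> :: real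
  assumes "0 < \<delta>" and n: "1 < card V" "real k \<le> \<delta>\<^sup>2 * real (card V)"
  shows "\<exists>J. quasirandom \<delta> V (decomposition_arcs (reorient J ` C))"
proof -
  let ?n = "real (card V)"
  let ?bad = "\<lambda>(A, B). {J. real (card A) * real (card B) / 2 + \<delta> * ?n\<^sup>2
      \<le> real (card (decomposition_arcs (reorient J ` C) \<inter> A \<times> B))}"
  have "0 < 2 * k * card C" using cycle_decomposition_card n(1) by simp
  then have C: "0 < real (card C)" "C \<noteq> {}" and k: "0 < real k" by auto
  have "2 * real k * real (card C) \<le> ?n\<^sup>2"
    using real_card_cycles by (simp add: power2_eq_square algebra_simps)
  then have "2 * ?n * real k * (2 * real k * real (card C)) \<le> 2 * ?n * real k * ?n\<^sup>2"
    by (rule mult_left_mono) simp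
  also have "\<dots> \<le> 2 * ?n * (\<delta>\<^sup>2 * ?n) * ?n\<^sup>2" using n(2) by (intro mult_right_mono mult_left_mono) simp_all
  finally have "4 * ?n * (real (card C) * (real k)\<^sup>2) \<le> 2 * (\<delta> * ?n\<^sup>2)\<^sup>2"
    by (simp add: power2_eq_square mult_ac)
  then have "4 * ?n \<le> 2 * (\<delta> * ?n\<^sup>2)\<^sup>2 / (real (card C) * (real k)\<^sup>2)"
    using C k by (simp add: pos_le_divide_eq)
  then have tail: "exp (- 2 * (\<delta> * ?n\<^sup>2)\<^sup>2 / (real (card C) * (real k)\<^sup>2)) \<le> exp (- 4 * ?n)" by simp
  have prob: "measure_pmf.prob (fair_coins C) (?bad AB) \<le> exp (- 4 * ?n)" if AB: "AB \<in> Pow V \<times> Pow V" for AB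
  proof -
    have "measure_pmf.prob (fair_coins C) (?bad AB) \<le> exp (- 2 * (\<delta> * ?n\<^sup>2)\<^sup>2 / (real (card C) * (real k)\<^sup>2))"
      unfolding case_prod_beta using AB assms(1) C(2) by (intro prob_reorient_dense_le) auto
    then show ?thesis using tail by (rule order_trans)
  qed
  then have "(\<Sum>AB\<in>Pow V \<times> Pow V. measure_pmf.prob (fair_coins C) (?bad AB))
      \<le> (\<Sum>AB\<in>Pow V \<times> Pow V. exp (- 4 * ?n))"
    by (rule sum_mono)
  also have "\<dots> = 4 ^ card V * exp (- 4 * ?n)"
    using finite_verts by (simp add: card_cartesian_product card_Pow flip: power_mult_distrib)
  also have "\<dots> < 1" using n(1) by (intro four_power_mult_exp_less_one) simp
  finally obtain J where "\<forall>AB\<in>Pow V \<times> Pow V. J \<notin> ?bad AB"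
    using exists_outside_events[of "Pow V \<times> Pow V" "fair_coins C" ?bad] finite_verts by blast
  then have "quasirandom \<delta> V (decomposition_arcs (reorient J ` C))"
    by (auto simp: quasirandom_def not_le less_imp_le)
  then show ?thesis by blast
qed

end

section \<open>Copies of directed cycles\<close>

definition cycle_digraph :: "'a list \<Rightarrow> 'a pair_pre_digraph" where
  "cycle_digraph ws = \<lparr>pverts = set ws, parcs = cycle_arcs ws\<rparr>"

lemma cycle_digraph_simps [simp]:
  "pverts (cycle_digraph ws) = set ws" "parcs (cycle_digraph ws) = cycle_arcs ws"
  by (simp_all add: cycle_digraph_def)

lemma wf_digraph_with_proj: "wf_digraph (with_proj D) \<longleftrightarrow> parcs D \<subseteq> pverts D \<times> pverts D"
  by (auto simp: wf_digraph_def)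

lemma directed_cycle_eq: "directed_cycle k = cycle_digraph [0..<k]"
  unfolding directed_cycle_def cycle_digraph_def cycle_arcs_conv_nth
  by (auto simp: image_iff lessThan_atLeast0)

lemma digraph_iso_with_projD:
  assumes "digraph_iso (with_proj D) (with_proj X)"
  obtains g where "inj_on g (pverts D)" "pverts X = g ` pverts D" "parcs X = map_prod g g ` parcs D"
proof -
  obtain f where f: "pre_digraph.digraph_isomorphism (with_proj D) f"
    and X: "with_proj X = app_iso f (with_proj D)"
    using assms by (auto simp: digraph_iso_def)
  define g where "g = iso_verts f"
  have ends: "iso_tail f = fst" "iso_head f = snd"
    using arg_cong[OF X, of tail] arg_cong[OF X, of head] by simp_all
  have "iso_arcs f a = map_prod g g a" if "a \<in> parcs D" for a
    using f that unfolding pre_digraph.digraph_isomorphism_def by (simp add: ends g_def prod_eq_iff)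
  then have "parcs X = map_prod g g ` parcs D"
    using arg_cong[OF X, of arcs] by (auto intro!: image_cong)
  moreover have "inj_on g (pverts D)" "pverts X = g ` pverts D"
    using f arg_cong[OF X, of verts] by (simp_all add: pre_digraph.digraph_isomorphism_def g_def)
  ultimately show thesis using that by blast
qed

lemma digraph_iso_with_projI:
  assumes "parcs D \<subseteq> pverts D \<times> pverts D" and g: "inj_on g (pverts D)"
    and X: "pverts X = g ` pverts D" "parcs X = map_prod g g ` parcs D"
  shows "digraph_iso (with_proj D) (with_proj X)"
proof -
  let ?f = "\<lparr>iso_verts = g, iso_arcs = map_prod g g, iso_head = snd, iso_tail = fst\<rparr>"
  have "inj_on (map_prod g g) (parcs D)"
    using map_prod_inj_on[OF g g] assms(1) by (rule inj_on_subset)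
  then have "pre_digraph.digraph_isomorphism (with_proj D) ?f"
    using assms(1) g by (simp add: pre_digraph.digraph_isomorphism_def wf_digraph_with_proj)
  moreover have "with_proj X = app_iso ?f (with_proj D)"
    by (simp add: app_iso_def with_proj_def X)
  ultimately show ?thesis unfolding digraph_iso_def by blast
qed

lemma directed_cycle_iso_iff:
  "digraph_iso (with_proj (directed_cycle k)) (with_proj X)
    \<longleftrightarrow> (\<exists>ws\<in>cycles_on (pverts X) k. X = cycle_digraph ws)"
proof
  assume "digraph_iso (with_proj (directed_cycle k)) (with_proj X)"
  then obtain g where g: "inj_on g {..<k}" "pverts X = g ` {..<k}"
      "parcs X = map_prod g g ` cycle_arcs [0..<k]"
    by (rule digraph_iso_with_projD) (simp add: directed_cycle_eq lessThan_atLeast0)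
  define ws where "ws = map g [0..<k]"
  have "ws \<in> cycles_on (pverts X) k"
    using g(1,2) by (auto simp: ws_def cycles_on_def distinct_map lessThan_atLeast0)
  moreover have "X = cycle_digraph ws"
    using g(2,3) by (cases X) (simp add: cycle_digraph_def ws_def cycle_arcs_map lessThan_atLeast0)
  ultimately show "\<exists>ws\<in>cycles_on (pverts X) k. X = cycle_digraph ws" by blast
next
  assume "\<exists>ws\<in>cycles_on (pverts X) k. X = cycle_digraph ws"
  then obtain ws where ws: "length ws = k" "distinct ws" and X: "X = cycle_digraph ws"
    by (auto simp: cycles_on_def)
  have "map ((!) ws) [0..<k] = ws" using map_nth[of ws] ws(1) by simp
  then have "set ws = (!) ws ` {..<k}" "cycle_arcs ws = map_prod ((!) ws) ((!) ws) ` cycle_arcs [0..<k]"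
    by (metis lessThan_atLeast0 set_map set_upt, metis cycle_arcs_map)
  moreover have "inj_on ((!) ws) {..<k}" using ws inj_on_nth by blast
  ultimately show "digraph_iso (with_proj (directed_cycle k)) (with_proj X)"
    using cycle_arcs_subset[of "[0..<k]"] unfolding directed_cycle_eq X
    by (intro digraph_iso_with_projI) (simp_all add: lessThan_atLeast0)
qed

lemma cycle_copies_eq:
  assumes D: "parcs D \<subseteq> pverts D \<times> pverts D"
  shows "cycle_copies k D = cycle_digraph ` {ws \<in> cycles_on (pverts D) k. cycle_arcs ws \<subseteq> parcs D}"
proof -
  have "subgraph (with_proj (cycle_digraph ws)) (with_proj D)
      \<longleftrightarrow> set ws \<subseteq> pverts D \<and> cycle_arcs ws \<subseteq> parcs D" for ws
    using D cycle_arcs_subset[of ws] by (auto simp: subgraph_def wf_digraph_with_proj compatible_def)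
  then show ?thesis unfolding cycle_copies_def directed_cycle_iso_iff by (auto simp: cycles_on_def)
qed

lemma finite_cycle_copies:
  assumes "parcs D \<subseteq> pverts D \<times> pverts D" "finite (pverts D)"
  shows "finite (cycle_copies k D)"
  using finite_cycles_on[OF assms(2)] by (simp add: cycle_copies_eq assms(1))

lemma cycle_copy_arcs:
  assumes "parcs D \<subseteq> pverts D \<times> pverts D" "X \<in> cycle_copies k D"
  shows "parcs X \<subseteq> parcs D" "card (parcs X) = k"
  using assms(2) by (auto simp: cycle_copies_eq[OF assms(1)] cycles_on_def card_cycle_arcs)

lemma cycle_copies_acyclic:
  assumes "0 < k" "parcs D \<subseteq> pverts D \<times> pverts D" "finite (parcs D)" "acyclic (parcs D)"
  shows "cycle_copies k D = {}"
proof (rule equals0I)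
  fix X assume "X \<in> cycle_copies k D"
  then obtain ws where ws: "length ws = k" "distinct ws" "cycle_arcs ws \<subseteq> parcs D"
    by (auto simp: cycle_copies_eq[OF assms(2)] cycles_on_def)
  have "wf ((parcs D)\<inverse>)" using assms(3,4) by (rule finite_acyclic_wf_converse)
  moreover have "set ws \<noteq> {}" using ws(1) assms(1) by auto
  ultimately obtain z where z: "z \<in> set ws" "\<And>y. (y, z) \<in> (parcs D)\<inverse> \<Longrightarrow> y \<notin> set ws" by (rule wfE_min') blast
  have "card (cycle_arcs ws `` {z}) = 1" using z(1) ws(2) by (simp add: card_cycle_arcs_Image)
  then obtain y where "(z, y) \<in> cycle_arcs ws" by (auto simp: card_1_singleton_iff)
  then show False using z(2)[of y] ws(3) cycle_arcs_subset[of ws] by auto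
qed

section \<open>Packings\<close>

lemma fractional_packing_le:
  fixes m :: "'a pair_pre_digraph \<Rightarrow> real"
  assumes D: "parcs D \<subseteq> pverts D \<times> pverts D" "finite (pverts D)" and m: "fractional_packing k D m"
  shows "real k * (\<Sum>X\<in>cycle_copies k D. m X) \<le> real (card (parcs D))"
proof -
  have "finite (parcs D)" using D by (auto intro: finite_subset)
  have "{e \<in> parcs D. e \<in> parcs X} = parcs X" if "X \<in> cycle_copies k D" for X
    using cycle_copy_arcs(1)[OF D(1) that] by auto
  then have "real k * (\<Sum>X\<in>cycle_copies k D. m X) = (\<Sum>X\<in>cycle_copies k D. \<Sum>e | e \<in> parcs D \<and> e \<in> parcs X. m X)"
    using cycle_copy_arcs(2)[OF D(1)] by (simp add: sum_distrib_left)
  also have "\<dots> = (\<Sum>e\<in>parcs D. \<Sum>X | X \<in> cycle_copies k D \<and> e \<in> parcs X. m X)"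
    by (rule sum.swap_restrict[OF finite_cycle_copies[OF D] \<open>finite (parcs D)\<close>])
  also have "\<dots> \<le> (\<Sum>e\<in>parcs D. 1)"
    using m by (intro sum_mono) (simp add: fractional_packing_def)
  finally show ?thesis by simp
qed

lemma fractional_packing_of_packing:
  assumes fin: "finite (cycle_copies k D)" and P: "P \<subseteq> cycle_copies k D" "pairwise arc_disjoint P"
  shows "fractional_packing k D (\<lambda>X. of_bool (X \<in> P))"
    and "(\<Sum>X\<in>cycle_copies k D. of_bool (X \<in> P)) = real (card P)"
proof -
  have "finite P" using P(1) fin by (rule finite_subset)
  have "(\<Sum>X | X \<in> cycle_copies k D \<and> e \<in> parcs X. of_bool (X \<in> P)) = real (card {X \<in> P. e \<in> parcs X})" for e
  proof -
    have "{X \<in> cycle_copies k D. e \<in> parcs X} \<inter> P = {X \<in> P. e \<in> parcs X}" using P(1) by auto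
    then show ?thesis using fin by simp
  qed
  moreover have "card {X \<in> P. e \<in> parcs X} \<le> 1" for e
    using P(2) \<open>finite P\<close> by (auto simp: card_le_Suc0_iff_eq pairwise_def arc_disjoint_def)
  ultimately show "fractional_packing k D (\<lambda>X. of_bool (X \<in> P))" by (simp add: fractional_packing_def)
  show "(\<Sum>X\<in>cycle_copies k D. of_bool (X \<in> P)) = real (card P)" using P(1) fin by (simp add: Int_absorb1)
qed

lemma nu_nu_frac_of_perfect_packing:
  assumes k: "0 < k" and D: "parcs D \<subseteq> pverts D \<times> pverts D" "finite (pverts D)"
    and P: "P \<subseteq> cycle_copies k D" "pairwise arc_disjoint P" and perfect: "k * card P = card (parcs D)"
  shows "nu k D = card P" "nu_frac k D = card P"
proof -
  note fin = finite_cycle_copies[OF D, of k]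
  have sum_le: "(\<Sum>X\<in>cycle_copies k D. m X) \<le> card P" if "fractional_packing k D m" for m
  proof -
    have "real k * (\<Sum>X\<in>cycle_copies k D. m X) \<le> real k * card P"
      using fractional_packing_le[OF D that] by (simp flip: perfect)
    then show ?thesis using k by simp
  qed
  show "nu_frac k D = card P"
    unfolding nu_frac_def
  proof (rule Greatest_equality)
    show "\<exists>m. fractional_packing k D m \<and> real (card P) = (\<Sum>X\<in>cycle_copies k D. m X)"
      using fractional_packing_of_packing[OF fin P] by metis
  qed (use sum_le in blast)
  have "card Q \<le> card P" if "Q \<subseteq> cycle_copies k D" "pairwise arc_disjoint Q" for Q
    using sum_le[OF fractional_packing_of_packing(1)[OF fin that]]
      fractional_packing_of_packing(2)[OF fin that] by simp
  moreover have "finite {card Q | Q. Q \<subseteq> cycle_copies k D \<and> pairwise arc_disjoint Q}"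
    by (rule finite_subset[of _ "card ` Pow (cycle_copies k D)"]) (blast, simp add: fin)
  ultimately show "nu k D = card P" unfolding nu_def using P by (intro Max_eqI) blast+
qed

section \<open>Transversals\<close>

lemma finite_transversal_sizes:
  assumes "finite (parcs D)"
  shows "finite {card F | F. F \<subseteq> parcs D \<and> cycle_copies k (D\<lparr>parcs := parcs D - F\<rparr>) = {}}"
  by (rule finite_subset[of _ "card ` Pow (parcs D)"]) (blast, simp add: assms)

lemma tau_le:
  assumes "finite (parcs D)" "F \<subseteq> parcs D" "cycle_copies k (D\<lparr>parcs := parcs D - F\<rparr>) = {}"
  shows "tau k D \<le> card F"
  unfolding tau_def using assms(2,3) by (intro Min_le finite_transversal_sizes[OF assms(1)]) blast

lemma tau_attained:
  assumes k: "0 < k" and fin: "finite (parcs D)"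
  obtains F where "F \<subseteq> parcs D" "cycle_copies k (D\<lparr>parcs := parcs D - F\<rparr>) = {}" "tau k D = card F"
proof -
  let ?S = "{card F | F. F \<subseteq> parcs D \<and> cycle_copies k (D\<lparr>parcs := parcs D - F\<rparr>) = {}}"
  have "cycle_copies k (D\<lparr>parcs := parcs D - parcs D\<rparr>) = {}"
    by (rule cycle_copies_acyclic[OF k]) (simp_all add: acyclic_def)
  then have "?S \<noteq> {}" by blast
  then have "Min ?S \<in> ?S" using finite_transversal_sizes[OF fin] by (intro Min_in)
  then show thesis using that unfolding tau_def by blast
qed

lemma tau_le_half:
  fixes D :: "'a::linorder pair_pre_digraph"
  assumes k: "0 < k" and D: "parcs D \<subseteq> pverts D \<times> pverts D" "finite (pverts D)" and irrefl: "irrefl (parcs D)"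
  shows "2 * tau k D \<le> card (parcs D)"
proof -
  let ?up = "{(u, v) \<in> parcs D. u < v}" and ?down = "{(u, v) \<in> parcs D. v < u}"
  have fin: "finite (parcs D)" using D by (auto intro: finite_subset)
  have "u < v \<or> v < u" if "(u, v) \<in> parcs D" for u v using irrefl that by (metis irreflD neq_iff)
  then have split: "?up \<union> ?down = parcs D" "?up \<inter> ?down = {}" by auto
  have "finite ?up" "finite ?down" by (rule finite_subset[OF _ fin], blast)+
  have down: "acyclic ?down" by (rule acyclicI_order[of _ id]) auto
  have "acyclic (?up\<inverse>)" by (rule acyclicI_order[of _ id]) auto
  then have up: "acyclic ?up" by simp
  have tau_le_Diff: "tau k D \<le> card (parcs D - H)" if "H \<subseteq> parcs D" "acyclic H" for H
  proof (rule tau_le[OF fin])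
    have "parcs D - (parcs D - H) = H" using that(1) by auto
    then show "cycle_copies k (D\<lparr>parcs := parcs D - (parcs D - H)\<rparr>) = {}"
      using that D(1) finite_subset[OF that(1) fin] by (intro cycle_copies_acyclic[OF k]) auto
  qed auto
  have "parcs D - ?up = ?down" "parcs D - ?down = ?up" using split by blast+
  then have "tau k D \<le> card ?down" "tau k D \<le> card ?up"
    using tau_le_Diff[OF _ up] tau_le_Diff[OF _ down] by auto
  moreover have "card ?up + card ?down = card (parcs D)"
    using split(1) card_Un_disjoint[OF \<open>finite ?up\<close> \<open>finite ?down\<close> split(2)] by simp
  ultimately show ?thesis by linarith
qed

section \<open>Optimal tournaments\<close>

definition decomposition_tournament :: "'a set \<Rightarrow> 'a list set \<Rightarrow> 'a pair_pre_digraph" where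
  "decomposition_tournament V C = \<lparr>pverts = V, parcs = decomposition_arcs C\<rparr>"

definition optimal_tournament :: "nat \<Rightarrow> nat \<Rightarrow> 'a pair_pre_digraph \<Rightarrow> bool" where
  "optimal_tournament k n T \<longleftrightarrow> regular_tournament T \<and> card (pverts T) = n \<and>
     real (nu k T) = nu_frac k T \<and> nu_frac k T = real n * (real n - 1) / (2 * real k)"

lemma decomposition_tournament_simps [simp]:
  "pverts (decomposition_tournament V C) = V" "parcs (decomposition_tournament V C) = decomposition_arcs C"
  by (simp_all add: decomposition_tournament_def)

lemma (in tournament) parcs_subset: "parcs G \<subseteq> pverts G \<times> pverts G"
  using in_arcsD1 in_arcsD2 by auto

lemma (in tournament) irrefl_parcs: "irrefl (parcs G)"
  using pair_no_loops by (intro irreflI) fastforce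

lemma (in tournament) card_parcs: "2 * card (parcs G) = card (pverts G) * (card (pverts G) - 1)"
proof -
  have ends: "u \<in> pverts G \<and> v \<in> pverts G \<and> u \<noteq> v" if "(u, v) \<in> parcs G" for u v
    using that parcs_subset irrefl_parcs by (auto dest: irreflD)
  then have "pverts G \<times> pverts G - Id = parcs G \<union> (parcs G)\<inverse>"
    using exactly_one_arc by auto
  moreover have "parcs G \<inter> (parcs G)\<inverse> = {}"
    using ends exactly_one_arc by blast
  ultimately show ?thesis
    using card_off_diagonal[OF pair_finite_verts] pair_finite_arcs by (simp add: card_Un_disjoint)
qed

lemma tau_tournament_le:
  fixes T :: "'a::linorder pair_pre_digraph"
  assumes k: "0 < k" and T: "tournament T"
  shows "real (tau k T) \<le> (real (card (pverts T)))\<^sup>2 / 4"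
proof -
  interpret tournament T by (fact T)
  have "2 * tau k T \<le> card (parcs T)"
    using tau_le_half[OF k parcs_subset pair_finite_verts irrefl_parcs] .
  moreover have "2 * card (parcs T) \<le> card (pverts T) * card (pverts T)" using card_parcs by simp
  ultimately have "4 * tau k T \<le> card (pverts T) * card (pverts T)" by linarith
  then have "real (4 * tau k T) \<le> real (card (pverts T) * card (pverts T))" by (rule of_nat_mono)
  then show ?thesis by (simp add: power2_eq_square)
qed

lemma tau_ge_of_dense_cycles:
  fixes c :: real
  assumes k: "0 < k" and D: "parcs D \<subseteq> pverts D \<times> pverts D" and fin: "finite (parcs D)"
    and dense: "\<And>H. H \<subseteq> parcs D \<Longrightarrow> c \<le> real (card H) \<Longrightarrow> \<exists>ws\<in>cycles_on (pverts D) k. cycle_arcs ws \<subseteq> H"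
  shows "real (card (parcs D)) - c \<le> real (tau k D)"
proof -
  obtain F where F: "F \<subseteq> parcs D" "cycle_copies k (D\<lparr>parcs := parcs D - F\<rparr>) = {}" "tau k D = card F"
    using tau_attained[OF k fin] .
  have "\<not> (\<exists>ws\<in>cycles_on (pverts D) k. cycle_arcs ws \<subseteq> parcs D - F)"
    using F(2) D by (subst (asm) cycle_copies_eq) auto
  then have "real (card (parcs D - F)) < c" using dense[of "parcs D - F"] by fastforce
  moreover have "card (parcs D) = card (parcs D - F) + card F"
    using F(1) fin card_mono[OF fin F(1)] by (simp add: card_Diff_subset finite_subset)
  ultimately show ?thesis using F(3) by simp
qed

context cycle_decomposition
begin

lemma tournament_decomposition_tournament: "tournament (decomposition_tournament V C)"
proof unfold_locales
  let ?T = "decomposition_tournament V C"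
  show "fst e \<in> pverts ?T" "snd e \<in> pverts ?T" if "e \<in> parcs ?T" for e
    using decomposition_arcs_subset that by auto
  show "fst e \<noteq> snd e" if "e \<in> parcs ?T" for e
    using that decomposition_arcs_antisym[of "fst e" "fst e"] by (cases e) auto
  show "((u, v) \<in> parcs ?T) \<noteq> ((v, u) \<in> parcs ?T)" if "u \<in> pverts ?T" "v \<in> pverts ?T" "u \<noteq> v" for u v
    using that decomposition_arcs_antisym decomposition_arcs_total[of u v] by auto
qed (simp_all add: finite_verts finite_decomposition_arcs)

lemma regular_decomposition_tournament: "regular_tournament (decomposition_tournament V C)"
  unfolding regular_tournament_def
proof (intro conjI exI ballI tournament_decomposition_tournament)
  let ?T = "decomposition_tournament V C"
  fix v assume "v \<in> pverts ?T"
  then have "2 * card (decomposition_arcs C `` {v}) = card V - 1" by (simp add: decomposition_arcs_regular)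
  moreover have "out_arcs (with_proj ?T) v = Pair v ` (decomposition_arcs C `` {v})"
    by (auto simp: out_arcs_def)
  then have "out_degree (with_proj ?T) v = card (decomposition_arcs C `` {v})"
    by (simp add: out_degree_def card_image inj_on_def)
  ultimately show "out_degree (with_proj ?T) v = (card V - 1) div 2" by simp
qed

lemma nu_decomposition_tournament:
  "nu k (decomposition_tournament V C) = card C" "nu_frac k (decomposition_tournament V C) = card C"
proof -
  let ?T = "decomposition_tournament V C"
  have wf: "parcs ?T \<subseteq> pverts ?T \<times> pverts ?T" using decomposition_arcs_subset by simp
  have sub: "cycle_digraph ` C \<subseteq> cycle_copies k ?T"
    using cycles unfolding cycle_copies_eq[OF wf] by (auto simp: decomposition_arcs_def)
  have "ws = ws'" if "ws \<in> C" "ws' \<in> C" "cycle_digraph ws = cycle_digraph ws'" for ws ws'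
  proof (rule ccontr)
    assume "ws \<noteq> ws'"
    then have "cycle_arcs ws = {}"
      using arcs_disjoint(1)[OF that(1,2)] that(3) by (simp add: cycle_digraph_def)
    then show False using card_cycle_arcs[of ws] cycle_props[OF that(1)] by simp
  qed
  then have "card (cycle_digraph ` C) = card C" by (intro card_image inj_onI)
  moreover have "pairwise arc_disjoint (cycle_digraph ` C)"
    using arcs_disjoint(1) by (auto simp: pairwise_def arc_disjoint_def)
  ultimately show "nu k ?T = card C" "nu_frac k ?T = card C"
    using nu_nu_frac_of_perfect_packing[OF _ wf _ sub] three_le finite_verts card_decomposition_arcs
    by simp_all
qed

lemma optimal_decomposition_tournament:
  assumes "card V = n"
  shows "optimal_tournament k n (decomposition_tournament V C)"
proof -
  have "real (card C) = real n * (real n - 1) / (2 * real k)"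
    using real_card_cycles three_le assms by (simp add: field_simps)
  then show ?thesis
    by (simp add: optimal_tournament_def regular_decomposition_tournament nu_decomposition_tournament assms)
qed

lemma tau_decomposition_tournament_ge:
  assumes qr: "quasirandom \<delta> V (decomposition_arcs C)"
    and dense: "\<forall>H. dense_in_quasirandom \<delta> \<epsilon> V H \<longrightarrow> (\<exists>ws\<in>cycles_on V k. cycle_arcs ws \<subseteq> H)"
  shows "(1 / 4 - \<epsilon>) * (real (card V))\<^sup>2 - real (card V) / 2 \<le> real (tau k (decomposition_tournament V C))"
proof -
  let ?T = "decomposition_tournament V C" and ?n = "real (card V)"
  have "real (card (parcs ?T)) - (1 / 4 + \<epsilon>) * ?n\<^sup>2 \<le> real (tau k ?T)"
  proof (rule tau_ge_of_dense_cycles)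
    fix H assume "H \<subseteq> parcs ?T" "(1 / 4 + \<epsilon>) * ?n\<^sup>2 \<le> real (card H)"
    then have "dense_in_quasirandom \<delta> \<epsilon> V H"
      using qr finite_verts decomposition_arcs_subset unfolding dense_in_quasirandom_def by auto
    then show "\<exists>ws\<in>cycles_on (pverts ?T) k. cycle_arcs ws \<subseteq> H" using dense by simp
  qed (use three_le decomposition_arcs_subset finite_decomposition_arcs in auto)
  moreover have "2 * real (card (parcs ?T)) = ?n * (?n - 1)"
    using real_card_cycles by (simp add: card_decomposition_arcs)
  ultimately show ?thesis by (simp add: power2_eq_square algebra_simps)
qed

end

theorem cycle_decomposition_exists:
  assumes k: "3 \<le> k" and p: "3 \<le> p" and V: "finite V" "card V = 2 * k * p + 1"
  shows "\<exists>C. cycle_decomposition k V C"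
proof (cases "even k")
  case True
  obtain C where "cycle_decomposition k (insert None (Some ` ({..<p} \<times> {0..<2 * int k}))) C"
    using cycle_decomposition_even[OF k True finite_lessThan] ..
  then show ?thesis
    by (rule cycle_decomposition_transfer[OF _ V(1)])
      (simp add: V(2) card_image card_cartesian_product nat_mult_distrib)
next
  case False
  obtain C where
    "cycle_decomposition k (insert None (Some ` ({0..<int p} \<times> (UNIV :: bool set) \<times> {0..<int k}))) C"
    using cycle_decomposition_odd[OF False k p] ..
  then show ?thesis
    by (rule cycle_decomposition_transfer[OF _ V(1)])
      (simp add: V(2) card_image card_cartesian_product)
qed

lemma optimal_tournament_exists:
  fixes \<epsilon> :: real
  assumes k: "3 \<le> k" and \<epsilon>: "0 < \<epsilon>"
  shows "\<forall>\<^sub>F n in sequentially. [n = 1] (mod (2 * k)) \<longrightarrow>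
    (\<exists>T :: nat pair_pre_digraph. optimal_tournament k n T \<and> (real n)\<^sup>2 / 4 - \<epsilon> * (real n)\<^sup>2 \<le> real (tau k T))"
proof -
  define \<eta> where "\<eta> = min \<epsilon> 1 / 2"
  have \<eta>: "0 < \<eta>" "\<eta> \<le> 1" "2 * \<eta> \<le> \<epsilon>" using \<epsilon> by (auto simp: \<eta>_def)
  obtain \<delta> N where \<delta>: "0 < \<delta>" and dense: "\<forall>(V :: nat set) H. dense_in_quasirandom \<delta> \<eta> V H \<longrightarrow> N \<le> card V
      \<longrightarrow> (\<exists>ws\<in>cycles_on V k. cycle_arcs ws \<subseteq> H)"
    using dense_subgraph_of_quasirandom_has_cycle[OF k \<eta>(1,2), where ?'a = nat] .
  have "\<exists>T :: nat pair_pre_digraph. optimal_tournament k n T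
      \<and> (real n)\<^sup>2 / 4 - \<epsilon> * (real n)\<^sup>2 \<le> real (tau k T)"
    if "N + (6 * k + 1) + nat \<lceil>k / \<delta>\<^sup>2\<rceil> + nat \<lceil>1 / \<epsilon>\<rceil> \<le> n" and cong: "[n = 1] (mod (2 * k))" for n
  proof -
    have n: "N \<le> n" "6 * k + 1 \<le> n" "nat \<lceil>k / \<delta>\<^sup>2\<rceil> \<le> n" "nat \<lceil>1 / \<epsilon>\<rceil> \<le> n" using that(1) by linarith+
    then have large: "1 \<le> \<epsilon> * n" "k \<le> \<delta>\<^sup>2 * n"
      using \<epsilon> \<delta> by (simp_all add: nat_ceiling_le_eq pos_divide_le_eq mult.commute)
    have "n mod (2 * k) = 1" using cong k by (simp add: unique_euclidean_semiring_class.cong_def)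
    then have "n = 2 * k * (n div (2 * k)) + 1" by (metis mult_div_mod_eq)
    moreover have "3 \<le> n div (2 * k)" using n(2) k by (simp add: less_eq_div_iff_mult_less_eq mult.commute)
    ultimately obtain C where "cycle_decomposition k {..<n} C"
      using cycle_decomposition_exists[OF k] by (metis card_lessThan finite_lessThan)
    then interpret C: cycle_decomposition k "{..<n}" C .
    obtain J where J: "quasirandom \<delta> {..<n} (decomposition_arcs (reorient J ` C))"
      using C.quasirandom_reorientation_exists[OF \<delta>] large(2) n(2) k by auto
    interpret R: cycle_decomposition k "{..<n}" "reorient J ` C" by (rule C.cycle_decomposition_reorient)
    let ?T = "decomposition_tournament {..<n} (reorient J ` C)"
    have "(1 / 4 - \<eta>) * (real n)\<^sup>2 - real n / 2 \<le> real (tau k ?T)"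
      using R.tau_decomposition_tournament_ge[OF J, of \<eta>] dense n(1) by simp
    moreover have "real n \<le> \<epsilon> * (real n)\<^sup>2"
      using mult_right_mono[OF large(1), of "real n"] by (simp add: power2_eq_square)
    moreover have "2 * \<eta> * (real n)\<^sup>2 \<le> \<epsilon> * (real n)\<^sup>2" using \<eta>(3) by (rule mult_right_mono) simp
    ultimately have "(real n)\<^sup>2 / 4 - \<epsilon> * (real n)\<^sup>2 \<le> real (tau k ?T)" by (simp add: algebra_simps)
    then show ?thesis using R.optimal_decomposition_tournament[of n] by auto
  qed
  then show ?thesis unfolding eventually_sequentially by blast
qed

section \<open>Deficits of lower order\<close>

lemma exists_smallo_deficit:
  fixes v :: "'t \<Rightarrow> nat" and g h :: "'n \<Rightarrow> real"
  assumes upper: "\<And>n t. Q n t \<Longrightarrow> real (v t) \<le> g n"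
    and lower: "\<And>\<epsilon>. 0 < \<epsilon> \<Longrightarrow> \<forall>\<^sub>F n in F. P n \<longrightarrow> (\<exists>t. Q n t \<and> g n - \<epsilon> * norm (h n) \<le> real (v t))"
  shows "\<exists>f\<in>o[F](h). \<forall>\<^sub>F n in F. P n \<longrightarrow> (\<exists>t. Q n t \<and> real (v t) = g n - f n)"
proof -
  define best where "best n = arg_max v (Q n)" for n
  define f where "f n = (if P n \<and> (\<exists>t. Q n t) then g n - real (v (best n)) else 0)" for n
  have best: "Q n (best n)" "v t \<le> v (best n)" if "Q n t" for n t
  proof -
    have "v t < nat \<lceil>g n\<rceil> + 1" if "Q n t" for t using upper[OF that] by linarith
    then show "Q n (best n)" "v t \<le> v (best n)"
      using arg_max_nat_lemma[of "Q n", OF that] that unfolding best_def by blast+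
  qed
  have "f \<in> o[F](h)"
  proof (rule landau_o.smallI)
    fix \<epsilon> :: real assume "0 < \<epsilon>"
    show "\<forall>\<^sub>F n in F. norm (f n) \<le> \<epsilon> * norm (h n)"
      using lower[OF \<open>0 < \<epsilon>\<close>]
    proof eventually_elim
      case (elim n)
      show ?case
      proof (cases "P n \<and> (\<exists>t. Q n t)")
        case True
        then obtain t where t: "Q n t" "g n - \<epsilon> * norm (h n) \<le> real (v t)" using elim by blast
        then show ?thesis using True best[OF t(1)] upper[of n "best n"] by (simp add: f_def)
      qed (use \<open>0 < \<epsilon>\<close> in \<open>auto simp: f_def\<close>)
    qed
  qed
  moreover have "\<forall>\<^sub>F n in F. P n \<longrightarrow> (\<exists>t. Q n t \<and> real (v t) = g n - f n)"
    using lower[OF zero_less_one]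
  proof eventually_elim
    case (elim n)
    then show ?case using best(1) by (auto simp: f_def intro!: exI[of _ "best n"])
  qed
  ultimately show ?thesis by blast
qed

theorem theorem1p6:
  fixes k :: nat
  assumes "k \<ge> 3"
  shows "\<exists>f :: nat \<Rightarrow> real. f \<in> o(\<lambda>n. (real n)\<^sup>2) \<and>
    (\<forall>\<^sub>F n in sequentially. [n = 1] (mod (2 * k)) \<longrightarrow>
      (\<exists>T :: nat pair_pre_digraph.
         regular_tournament T \<and> card (pverts T) = n \<and>
         real (nu k T) = nu_frac k T \<and>
         nu_frac k T = real n * (real n - 1) / (2 * real k) \<and>
         real (tau k T) = (real n)\<^sup>2 / 4 - f n))"
proof -
  have upper: "real (tau k T) \<le> (real n)\<^sup>2 / 4"
    if "optimal_tournament k n T" for n and T :: "nat pair_pre_digraph"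
    using tau_tournament_le[of k T] that assms by (auto simp: optimal_tournament_def regular_tournament_def)
  have lower: "\<forall>\<^sub>F n in sequentially. [n = 1] (mod (2 * k)) \<longrightarrow> (\<exists>T :: nat pair_pre_digraph.
      optimal_tournament k n T \<and> (real n)\<^sup>2 / 4 - \<epsilon> * norm ((real n)\<^sup>2) \<le> real (tau k T))" if "0 < \<epsilon>" for \<epsilon>
    using optimal_tournament_exists[OF assms that] by simp
  show ?thesis
    using exists_smallo_deficit[of "optimal_tournament k" "tau k", OF upper lower]
    by (auto simp: optimal_tournament_def conj_assoc)
qed

end
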